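(* Let $K=\mathbb{Z}[v^{\pm1}]$, $q=v^2$, $m\ge1$. For $w\in\Sigma_m\times\Sigma_m$ set $I_{wt_1}:=I_wb_1$. Then $\{I_x\mid x\in\Sigma_m\wr\Sigma_2\}$ is a standard basis of $\mathcal{A}(m)$, in the sense that $\overline{I_x}\in I_x+\sum_{y<x}\mathbb{Z}[v^{\pm1}]I_y$ for all $x\in\Sigma_m\wr\Sigma_2$, where $y<x$ refers to the Bruhat order inherited from $\Sigma_{2m}$.
   Context: $\mathcal{H}_q(\Sigma_{2m})$ is the $K$-algebra generated by $T_1,\dots,T_{2m-1}$ with type A braid relations and $T_i^2=(q-1)T_i+q$; $I_w:=v^{-\ell(w)}T_w$; the bar involution sends $v\mapsto v^{-1}$, $I_w\mapsto I_{w^{-1}}^{-1}$. $\Sigma_m\times\Sigma_m\subseteq\Sigma_{2m}$ is the Young subgroup generated by $s_i$, $i\ne m$; $t_1:=w_{m,m}\in\Sigma_{2m}$ sends $j\mapsto m+j$, $m+j\mapsto j$ ($1\le j\le m$); $\Sigma_m\wr\Sigma_2=(\Sigma_m\times\Sigma_m)\sqcup(\Sigma_m\times\Sigma_m)t_1\subseteq\Sigma_{2m}$. With $I_{a\to b}:=I_a\cdots I_b$ (indices decreasing if $a>b$, increasing if $a<b$), $I^+_{a\to b}=I_{a\to b}$, $I^-_{a\to b}=I_{b\to a}^{-1}$, $c_{m,0}=1$, $c_{m,i}=I_{m+i\to m+1}I_{m+1\to m+i}$, for $\epsilon\in\{\pm\}^m$ let $I_\epsilon:=I^{\epsilon_1}_{m\to2m-1}I^{\epsilon_2}_{m-1\to2m-2}\cdots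 I^{\epsilon_m}_{1\to m}$ and $C_\epsilon:=\prod_{i:\epsilon_i=-}c_{m,m-i}$. Let $H_1:=v^{m(2m-1)}\sum_\epsilon I_\epsilon C_\epsilon$, $\gamma:=\pi_m(I_{w_0^{(m)}})$ ($w_0^{(m)}$ longest in $\Sigma_m$, $\pi_m$ the shift $T_i\mapsto T_{i+m}$), and $b_1:=v^{-m(2m-1)}H_1\overline{\gamma}$. The Hu algebra $\mathcal{A}(m)$ is the subalgebra of $\mathcal{H}_q(\Sigma_{2m})$ generated by $T_i$ ($1\le i\le 2m-1$, $i\ne m$) and $H_1$. *)

theory Defs
  imports "HOL-Computational_Algebra.Formal_Laurent_Series" "HOL-Combinatorics.Permutations"
begin

type_synonym lpoly = "int fls"

definition vv :: lpoly where "vv = fls_X"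
definition vinv :: lpoly where "vinv = fls_X_inv"
definition qq :: lpoly where "qq = vv ^ 2"

definition is_lpoly :: "lpoly \<Rightarrow> bool" where
  "is_lpoly f \<longleftrightarrow> finite {k. fls_nth f k \<noteq> 0}"

definition lbar :: "lpoly \<Rightarrow> lpoly" where
  "lbar f = (\<Sum>k\<in>{k. fls_nth f k \<noteq> 0}. fls_const (fls_nth f k) * fls_X_intpow (- k))"

definition perms :: "nat \<Rightarrow> (nat \<Rightarrow> nat) set" where
  "perms n = {p. p permutes {1..n}}"

definition sw :: "nat \<Rightarrow> nat \<Rightarrow> nat \<Rightarrow> nat" where
  "sw i j = (\<lambda>k. if k = i then j else if k = j then i else k)"

definition sref :: "nat \<Rightarrow> nat \<Rightarrow> nat" where
  "sref i = sw i (Suc i)"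

definition len :: "nat \<Rightarrow> (nat \<Rightarrow> nat) \<Rightarrow> nat" where
  "len n w = card {(i, j). i \<in> {1..n} \<and> j \<in> {1..n} \<and> i < j \<and> w j < w i}"

definition bruhat_step :: "nat \<Rightarrow> (nat \<Rightarrow> nat) \<Rightarrow> (nat \<Rightarrow> nat) \<Rightarrow> bool" where
  "bruhat_step n y x \<longleftrightarrow> y \<in> perms n \<and>
     (\<exists>i j. 1 \<le> i \<and> i < j \<and> j \<le> n \<and> x = y \<circ> sw i j \<and> len n y < len n x)"

definition bruhat_le :: "nat \<Rightarrow> (nat \<Rightarrow> nat) \<Rightarrow> (nat \<Rightarrow> nat) \<Rightarrow> bool" where
  "bruhat_le n = (bruhat_step n)\<^sup>*\<^sup>*"

definition bruhat_lt :: "nat \<Rightarrow> (nat \<Rightarrow> nat) \<Rightarrow> (nat \<Rightarrow> nat) \<Rightarrow> bool" where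
  "bruhat_lt n y x \<longleftrightarrow> bruhat_le n y x \<and> y \<noteq> x"

text \<open>Elements are coefficient functions in the T-basis, supported on perms n.\<close>
type_synonym hecke = "(nat \<Rightarrow> nat) \<Rightarrow> lpoly"

definition hecke_carrier :: "nat \<Rightarrow> hecke set" where
  "hecke_carrier n = {h. \<forall>w. w \<notin> perms n \<longrightarrow> h w = 0}"

definition hzero :: hecke where "hzero = (\<lambda>w. 0)"
definition hadd :: "hecke \<Rightarrow> hecke \<Rightarrow> hecke" where "hadd h g = (\<lambda>w. h w + g w)"
definition hscale :: "lpoly \<Rightarrow> hecke \<Rightarrow> hecke" where "hscale a h = (\<lambda>w. a * h w)"
definition hsum :: "'a set \<Rightarrow> ('a \<Rightarrow> hecke) \<Rightarrow> hecke" where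
  "hsum A f = (\<lambda>w. \<Sum>x\<in>A. f x w)"

definition Tb :: "(nat \<Rightarrow> nat) \<Rightarrow> hecke" where
  "Tb w = (\<lambda>u. if u = w then 1 else 0)"

definition hone :: hecke where "hone = Tb id"

text \<open>Left multiplication by T_{s_i}: T_s T_w = T_{sw} if l(sw) > l(w),
  and T_s T_w = (q-1) T_w + q T_{sw} otherwise.\<close>
definition Tgen_mul :: "nat \<Rightarrow> nat \<Rightarrow> hecke \<Rightarrow> hecke" where
  "Tgen_mul n i g = (\<lambda>u. if len n (sref i \<circ> u) < len n u
       then g (sref i \<circ> u) + (qq - 1) * g u
       else qq * g (sref i \<circ> u))"

text \<open>Left multiplication by T_x, via T_x = T_s T_{sx} for a left descent s of x.\<close>
fun Tact :: "nat \<Rightarrow> nat \<Rightarrow> (nat \<Rightarrow> nat) \<Rightarrow> hecke \<Rightarrow> hecke" where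
  "Tact n 0 x g = g"
| "Tact n (Suc k) x g =
     (let i = (LEAST i. 1 \<le> i \<and> i < n \<and> len n (sref i \<circ> x) < len n x)
      in Tgen_mul n i (Tact n k (sref i \<circ> x) g))"

definition Tmul :: "nat \<Rightarrow> (nat \<Rightarrow> nat) \<Rightarrow> hecke \<Rightarrow> hecke" where
  "Tmul n x g = Tact n (len n x) x g"

definition hmul :: "nat \<Rightarrow> hecke \<Rightarrow> hecke \<Rightarrow> hecke" where
  "hmul n h g = hsum (perms n) (\<lambda>x. hscale (h x) (Tmul n x g))"

definition hprod :: "nat \<Rightarrow> hecke list \<Rightarrow> hecke" where
  "hprod n xs = foldr (hmul n) xs hone"

definition hinv :: "nat \<Rightarrow> hecke \<Rightarrow> hecke" where
  "hinv n h = (THE g. g \<in> hecke_carrier n \<and> hmul n h g = hone \<and> hmul n g h = hone)"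

definition Ib :: "nat \<Rightarrow> (nat \<Rightarrow> nat) \<Rightarrow> hecke" where
  "Ib n w = hscale (vinv ^ len n w) (Tb w)"

text \<open>Bar involution: sum a_w I_w maps to sum bar(a_w) (I_{w^-1})^-1.
  If h = sum c_w T_w then a_w = v^l(w) c_w.\<close>
definition hbar :: "nat \<Rightarrow> hecke \<Rightarrow> hecke" where
  "hbar n h = hsum (perms n)
     (\<lambda>w. hscale (lbar (vv ^ len n w * h w)) (hinv n (Ib n (inv w))))"

definition Ig :: "nat \<Rightarrow> nat \<Rightarrow> hecke" where
  "Ig m i = Ib (2*m) (sref i)"

definition idx :: "nat \<Rightarrow> nat \<Rightarrow> nat list" where
  "idx a b = (if a \<le> b then [a..<Suc b] else rev [b..<Suc a])"

definition Iarrow :: "nat \<Rightarrow> nat \<Rightarrow> nat \<Rightarrow> hecke" where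
  "Iarrow m a b = hprod (2*m) (map (Ig m) (idx a b))"

definition Ipm :: "nat \<Rightarrow> bool \<Rightarrow> nat \<Rightarrow> nat \<Rightarrow> hecke" where
  "Ipm m pos a b = (if pos then Iarrow m a b else hinv (2*m) (Iarrow m b a))"

definition cm :: "nat \<Rightarrow> nat \<Rightarrow> hecke" where
  "cm m i = (if i = 0 then hone
             else hmul (2*m) (Iarrow m (m+i) (m+1)) (Iarrow m (m+1) (m+i)))"

text \<open>A sign vector epsilon in {+,-}^m is encoded by the set S of indices k in {1..m}
  with epsilon_k = -.\<close>
definition Ieps :: "nat \<Rightarrow> nat set \<Rightarrow> hecke" where
  "Ieps m S = hprod (2*m) (map (\<lambda>k. Ipm m (k \<notin> S) (m + 1 - k) (2*m - k)) [1..<Suc m])"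

definition Ceps :: "nat \<Rightarrow> nat set \<Rightarrow> hecke" where
  "Ceps m S = hprod (2*m) (map (\<lambda>i. cm m (m - i)) (filter (\<lambda>i. i \<in> S) [1..<Suc m]))"

definition H1 :: "nat \<Rightarrow> hecke" where
  "H1 m = hscale (vv ^ (m * (2*m - 1)))
            (hsum (Pow {1..m}) (\<lambda>S. hmul (2*m) (Ieps m S) (Ceps m S)))"

text \<open>Longest element of Sigma_m, shifted by m (the image of w_0^(m) under pi_m).\<close>
definition w0_shift :: "nat \<Rightarrow> nat \<Rightarrow> nat" where
  "w0_shift m = (\<lambda>k. if m + 1 \<le> k \<and> k \<le> 2*m then 3*m + 1 - k else k)"

definition gamma :: "nat \<Rightarrow> hecke" where
  "gamma m = Ib (2*m) (w0_shift m)"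

definition b1 :: "nat \<Rightarrow> hecke" where
  "b1 m = hscale (vinv ^ (m * (2*m - 1))) (hmul (2*m) (H1 m) (hbar (2*m) (gamma m)))"

definition young :: "nat \<Rightarrow> (nat \<Rightarrow> nat) set" where
  "young m = {w \<in> perms (2*m). w ` {1..m} = {1..m}}"

definition t1 :: "nat \<Rightarrow> nat \<Rightarrow> nat" where
  "t1 m = (\<lambda>k. if 1 \<le> k \<and> k \<le> m then m + k else if m < k \<and> k \<le> 2*m then k - m else k)"

definition wreath :: "nat \<Rightarrow> (nat \<Rightarrow> nat) set" where
  "wreath m = young m \<union> (\<lambda>w. w \<circ> t1 m) ` young m"

definition Iw :: "nat \<Rightarrow> (nat \<Rightarrow> nat) \<Rightarrow> hecke" where
  "Iw m x = (if x \<in> young m then Ib (2*m) x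
             else hmul (2*m) (Ib (2*m) (x \<circ> t1 m)) (b1 m))"

inductive_set hu_alg :: "nat \<Rightarrow> hecke set" for m where
  gen_T: "\<lbrakk>1 \<le> i; i < 2*m; i \<noteq> m\<rbrakk> \<Longrightarrow> Tb (sref i) \<in> hu_alg m"
| gen_H1: "H1 m \<in> hu_alg m"
| one: "hone \<in> hu_alg m"
| add: "\<lbrakk>a \<in> hu_alg m; b \<in> hu_alg m\<rbrakk> \<Longrightarrow> hadd a b \<in> hu_alg m"
| mul: "\<lbrakk>a \<in> hu_alg m; b \<in> hu_alg m\<rbrakk> \<Longrightarrow> hmul (2*m) a b \<in> hu_alg m"
| scale: "\<lbrakk>is_lpoly c; a \<in> hu_alg m\<rbrakk> \<Longrightarrow> hscale c a \<in> hu_alg m"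

end

theory Submission
  imports Defs
begin

text \<open>Let \<open>g\<^sub>i = I\<^bsub>s\<^sub>i\<^esub>\<close> and \<open>R = \<Sum>\<^sub>\<epsilon> I\<^sub>\<epsilon> C\<^sub>\<epsilon>\<close>, so that \<open>b\<^sub>1 = R \<gamma>\<^sup>-\<^sup>1\<close>.

The Young subgroup \<open>\<Sigma>\<^sub>m \<times> \<Sigma>\<^sub>m\<close> induces from \<open>H(B\<^sub>m) \<otimes> H(B\<^sub>m)\<close>, with the two generators \<open>T\<^sub>0\<close>
acting by \<open>1\<close> and by \<open>-1\<close>, a type B action on \<open>H(\<Sigma>\<^bsub>2m\<^esub>)\<close> by left operators that commutes with
right multiplication by \<open>H(\<Sigma>\<^sub>m \<times> \<Sigma>\<^sub>m)\<close>. Writing \<open>\<theta>\<close> for the action of \<open>T\<^sub>0\<close>, \<open>L\<^sub>1 = \<theta>\<close>,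
\<open>L\<^bsub>k+1\<^esub> = g\<^sub>k L\<^sub>k g\<^sub>k\<close> and \<open>u\<^sub>k = (1 - L\<^sub>k) \<cdots> (1 - L\<^sub>1)\<close>, one finds \<open>R = u\<^sub>m I\<^bsub>t\<^sub>1\<^esub>\<close>; expanding the product
gives the signs \<open>\<epsilon>\<close>. Since \<open>u\<^sub>m\<close> commutes with all \<open>g\<^sub>i\<close>, \<open>i \<noteq> m\<close>, this yields
\<open>g\<^sub>i R = R g\<^bsub>i \<plusminus> m\<^esub>\<close>. The operator \<open>u\<^bsub>m+1\<^esub>\<close> vanishes on \<open>H(\<Sigma>\<^bsub>2m\<^esub>)\<close>, because among \<open>m + 1\<close> positions one belongs
to the block on which \<open>\<theta>\<close> is \<open>1\<close>; hence \<open>L\<^bsub>m+1\<^esub> R = R\<close>, and this forces \<open>R\<^sup>2 \<in> H(\<Sigma>\<^sub>m \<times> \<Sigma>\<^sub>m)\<close>.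
So \<open>A(m) = H(\<Sigma>\<^sub>m \<times> \<Sigma>\<^sub>m) + H(\<Sigma>\<^sub>m \<times> \<Sigma>\<^sub>m) b\<^sub>1\<close>.

The sum is direct because \<open>R \<equiv> I\<^bsub>t\<^sub>1\<^esub> \<Prod>\<^sub>j (1 + c\<^bsub>m,j\<^esub>)\<close> modulo the other cosets of \<open>\<Sigma>\<^sub>m \<times> \<Sigma>\<^sub>m\<close>, and
\<open>(1 + c) x = 0\<close> with \<open>c = a\<^sup>* a\<close> gives \<open>\<langle>x, x\<rangle> + \<langle>a x, a x\<rangle> = 0\<close> for the form with orthonormal basis
\<open>I\<^sub>w\<close>, hence \<open>x = 0\<close>. Finally the bar involution exchanges \<open>\<epsilon>\<close> with \<open>-\<epsilon>\<close> and inverts the commuting elements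
\<open>c\<^bsub>m,j\<^esub>\<close>, whose product is the full twist \<open>\<gamma>\<^sup>2\<close>; therefore \<open>b\<^sub>1\<close> is bar invariant, and the
triangularity reduces to that of the \<open>I\<^sub>w\<close> with \<open>w \<in> \<Sigma>\<^sub>m \<times> \<Sigma>\<^sub>m\<close>.\<close>

text \<open>The signs come from the second block: \<open>theta m\<close> sends
  \<open>asc gs 1 m\<close> to minus \<open>asc gi 1 m\<close>, so each factor 1 - L_k adds, to a
  string of generators, the string of their inverses followed by a Jucys-Murphy element. The
  laborious point is the type B braid relation between \<open>theta m\<close> and
  \<open>gs 1\<close>: it does not follow from relations of the Hecke algebra, because
  \<open>theta m\<close> is not a left multiplication.

  The passage from L_(m+1) R = R to R^2 goes through \<open>front\<close>, the span of the basis
  elements having the value 1 at a position of the first block. Modulo \<open>front\<close>,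
  \<open>theta m\<close> is -1; but it sends \<open>asc gs 1 m\<close> R to
  \<open>asc gi 1 m\<close> R. Hence (\<open>asc gs 1 m\<close> + \<open>asc gi 1 m\<close>) R lies
  in \<open>front\<close>. The innermost factor of R is this very sum, so R^2 lies in
  \<open>front\<close> too, and its commutation with the g_i, i < m, carries the conclusion from the
  value 1 to all values up to m.

  The coefficient type contains all integer Laurent series; Laurent polynomials are therefore
  tracked by separate predicates.\<close>

declare One_nat_def [simp del]

section \<open>Finitary permutations and their length\<close>

definition fperm :: "(nat \<Rightarrow> nat) \<Rightarrow> bool" where
  "fperm w \<longleftrightarrow> (\<exists>n. w \<in> perms n)"

definition Inv :: "(nat \<Rightarrow> nat) \<Rightarrow> (nat \<times> nat) set" where
  "Inv w = {(i, j). i < j \<and> w j < w i}"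

text \<open>Counting over all pairs frees the length from n; \<open>len_ell\<close> compares it with
  \<open>len n\<close>.\<close>

definition ell :: "(nat \<Rightarrow> nat) \<Rightarrow> nat" where
  "ell w = card (Inv w)"

lemma perms_permutes: "w \<in> perms n \<longleftrightarrow> w permutes {1..n}"
  by (simp add: perms_def)

lemma perms_mono: "w \<in> perms n \<Longrightarrow> n \<le> N \<Longrightarrow> w \<in> perms N"
  by (auto simp: perms_permutes intro: permutes_subset)

lemma id_perms [simp]: "id \<in> perms n"
  by (simp add: perms_permutes permutes_id)

lemma comp_perms: "u \<in> perms n \<Longrightarrow> w \<in> perms n \<Longrightarrow> u \<circ> w \<in> perms n"
  by (simp add: perms_permutes permutes_compose)

lemma inv_perms: "u \<in> perms n \<Longrightarrow> inv u \<in> perms n"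
  by (simp add: perms_permutes permutes_inv)

lemma finite_perms [simp]: "finite (perms n)"
  by (simp add: perms_def finite_permutations)

lemma sw_perms: "i \<in> {1..n} \<Longrightarrow> j \<in> {1..n} \<Longrightarrow> sw i j \<in> perms n"
  using permutes_swap_id[of i "{1..n}" j]
  by (simp add: perms_permutes sw_def[abs_def] transpose_def[abs_def])

lemma sref_perms: "1 \<le> i \<Longrightarrow> i < n \<Longrightarrow> sref i \<in> perms n"
  by (simp add: sref_def sw_perms)

lemma sw_sw [simp]: "sw i j (sw i j k) = k"
  by (simp add: sw_def)

lemma sw_comp_sw [simp]: "sw i j \<circ> sw i j = id"
  by (simp add: fun_eq_iff)

lemma sref_sref [simp]: "sref i (sref i k) = k"
  by (simp add: sref_def)

lemma sref_comp_sref [simp]: "sref i \<circ> sref i = id"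
  by (simp add: sref_def)

lemma sref_comp_cancel [simp]: "sref i \<circ> (sref i \<circ> u) = u" "(u \<circ> sref i) \<circ> sref i = u"
  by (simp_all add: fun_eq_iff)

lemma inv_sref [simp]: "inv (sref i) = sref i"
  by (rule inv_unique_comp) simp_all

lemma fperm_id [simp]: "fperm id"
  unfolding fperm_def using id_perms by blast

lemma fperm_common:
  assumes "fperm u" "fperm w"
  obtains n where "u \<in> perms n" "w \<in> perms n"
proof -
  from assms obtain a b where "u \<in> perms a" "w \<in> perms b"
    by (auto simp: fperm_def)
  then have "u \<in> perms (max a b)" "w \<in> perms (max a b)"
    by (auto intro: perms_mono)
  then show thesis by (rule that)
qed

lemma fperm_comp: "fperm u \<Longrightarrow> fperm w \<Longrightarrow> fperm (u \<circ> w)"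
  by (metis comp_perms fperm_common fperm_def)

lemma fperm_inv: "fperm u \<Longrightarrow> fperm (inv u)"
  using fperm_def inv_perms by blast

lemma fperm_bij: "fperm u \<Longrightarrow> bij u"
  by (auto simp: fperm_def perms_permutes permutes_bij)

lemma perms_fperm: "u \<in> perms n \<Longrightarrow> fperm u"
  by (auto simp: fperm_def)

lemma fperm_sref: "1 \<le> i \<Longrightarrow> fperm (sref i)"
  using sref_perms[of i "Suc i"] by (auto simp: fperm_def)

lemma fperm_0: "fperm u \<Longrightarrow> u 0 = 0"
  by (auto simp: fperm_def perms_permutes permutes_def)

lemma fperm_inj: "fperm u \<Longrightarrow> u i = u j \<longleftrightarrow> i = j"
  using fperm_bij bij_is_inj inj_eq by metis

lemma fperm_inv_f: "fperm u \<Longrightarrow> inv u (u i) = i"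
  by (simp add: fperm_bij bij_is_inj)

lemma fperm_f_inv: "fperm u \<Longrightarrow> u (inv u i) = i"
  using fperm_bij by (simp add: bij_is_surj surj_f_inv_f)

lemma inv_comp: "fperm u \<Longrightarrow> fperm w \<Longrightarrow> inv (u \<circ> w) = inv w \<circ> inv u"
  by (simp add: fperm_bij o_inv_distrib)

lemma inv_inv: "fperm u \<Longrightarrow> inv (inv u) = u"
  by (simp add: fperm_bij inv_inv_eq)

lemma perms_out: "u \<in> perms n \<Longrightarrow> n < j \<Longrightarrow> u j = j"
  by (auto simp: perms_permutes permutes_def)

lemma perms_in: "u \<in> perms n \<Longrightarrow> u j \<in> {1..n} \<longleftrightarrow> j \<in> {1..n}"
  by (simp only: perms_permutes permutes_in_image)

lemma Inv_perms:
  assumes "w \<in> perms n"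
  shows "Inv w = {(i, j). i \<in> {1..n} \<and> j \<in> {1..n} \<and> i < j \<and> w j < w i}"
proof -
  have "i \<in> {1..n} \<and> j \<in> {1..n}" if "i < j" "w j < w i" for i j
  proof -
    have w0: "w 0 = 0" using assms by (simp add: fperm_0 perms_fperm)
    then have i: "1 \<le> i" using that by (cases i) auto
    have "j \<le> n"
    proof (rule ccontr)
      assume "\<not> j \<le> n"
      then have j: "w j = j" using assms perms_out by auto
      show False
      proof (cases "i \<le> n")
        case True
        then have "w i \<le> n" using perms_in[OF assms, of i] i by auto
        then show False using that j \<open>\<not> j \<le> n\<close> by auto
      next
        case False
        then have "w i = i" using assms perms_out by auto
        then show False using that j by auto
      qed
    qed
    with i that show ?thesis by auto
  qed
  then show ?thesis by (auto simp: Inv_def)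
qed

lemma finite_Inv: assumes "fperm w" shows "finite (Inv w)"
proof -
  from assms obtain n where "w \<in> perms n" by (auto simp: fperm_def)
  then have "Inv w \<subseteq> {1..n} \<times> {1..n}" by (auto simp: Inv_perms)
  then show ?thesis by (rule finite_subset) simp
qed

lemma len_ell: "w \<in> perms n \<Longrightarrow> len n w = ell w"
  by (simp add: len_def ell_def Inv_perms)

lemma ell_id [simp]: "ell id = 0"
  proof -
  have "Inv id = {}" by (auto simp: Inv_def)
  then show ?thesis by (simp add: ell_def)
qed

lemma ell_inv: assumes "fperm w" shows "ell (inv w) = ell w"
proof -
  have "bij_betw (\<lambda>(i, j). (w j, w i)) (Inv w) (Inv (inv w))"
    by (rule bij_betwI[where g = "\<lambda>(i, j). (inv w j, inv w i)"])
      (auto simp: Inv_def fperm_inv_f[OF assms] fperm_f_inv[OF assms])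
  then show ?thesis by (simp add: ell_def bij_betw_same_card)
qed

lemma sref_less_iff:
  "\<not> (a = k \<and> b = Suc k) \<Longrightarrow> \<not> (b = k \<and> a = Suc k) \<Longrightarrow> sref k a < sref k b \<longleftrightarrow> a < b"
  by (auto simp: sref_def sw_def)

text \<open>Only the values k and k+1 are exchanged, and the order of every other pair of values is
  kept.\<close>

lemma Inv_sref_comp:
  assumes w: "fperm w" and up: "inv w k < inv w (Suc k)"
  shows "Inv (sref k \<circ> w) = insert (inv w k, inv w (Suc k)) (Inv w)"
proof -
  have wi: "w i = k \<longleftrightarrow> i = inv w k" "w i = Suc k \<longleftrightarrow> i = inv w (Suc k)" for i
    using fperm_inv_f[OF w] fperm_f_inv[OF w] by metis+
  have "(i < j \<and> sref k (w j) < sref k (w i)) \<longleftrightarrow>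
      (i = inv w k \<and> j = inv w (Suc k)) \<or> (i < j \<and> w j < w i)" for i j
  proof (cases "i = inv w k \<and> j = inv w (Suc k)")
    case True
    then show ?thesis using up by (auto simp: fperm_f_inv[OF w] sref_def sw_def)
  next
    case False
    have "sref k (w j) < sref k (w i) \<longleftrightarrow> w j < w i" if "i < j"
      using False that up by (intro sref_less_iff) (auto simp: wi)
    with False show ?thesis by auto
  qed
  then show ?thesis by (auto simp: Inv_def)
qed

lemma ell_left_up:
  assumes w: "fperm w" and up: "inv w k < inv w (Suc k)"
  shows "ell (sref k \<circ> w) = Suc (ell w)"
proof -
  have "(inv w k, inv w (Suc k)) \<notin> Inv w"
    by (auto simp: Inv_def fperm_f_inv[OF w])
  then show ?thesis
    by (simp add: ell_def Inv_sref_comp[OF assms] finite_Inv[OF w])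
qed

lemma inv_sref_comp: "fperm w \<Longrightarrow> 1 \<le> k \<Longrightarrow> inv (sref k \<circ> w) = inv w \<circ> sref k"
  by (simp add: inv_comp fperm_sref)

lemma inv_comp_sref: "fperm w \<Longrightarrow> 1 \<le> k \<Longrightarrow> inv (w \<circ> sref k) = sref k \<circ> inv w"
  by (simp add: inv_comp fperm_sref)

lemma sref_at [simp]: "sref k k = Suc k" "sref k (Suc k) = k"
  by (auto simp: sref_def sw_def)

lemma ell_left_down:
  assumes w: "fperm w" and k: "1 \<le> k" and down: "inv w (Suc k) < inv w k"
  shows "ell w = Suc (ell (sref k \<circ> w))"
proof -
  have f: "fperm (sref k \<circ> w)" using w k by (simp add: fperm_comp fperm_sref)
  have "ell (sref k \<circ> (sref k \<circ> w)) = Suc (ell (sref k \<circ> w))"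
    by (rule ell_left_up[OF f]) (simp add: inv_sref_comp w k down)
  then show ?thesis by simp
qed

lemma ell_right_up:
  assumes w: "fperm w" and k: "1 \<le> k" and up: "w k < w (Suc k)"
  shows "ell (w \<circ> sref k) = Suc (ell w)"
proof -
  have "ell (w \<circ> sref k) = ell (inv (w \<circ> sref k))"
    using w k by (simp add: ell_inv fperm_comp fperm_sref)
  also have "\<dots> = ell (sref k \<circ> inv w)" by (simp add: inv_comp_sref w k)
  also have "\<dots> = Suc (ell (inv w))"
    by (rule ell_left_up) (simp_all add: fperm_inv w inv_inv up)
  finally show ?thesis by (simp add: ell_inv w)
qed

lemma ell_right_down:
  assumes w: "fperm w" and k: "1 \<le> k" and down: "w (Suc k) < w k"
  shows "ell w = Suc (ell (w \<circ> sref k))"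
proof -
  have f: "fperm (w \<circ> sref k)" using w k by (simp add: fperm_comp fperm_sref)
  have "ell (w \<circ> sref k \<circ> sref k) = Suc (ell (w \<circ> sref k))"
    by (rule ell_right_up[OF f k]) (simp add: down)
  then show ?thesis by simp
qed

lemma left_descent_iff:
  assumes w: "fperm w" and k: "1 \<le> k"
  shows "ell (sref k \<circ> w) < ell w \<longleftrightarrow> inv w (Suc k) < inv w k"
proof -
  have "inv w k \<noteq> inv w (Suc k)" by (simp add: fperm_inj fperm_inv w)
  then consider "inv w k < inv w (Suc k)" | "inv w (Suc k) < inv w k" by linarith
  then show ?thesis
    by cases (use ell_left_up[OF w] ell_left_down[OF w k] in \<open>auto dest: less_asym\<close>)
qed

lemma perms_increasing_id:
  assumes w: "w \<in> perms n" and inc: "\<And>j. 1 \<le> j \<Longrightarrow> j < n \<Longrightarrow> w j < w (Suc j)"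
  shows "w = id"
proof
  fix j
  have lo: "j \<le> w j" if "j \<le> n" for j
    using that
  proof (induction j)
    case (Suc j)
    show ?case
    proof (cases "j = 0")
      case True
      then show ?thesis using perms_in[OF w, of "Suc j"] Suc.prems by auto
    next
      case False
      then show ?thesis using Suc inc[of j] by auto
    qed
  qed simp
  \<comment> \<open>Downward induction from n; together with \<open>lo\<close> this squeezes
    \<open>w j\<close> to j.\<close>
  have hi: "w (n - d) + d \<le> n" if "d < n" for d
    using that
  proof (induction d)
    case 0
    then show ?case using perms_in[OF w, of n] by auto
  next
    case (Suc d)
    have "w (n - Suc d) < w (Suc (n - Suc d))" using Suc.prems by (intro inc) auto
    moreover have "Suc (n - Suc d) = n - d" using Suc.prems by auto
    ultimately show ?case using Suc by auto
  qed
  show "w j = id j"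
  proof (cases "1 \<le> j \<and> j \<le> n")
    case True
    then show ?thesis using lo[of j] hi[of "n - j"] by auto
  next
    case False
    then show ?thesis using w by (auto simp: perms_permutes permutes_def)
  qed
qed

lemma right_descent_exists:
  assumes "w \<in> perms n" "w \<noteq> id"
  obtains j where "1 \<le> j" "j < n" "w (Suc j) < w j"
proof -
  have "\<exists>j. 1 \<le> j \<and> j < n \<and> \<not> w j < w (Suc j)"
    using perms_increasing_id[OF assms(1)] assms(2) by blast
  then obtain j where "1 \<le> j" "j < n" "\<not> w j < w (Suc j)" by blast
  moreover have "w j \<noteq> w (Suc j)" using fperm_inj[OF perms_fperm[OF assms(1)]] by simp
  ultimately show thesis using that by auto
qed

lemma left_descent_exists:
  assumes "w \<in> perms n" "w \<noteq> id"
  obtains j where "1 \<le> j" "j < n" "inv w (Suc j) < inv w j"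
proof -
  have "inv w \<noteq> id"
    using assms inv_inv[OF perms_fperm[OF assms(1)]] inv_id by metis
  then show thesis using right_descent_exists[OF inv_perms[OF assms(1)]] that by blast
qed

lemma perms_comp_sref: "w \<in> perms n \<Longrightarrow> 1 \<le> j \<Longrightarrow> j < n \<Longrightarrow> w \<circ> sref j \<in> perms n"
  by (simp add: comp_perms sref_perms)

lemma perms_sref_comp: "w \<in> perms n \<Longrightarrow> 1 \<le> j \<Longrightarrow> j < n \<Longrightarrow> sref j \<circ> w \<in> perms n"
  by (simp add: comp_perms sref_perms)

lemma perms_comp_sref_iff: "1 \<le> j \<Longrightarrow> j < n \<Longrightarrow> w \<circ> sref j \<in> perms n \<longleftrightarrow> w \<in> perms n"
  using perms_comp_sref[of "w \<circ> sref j" n j] perms_comp_sref by auto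

lemma perms_sref_comp_iff: "1 \<le> j \<Longrightarrow> j < n \<Longrightarrow> sref j \<circ> w \<in> perms n \<longleftrightarrow> w \<in> perms n"
  using perms_sref_comp[of "sref j \<circ> w" n j] perms_sref_comp by auto

lemma perms_right_induct [consumes 1, case_names id step]:
  assumes "w \<in> perms n" and "P id"
    and "\<And>w j. w \<in> perms n \<Longrightarrow> 1 \<le> j \<Longrightarrow> j < n \<Longrightarrow> w j < w (Suc j) \<Longrightarrow> P w \<Longrightarrow> P (w \<circ> sref j)"
  shows "P w"
  using assms(1)
proof (induction "ell w" arbitrary: w rule: less_induct)
  case less
  show ?case
  proof (cases "w = id")
    case False
    obtain j where j: "1 \<le> j" "j < n" "w (Suc j) < w j"
      using right_descent_exists[OF less.prems False] .
    have "P (w \<circ> sref j)"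
      using ell_right_down[OF perms_fperm[OF less.prems] j(1,3)] j less
      by (auto simp: perms_comp_sref)
    then have "P (w \<circ> sref j \<circ> sref j)"
      using j less.prems assms(3)[of "w \<circ> sref j" j] by (simp add: perms_comp_sref)
    then show ?thesis by simp
  qed (simp add: assms)
qed

lemma perms_left_induct [consumes 1, case_names id step]:
  assumes "w \<in> perms n" and "P id"
    and "\<And>w j. w \<in> perms n \<Longrightarrow> 1 \<le> j \<Longrightarrow> j < n \<Longrightarrow> inv w j < inv w (Suc j) \<Longrightarrow> P w \<Longrightarrow> P (sref j \<circ> w)"
  shows "P w"
proof -
  have "P (inv u)" if "u \<in> perms n" for u
    using that
  proof (induction rule: perms_right_induct)
    case id
    show ?case using assms(2) by (simp only: inv_id)
  next
    case (step u j)
    then have "P (sref j \<circ> inv u)"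
      using assms(3)[of "inv u" j] by (simp add: inv_perms inv_inv perms_fperm)
    then show ?case
      by (simp only: inv_comp_sref[OF perms_fperm[OF step(1)] step(2)])
  qed
  from this[OF inv_perms[OF assms(1)]] show ?thesis
    by (simp add: inv_inv[OF perms_fperm[OF assms(1)]])
qed

section \<open>Associativity of the Hecke multiplication\<close>

text \<open>Multiplication by T_(s_i) from the left, with descents read off \<open>inv u\<close> so
  that no n enters; \<open>rhoT\<close> is its mirror image from the right.\<close>

definition lamT :: "nat \<Rightarrow> hecke \<Rightarrow> hecke" where
  "lamT i g = (\<lambda>u. if inv u (Suc i) < inv u i then g (sref i \<circ> u) + (qq - 1) * g u
       else qq * g (sref i \<circ> u))"

definition rhoT :: "nat \<Rightarrow> hecke \<Rightarrow> hecke" where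
  "rhoT j g = (\<lambda>u. if u (Suc j) < u j then g (u \<circ> sref j) + (qq - 1) * g u
       else qq * g (u \<circ> sref j))"

lemma carrier_out: "g \<in> hecke_carrier n \<Longrightarrow> w \<notin> perms n \<Longrightarrow> g w = 0"
  by (simp add: hecke_carrier_def)

lemma carrierI: "(\<And>w. w \<notin> perms n \<Longrightarrow> g w = 0) \<Longrightarrow> g \<in> hecke_carrier n"
  by (simp add: hecke_carrier_def)

lemma carrier_hadd: "a \<in> hecke_carrier n \<Longrightarrow> b \<in> hecke_carrier n \<Longrightarrow> hadd a b \<in> hecke_carrier n"
  by (simp add: hecke_carrier_def hadd_def)

lemma carrier_hscale: "a \<in> hecke_carrier n \<Longrightarrow> hscale c a \<in> hecke_carrier n"
  by (simp add: hecke_carrier_def hscale_def)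

lemma carrier_hsum: "(\<And>x. x \<in> A \<Longrightarrow> f x \<in> hecke_carrier n) \<Longrightarrow> hsum A f \<in> hecke_carrier n"
  by (simp add: hecke_carrier_def hsum_def)

lemma carrier_Tb: "w \<in> perms n \<Longrightarrow> Tb w \<in> hecke_carrier n"
  by (auto simp: hecke_carrier_def Tb_def)

lemma carrier_hone: "hone \<in> hecke_carrier n"
  by (simp add: hone_def carrier_Tb)

lemma carrier_mono: "h \<in> hecke_carrier n \<Longrightarrow> n \<le> N \<Longrightarrow> h \<in> hecke_carrier N"
  using perms_mono by (auto simp: hecke_carrier_def)

lemma carrier_lamT: "1 \<le> i \<Longrightarrow> i < n \<Longrightarrow> a \<in> hecke_carrier n \<Longrightarrow> lamT i a \<in> hecke_carrier n"
  by (rule carrierI) (simp add: lamT_def carrier_out perms_sref_comp_iff)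

lemma carrier_rhoT: "1 \<le> i \<Longrightarrow> i < n \<Longrightarrow> a \<in> hecke_carrier n \<Longrightarrow> rhoT i a \<in> hecke_carrier n"
  by (rule carrierI) (simp add: rhoT_def carrier_out perms_comp_sref_iff)

lemma Tgen_mul_lamT:
  assumes "g \<in> hecke_carrier n" "1 \<le> i" "i < n"
  shows "Tgen_mul n i g = lamT i g"
proof
  fix u
  show "Tgen_mul n i g u = lamT i g u"
  proof (cases "u \<in> perms n")
    case True
    then show ?thesis using assms
      by (simp add: Tgen_mul_def lamT_def len_ell perms_sref_comp left_descent_iff perms_fperm)
  next
    case False
    then have "sref i \<circ> u \<notin> perms n" using assms by (simp add: perms_sref_comp_iff)
    with False show ?thesis using assms by (simp add: Tgen_mul_def lamT_def carrier_out)
  qed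
qed

lemma sref_comp_eq:
  assumes u: "fperm u" and "(inv u i = j \<and> inv u (Suc i) = Suc j) \<or> (inv u i = Suc j \<and> inv u (Suc i) = j)"
  shows "sref i \<circ> u = u \<circ> sref j"
proof
  fix k
  have ui: "u (inv u i) = i" "u (inv u (Suc i)) = Suc i" "inv u (u k) = k"
    using u by (simp_all add: fperm_inv_f fperm_f_inv)
  consider "k = inv u i" | "k = inv u (Suc i)" | "k \<noteq> inv u i" "k \<noteq> inv u (Suc i)"
    by blast
  then show "(sref i \<circ> u) k = (u \<circ> sref j) k"
  proof cases
    case 3
    then have "u k \<noteq> i" "u k \<noteq> Suc i" using ui(3) by auto
    moreover have "k \<noteq> j" "k \<noteq> Suc j" using 3 assms(2) by auto
    ultimately show ?thesis by (simp add: sref_def sw_def)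
  qed (use assms(2) ui in auto)
qed

text \<open>If s_i u = u s_j, both operators act alike on the pair u, s_i u. Otherwise multiplying
  by one generator does not affect whether the other is a descent, and the operators commute term by
  term.\<close>

lemma lamT_rhoT_fperm:
  assumes u: "fperm u" and i: "1 \<le> i" and j: "1 \<le> j"
  shows "lamT i (rhoT j a) u = rhoT j (lamT i a) u"
proof -
  let ?s = "sref i" and ?t = "sref j"
  have iu: "inv (u \<circ> ?t) = ?t \<circ> inv u" "inv (?s \<circ> u) = inv u \<circ> ?s"
    using u i j by (simp_all add: inv_comp_sref inv_sref_comp)
  have ui: "u (inv u k) = k" "inv u (u k) = k" for k
    using u by (simp_all add: fperm_inv_f fperm_f_inv)
  show ?thesis
  proof (cases "(inv u i = j \<and> inv u (Suc i) = Suc j) \<or> (inv u i = Suc j \<and> inv u (Suc i) = j)")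
    case True
    have su: "?s \<circ> u = u \<circ> ?t" by (rule sref_comp_eq[OF u True])
    have "inv u (Suc i) < inv u i \<longleftrightarrow> u (Suc j) < u j"
      using True ui(1)[of i] ui(1)[of "Suc i"] by auto
    moreover have "u (Suc j) < u j \<longleftrightarrow> inv u i = Suc j"
      using True ui(1)[of i] ui(1)[of "Suc i"] by auto
    moreover have "(u \<circ> ?t) (Suc j) < (u \<circ> ?t) j \<longleftrightarrow> \<not> u (Suc j) < u j"
      using True ui(1)[of i] ui(1)[of "Suc i"] by auto
    moreover have "inv (u \<circ> ?t) (Suc i) < inv (u \<circ> ?t) i \<longleftrightarrow> \<not> inv u (Suc i) < inv u i"
      unfolding iu using True by auto
    moreover have "?s \<circ> (u \<circ> ?t) = u" by (simp add: su[symmetric] del: comp_apply)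
    moreover have "inv u (Suc i) < inv u i \<longleftrightarrow> u (Suc j) < u j"
      using calculation by simp
    ultimately show ?thesis
      by (cases "u (Suc j) < u j") (simp_all add: lamT_def rhoT_def su del: comp_apply)
  next
    case False
    have 1: "?t (inv u (Suc i)) < ?t (inv u i) \<longleftrightarrow> inv u (Suc i) < inv u i"
      using False by (intro sref_less_iff) auto
    have 2: "?s (u (Suc j)) < ?s (u j) \<longleftrightarrow> u (Suc j) < u j"
      using False ui(2)[of j] ui(2)[of "Suc j"] by (intro sref_less_iff) auto
    show ?thesis
      unfolding lamT_def rhoT_def iu comp_apply 1 2 comp_assoc
      by (auto simp: algebra_simps simp del: comp_apply)
  qed
qed

lemma lamT_rhoT:
  assumes a: "a \<in> hecke_carrier n" and i: "1 \<le> i" "i < n" and j: "1 \<le> j" "j < n"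
  shows "lamT i (rhoT j a) = rhoT j (lamT i a)"
proof
  fix u
  show "lamT i (rhoT j a) u = rhoT j (lamT i a) u"
  proof (cases "u \<in> perms n")
    case True
    then show ?thesis using i j by (simp add: lamT_rhoT_fperm perms_fperm)
  next
    case False
    moreover have "lamT i (rhoT j a) \<in> hecke_carrier n" "rhoT j (lamT i a) \<in> hecke_carrier n"
      using assms by (simp_all add: carrier_lamT carrier_rhoT)
    ultimately show ?thesis by (simp add: carrier_out)
  qed
qed

text \<open>An operator commuting with the right action of the generators is determined by its value at
  \<open>1\<close>; this is what makes \<open>hmul\<close> associative and independent of \<open>n\<close>.\<close>
definition right_linear :: "nat \<Rightarrow> (hecke \<Rightarrow> hecke) \<Rightarrow> bool" where
  "right_linear n F \<longleftrightarrow>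
     (\<forall>a\<in>hecke_carrier n. \<forall>b\<in>hecke_carrier n. F (hadd a b) = hadd (F a) (F b)) \<and>
     (\<forall>c. \<forall>a\<in>hecke_carrier n. F (hscale c a) = hscale c (F a)) \<and>
     (\<forall>j. \<forall>a\<in>hecke_carrier n. 1 \<le> j \<longrightarrow> j < n \<longrightarrow> F (rhoT j a) = rhoT j (F a))"

lemma rhoT_Tb:
  assumes w: "fperm w" and j: "1 \<le> j" and up: "w j < w (Suc j)"
  shows "rhoT j (Tb w) = Tb (w \<circ> sref j)"
proof
  fix u
  have e: "u \<circ> sref j = w \<longleftrightarrow> u = w \<circ> sref j" by auto
  have "w \<noteq> w \<circ> sref j"
  proof
    assume "w = w \<circ> sref j"
    then have "w j = w (Suc j)" by (metis comp_apply sref_at(1))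
    with up show False by simp
  qed
  then show "rhoT j (Tb w) u = Tb (w \<circ> sref j) u"
    using up by (auto simp: rhoT_def Tb_def e)
qed

text \<open>Along a reduced word each T_w arises from 1 by right multiplications, and every element
  of the carrier is a finite combination of the T_w.\<close>

lemma right_linear_unique:
  assumes F: "right_linear n F" and G: "right_linear n G" and one: "F hone = G hone"
    and g: "g \<in> hecke_carrier n"
  shows "F g = G g"
proof -
  have T: "F (Tb w) = G (Tb w)" if "w \<in> perms n" for w
    using that
  proof (induction rule: perms_right_induct)
    case id
    show ?case using one unfolding hone_def .
  next
    case (step w j)
    have "F (rhoT j (Tb w)) = G (rhoT j (Tb w))"
      using step F G by (simp add: right_linear_def carrier_Tb)
    then show "F (Tb (w \<circ> sref j)) = G (Tb (w \<circ> sref j))"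
      using step by (simp add: rhoT_Tb perms_fperm)
  qed
  have "F (\<lambda>w. if w \<in> A then g w else 0) = G (\<lambda>w. if w \<in> A then g w else 0)"
    if "finite A" "A \<subseteq> perms n" for A
    using that
  proof (induction A rule: finite_induct)
    case empty
    have "(\<lambda>w. if w \<in> {} then g w else 0) = hscale 0 hone" by (simp add: hscale_def)
    moreover have "F (hscale 0 hone) = G (hscale 0 hone)"
      using F G one by (simp add: right_linear_def carrier_hone)
    ultimately show ?case by simp
  next
    case (insert a A)
    let ?h = "\<lambda>w. if w \<in> A then g w else 0"
    have e: "(\<lambda>w. if w \<in> insert a A then g w else 0) = hadd (hscale (g a) (Tb a)) ?h"
      using insert.hyps by (auto simp: hadd_def hscale_def Tb_def)
    have "?h \<in> hecke_carrier n" "hscale (g a) (Tb a) \<in> hecke_carrier n" "Tb a \<in> hecke_carrier n"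
      using insert.prems by (auto intro!: carrierI carrier_hscale carrier_Tb)
    then show ?case
      unfolding e using F G T[of a] insert by (simp add: right_linear_def)
  qed
  from this[of "perms n"]
  have "F (\<lambda>w. if w \<in> perms n then g w else 0) = G (\<lambda>w. if w \<in> perms n then g w else 0)"
    by simp
  moreover have "(\<lambda>w. if w \<in> perms n then g w else 0) = g"
    using g by (auto simp: carrier_out)
  ultimately show ?thesis by simp
qed

lemma right_linear_lamT: "1 \<le> i \<Longrightarrow> i < n \<Longrightarrow> right_linear n (lamT i)"
  by (auto simp: right_linear_def lamT_rhoT) (auto simp: lamT_def hadd_def hscale_def algebra_simps)

lemma rhoT_hscale: "rhoT j (hscale c a) = hscale c (rhoT j a)"
  by (auto simp: rhoT_def hscale_def algebra_simps)

lemma rhoT_hsum: "rhoT j (hsum A f) = hsum A (\<lambda>x. rhoT j (f x))"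
  by (auto simp: rhoT_def hsum_def sum.distrib sum_distrib_left)

lemma right_linear_comp:
  assumes "right_linear n F" "right_linear n G" "\<And>a. a \<in> hecke_carrier n \<Longrightarrow> G a \<in> hecke_carrier n"
  shows "right_linear n (\<lambda>x. F (G x))"
  using assms by (simp add: right_linear_def)

lemma right_linear_mono: "right_linear N F \<Longrightarrow> n \<le> N \<Longrightarrow> right_linear n F"
  by (auto simp: right_linear_def carrier_mono)

text \<open>The index chosen by \<open>Tact\<close> is a genuine left descent, so its counter
  \<open>len n x\<close> matches the length of the word that it unfolds.\<close>

lemma Least_descent:
  assumes x: "x \<in> perms n" and "len n x \<noteq> 0"
  defines "i \<equiv> LEAST i. 1 \<le> i \<and> i < n \<and> len n (sref i \<circ> x) < len n x"
  shows "1 \<le> i" "i < n" "inv x (Suc i) < inv x i" "Suc (len n (sref i \<circ> x)) = len n x"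
proof -
  have "x \<noteq> id" using assms by (auto simp: len_ell)
  then obtain j where j: "1 \<le> j" "j < n" "inv x (Suc j) < inv x j"
    using left_descent_exists[OF x] by blast
  have "1 \<le> j \<and> j < n \<and> len n (sref j \<circ> x) < len n x"
    using j x by (simp add: len_ell perms_sref_comp left_descent_iff perms_fperm)
  then have i: "1 \<le> i \<and> i < n \<and> len n (sref i \<circ> x) < len n x"
    unfolding i_def by (rule LeastI)
  then show "1 \<le> i" "i < n" by auto
  show d: "inv x (Suc i) < inv x i"
    using i left_descent_iff[OF perms_fperm[OF x], of i] len_ell[OF x]
      len_ell[OF perms_sref_comp[OF x], of i] by simp
  show "Suc (len n (sref i \<circ> x)) = len n x"
    using i ell_left_down[OF perms_fperm[OF x] _ d] len_ell[OF x]
      len_ell[OF perms_sref_comp[OF x], of i] by simp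
qed

lemma lamT_Tb:
  assumes x: "fperm x" and i: "1 \<le> i" and down: "inv x (Suc i) < inv x i"
  shows "lamT i (Tb (sref i \<circ> x)) = Tb x"
proof
  fix u
  have e: "sref i \<circ> u = sref i \<circ> x \<longleftrightarrow> u = x" "u = sref i \<circ> x \<longleftrightarrow> sref i \<circ> u = x"
    by (metis sref_comp_cancel(1))+
  have "sref i \<circ> x \<noteq> x"
  proof
    assume "sref i \<circ> x = x"
    then have "sref i (x (inv x i)) = x (inv x i)" by (metis comp_apply)
    then show False using x by (simp add: fperm_f_inv)
  qed
  then have "sref i \<circ> x = u \<Longrightarrow> u \<noteq> x" by auto
  then show "lamT i (Tb (sref i \<circ> x)) u = Tb x u"
    using down inv_sref_comp[OF x i] by (auto simp: lamT_def Tb_def e(1))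
qed

lemma Tact_props:
  assumes "x \<in> perms n" "len n x = k"
  shows "right_linear n (Tact n k x) \<and> (\<forall>g\<in>hecke_carrier n. Tact n k x g \<in> hecke_carrier n)
     \<and> Tact n k x hone = Tb x"
  using assms
proof (induction k arbitrary: x)
  case 0
  have "x = id"
  proof (rule ccontr)
    assume "x \<noteq> id"
    then obtain j where "1 \<le> j" "j < n" "inv x (Suc j) < inv x j"
      using left_descent_exists[OF 0(1)] by blast
    then show False
      using 0 ell_left_down[OF perms_fperm[OF 0(1)]] by (simp add: len_ell)
  qed
  show ?case unfolding \<open>x = id\<close> by (simp add: right_linear_def hone_def del: id_apply)
next
  case (Suc k)
  define i where "i = (LEAST i. 1 \<le> i \<and> i < n \<and> len n (sref i \<circ> x) < len n x)"
  have "len n x \<noteq> 0" using Suc.prems(2) by simp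
  note i = Least_descent[OF Suc.prems(1) this, folded i_def]
  define y where "y = sref i \<circ> x"
  have y: "y \<in> perms n" "len n y = k" "Suc (ell y) = ell x"
    using i Suc.prems perms_sref_comp[OF Suc.prems(1) i(1,2)] by (simp_all add: y_def len_ell)
  have IH: "right_linear n (Tact n k y)" "Tact n k y hone = Tb y"
    "\<And>g. g \<in> hecke_carrier n \<Longrightarrow> Tact n k y g \<in> hecke_carrier n"
    using Suc.IH[OF y(1,2)] by auto
  have S: "Tact n (Suc k) x g = Tgen_mul n i (Tact n k y g)" for g
    by (subst Tact.simps(2)) (simp only: y_def i_def Let_def)
  have T: "Tact n (Suc k) x g = lamT i (Tact n k y g)" if "g \<in> hecke_carrier n" for g
    unfolding S using that IH(3) i by (simp add: Tgen_mul_lamT)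
  have "right_linear n (\<lambda>g. lamT i (Tact n k y g))"
    by (rule right_linear_comp[OF right_linear_lamT[OF i(1,2)] IH(1,3)])
  moreover have "hadd a b \<in> hecke_carrier n" "hscale c a \<in> hecke_carrier n"
    "1 \<le> j \<Longrightarrow> j < n \<Longrightarrow> rhoT j a \<in> hecke_carrier n"
    if "a \<in> hecke_carrier n" "b \<in> hecke_carrier n" for a b c j
    using that by (auto intro: carrier_hadd carrier_hscale carrier_rhoT)
  ultimately have "right_linear n (Tact n (Suc k) x)"
    unfolding right_linear_def by (simp add: T del: Tact.simps)
  moreover have "Tact n (Suc k) x hone = Tb x"
    using T[OF carrier_hone] IH(2) lamT_Tb[OF perms_fperm[OF Suc.prems(1)] i(1,3)]
    by (simp only: y_def)
  moreover have "Tact n (Suc k) x g \<in> hecke_carrier n" if "g \<in> hecke_carrier n" for g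
    unfolding T[OF that] by (intro carrier_lamT i IH(3) that)
  ultimately show ?case by blast
qed

lemma Tmul_props:
  assumes "x \<in> perms n"
  shows "right_linear n (Tmul n x)" "g \<in> hecke_carrier n \<Longrightarrow> Tmul n x g \<in> hecke_carrier n"
     "Tmul n x hone = Tb x"
  using Tact_props[OF assms refl] unfolding Tmul_def[abs_def] by auto

lemma carrier_hmul: "g \<in> hecke_carrier n \<Longrightarrow> hmul n h g \<in> hecke_carrier n"
  unfolding hmul_def by (intro carrier_hsum carrier_hscale Tmul_props)

lemma right_linear_hmul: "right_linear n (hmul n h)"
proof -
  have "hmul n h (hadd a b) = hadd (hmul n h a) (hmul n h b)"
    if "a \<in> hecke_carrier n" "b \<in> hecke_carrier n" for a b
  proof -
    have "Tmul n x (hadd a b) = hadd (Tmul n x a) (Tmul n x b)" if "x \<in> perms n" for x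
      using Tmul_props(1)[OF that] \<open>a \<in> _\<close> \<open>b \<in> _\<close> by (simp add: right_linear_def)
    then show ?thesis
      by (simp add: hmul_def hsum_def hadd_def hscale_def distrib_left sum.distrib)
  qed
  moreover have "hmul n h (hscale c a) = hscale c (hmul n h a)" if "a \<in> hecke_carrier n" for a c
  proof -
    have "Tmul n x (hscale c a) = hscale c (Tmul n x a)" if "x \<in> perms n" for x
      using Tmul_props(1)[OF that] \<open>a \<in> _\<close> by (simp add: right_linear_def)
    then show ?thesis
      by (simp add: hmul_def hsum_def hscale_def sum_distrib_left mult.left_commute)
  qed
  moreover have "hmul n h (rhoT j a) = rhoT j (hmul n h a)"
    if "a \<in> hecke_carrier n" "1 \<le> j" "j < n" for j a
  proof -
    have "Tmul n x (rhoT j a) = rhoT j (Tmul n x a)" if "x \<in> perms n" for x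
      using Tmul_props(1)[OF that] \<open>a \<in> _\<close> \<open>1 \<le> j\<close> \<open>j < n\<close> by (simp add: right_linear_def)
    then show ?thesis
      by (simp add: hmul_def rhoT_hsum rhoT_hscale) (simp add: hsum_def)
  qed
  ultimately show ?thesis by (simp add: right_linear_def)
qed

lemma hmul_hone_right: "h \<in> hecke_carrier n \<Longrightarrow> hmul n h hone = h"
proof
  fix w
  assume h: "h \<in> hecke_carrier n"
  have "hmul n h hone w = (\<Sum>x\<in>perms n. h x * Tb x w)"
    by (simp add: hmul_def hsum_def hscale_def Tmul_props(3))
  also have "\<dots> = (\<Sum>x\<in>perms n. if w = x then h x else 0)"
    by (rule sum.cong) (auto simp: Tb_def)
  also have "\<dots> = h w" using h by (simp add: carrier_out)
  finally show "hmul n h hone w = h w" .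
qed

lemma hmul_unique:
  assumes "right_linear n F" "h \<in> hecke_carrier n" "F hone = h" "g \<in> hecke_carrier n"
  shows "hmul n h g = F g"
  using right_linear_unique[OF right_linear_hmul assms(1)] assms by (simp add: hmul_hone_right)

lemma hmul_hone_left: "g \<in> hecke_carrier n \<Longrightarrow> hmul n hone g = g"
  by (rule hmul_unique) (auto simp: right_linear_def carrier_hone)

lemma hmul_assoc:
  assumes "a \<in> hecke_carrier n" "b \<in> hecke_carrier n" "c \<in> hecke_carrier n"
  shows "hmul n (hmul n a b) c = hmul n a (hmul n b c)"
proof (rule hmul_unique)
  \<comment> \<open>As functions of the last factor both products commute with the right action, and
    at 1 both give the product of a and b.\<close>
  show "right_linear n (\<lambda>x. hmul n a (hmul n b x))"
    by (rule right_linear_comp[OF right_linear_hmul right_linear_hmul carrier_hmul])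
qed (use assms in \<open>simp_all add: carrier_hmul hmul_hone_right\<close>)

lemma hmul_hadd_right:
  "a \<in> hecke_carrier n \<Longrightarrow> b \<in> hecke_carrier n \<Longrightarrow> hmul n h (hadd a b) = hadd (hmul n h a) (hmul n h b)"
  using right_linear_hmul[of n h] by (simp add: right_linear_def)

lemma hmul_hscale_right:
  "a \<in> hecke_carrier n \<Longrightarrow> hmul n h (hscale c a) = hscale c (hmul n h a)"
  using right_linear_hmul[of n h] by (simp add: right_linear_def)

lemma hmul_hadd_left: "hmul n (hadd a b) h = hadd (hmul n a h) (hmul n b h)"
  by (rule ext) (simp add: hmul_def hsum_def hadd_def hscale_def distrib_right sum.distrib)

lemma hmul_hscale_left: "hmul n (hscale c a) h = hscale c (hmul n a h)"
  by (simp add: hmul_def hsum_def hscale_def sum_distrib_left mult.assoc)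

text \<open>\<open>hmul N h\<close> is right linear also at the lower level and has the value h at
  1, which characterises \<open>hmul n h\<close>.\<close>

lemma hmul_mono:
  assumes "h \<in> hecke_carrier n" "g \<in> hecke_carrier n" "n \<le> N"
  shows "hmul N h g = hmul n h g"
proof -
  have "hmul n h g = hmul N h g"
    using assms
    by (intro hmul_unique[OF right_linear_mono[OF right_linear_hmul \<open>n \<le> N\<close>]]
        hmul_hone_right[OF carrier_mono]) auto
  then show ?thesis by simp
qed

lemma hmul_Tb_sref_left:
  assumes "g \<in> hecke_carrier n" "1 \<le> i" "i < n"
  shows "hmul n (Tb (sref i)) g = lamT i g"
proof (rule hmul_unique)
  show "lamT i hone = Tb (sref i)"
    using lamT_Tb[of "sref i" i] assms by (simp add: fperm_sref hone_def)
qed (use assms in \<open>auto simp: right_linear_lamT carrier_Tb sref_perms\<close>)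

lemma hmul_Tb_sref_right:
  assumes "g \<in> hecke_carrier n" "1 \<le> j" "j < n"
  shows "hmul n g (Tb (sref j)) = rhoT j g"
proof -
  have "Tb (sref j) = rhoT j hone"
    using rhoT_Tb[of id j] assms by (simp add: hone_def)
  then show ?thesis
    using right_linear_hmul[of n g] assms by (simp add: right_linear_def carrier_hone hmul_hone_right)
qed

section \<open>Laurent polynomials and the Hecke algebra of all finitary permutations\<close>

lemma vv_vinv [simp]: "vv * vinv = 1" "vinv * vv = 1"
  by (rule fls_eqI, simp add: vv_def vinv_def fls_X_times_conv_shift fls_X_inv_times_conv_shift)+

lemma vv_nonzero [simp]: "vv \<noteq> 0"
  using vv_vinv by force

lemma vv_vinv_power [simp]: "vv ^ k * vinv ^ k = 1" "vinv ^ k * vv ^ k = 1"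
  by (simp_all add: power_mult_distrib[symmetric])

lemma vv_vinv_power_mult [simp]: "vv ^ k * (vinv ^ k * c) = c" "vinv ^ k * (vv ^ k * c) = c"
  by (simp_all add: mult.assoc[symmetric])

text \<open>The parameter of the normalised quadratic relation g_i^2 = 1 + \<open>zz\<close> g_i;
  the bar involution changes its sign.\<close>

definition zz :: lpoly where "zz = vv - vinv"

lemma nth_vv_mult [simp]: "fls_nth (vv * f) k = fls_nth f (k - 1)"
  by (simp add: vv_def fls_X_times_conv_shift)

lemma nth_vinv_mult [simp]: "fls_nth (vinv * f) k = fls_nth f (k + 1)"
  by (simp add: vinv_def fls_X_inv_times_conv_shift)

lemma is_lpoly_0 [simp]: "is_lpoly 0" by (simp add: is_lpoly_def)

lemma is_lpoly_const: "is_lpoly (fls_const c)"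
  unfolding is_lpoly_def by (rule finite_subset[of _ "{0}"]) auto

lemma is_lpoly_1 [simp]: "is_lpoly 1"
  using is_lpoly_const[of 1] by simp

lemma is_lpoly_add: assumes "is_lpoly f" "is_lpoly g" shows "is_lpoly (f + g)"
  unfolding is_lpoly_def
  by (rule finite_subset[of _ "{k. fls_nth f k \<noteq> 0} \<union> {k. fls_nth g k \<noteq> 0}"])
    (use assms in \<open>auto simp: is_lpoly_def\<close>)

lemma is_lpoly_uminus: "is_lpoly f \<Longrightarrow> is_lpoly (- f)"
  by (simp add: is_lpoly_def)

lemma is_lpoly_diff: "is_lpoly f \<Longrightarrow> is_lpoly g \<Longrightarrow> is_lpoly (f - g)"
  using is_lpoly_add[of f "- g"] is_lpoly_uminus by simp

lemma is_lpoly_sum: "(\<And>x. x \<in> A \<Longrightarrow> is_lpoly (f x)) \<Longrightarrow> is_lpoly (sum f A)"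
  by (induction A rule: infinite_finite_induct) (auto intro: is_lpoly_add)

lemma is_lpoly_mult: assumes "is_lpoly f" "is_lpoly g" shows "is_lpoly (f * g)"
  unfolding is_lpoly_def
proof (rule finite_subset)
  show "finite ((\<lambda>(a, b). a + b) ` ({k. fls_nth f k \<noteq> 0} \<times> {k. fls_nth g k \<noteq> 0}))"
    using assms by (simp add: is_lpoly_def)
  show "{k. fls_nth (f * g) k \<noteq> 0} \<subseteq>
      (\<lambda>(a, b). a + b) ` ({k. fls_nth f k \<noteq> 0} \<times> {k. fls_nth g k \<noteq> 0})"
  proof
    fix n
    assume "n \<in> {k. fls_nth (f * g) k \<noteq> 0}"
    then have "(\<Sum>i=fls_subdegree f..n - fls_subdegree g. fls_nth f i * fls_nth g (n - i)) \<noteq> 0"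
      by (simp add: fls_times_nth(2))
    then obtain i where "fls_nth f i * fls_nth g (n - i) \<noteq> 0"
      by (meson sum.not_neutral_contains_not_neutral)
    then show "n \<in> (\<lambda>(a, b). a + b) ` ({k. fls_nth f k \<noteq> 0} \<times> {k. fls_nth g k \<noteq> 0})"
      by (intro image_eqI[of _ _ "(i, n - i)"]) auto
  qed
qed

lemma is_lpoly_vv [simp]: "is_lpoly vv" "is_lpoly vinv"
  unfolding is_lpoly_def vv_def vinv_def
  by (rule finite_subset[of _ "{1}"] finite_subset[of _ "{-1}"]; auto)+

lemma is_lpoly_power: "is_lpoly f \<Longrightarrow> is_lpoly (f ^ k)"
  by (induction k) (auto intro: is_lpoly_mult)

lemma is_lpoly_zz [simp]: "is_lpoly zz"
  by (simp add: zz_def is_lpoly_diff)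

lemma fls_nth_sum: "fls_nth (sum f A) k = (\<Sum>x\<in>A. fls_nth (f x) k)"
  by (induction A rule: infinite_finite_induct) auto

lemma nth_lbar: assumes "is_lpoly f" shows "fls_nth (lbar f) k = fls_nth f (- k)"
proof -
  have "fls_nth (lbar f) k = (\<Sum>j\<in>{j. fls_nth f j \<noteq> 0}. if k = - j then fls_nth f j else 0)"
    unfolding lbar_def fls_nth_sum by (rule sum.cong) (auto simp: fls_X_intpow_times_conv_shift)
  also have "\<dots> = (\<Sum>j\<in>{j. fls_nth f j \<noteq> 0}. if j = - k then fls_nth f (- k) else 0)"
    by (rule sum.cong) auto
  also have "\<dots> = fls_nth f (- k)"
    using assms by (simp add: is_lpoly_def)
  finally show ?thesis .
qed

lemma lbar_add: "is_lpoly f \<Longrightarrow> is_lpoly g \<Longrightarrow> lbar (f + g) = lbar f + lbar g"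
  by (rule fls_eqI) (simp add: nth_lbar is_lpoly_add)

lemma lbar_0 [simp]: "lbar 0 = 0"
  by (rule fls_eqI) (simp add: nth_lbar)

lemma lbar_1 [simp]: "lbar 1 = 1"
  by (rule fls_eqI) (simp add: nth_lbar)

lemma lbar_zz_mult: "is_lpoly f \<Longrightarrow> lbar (zz * f) = - zz * lbar f"
  by (rule fls_eqI) (simp add: nth_lbar zz_def left_diff_distrib is_lpoly_diff is_lpoly_mult)

text \<open>Working in the union of the Hecke algebras over all \<open>n\<close> gives a single type of class
  \<^class>\<open>ring_1\<close>.\<close>
typedef hk = "{h. \<exists>n. h \<in> hecke_carrier n}" morphisms cf Abs_hk
  using carrier_hone by blast

definition supported :: "nat \<Rightarrow> hk \<Rightarrow> bool" where
  "supported n x \<longleftrightarrow> cf x \<in> hecke_carrier n"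

lemma supported_ex: "\<exists>n. supported n x"
  using cf[of x] by (auto simp: supported_def)

lemma supported_mono: "supported n x \<Longrightarrow> n \<le> N \<Longrightarrow> supported N x"
  by (simp add: supported_def carrier_mono)

lemma supported_common:
  obtains n where "supported n x" "supported n y" "supported n t"
proof -
  obtain a b c where "supported a x" "supported b y" "supported c t"
    using supported_ex by blast
  then have "supported (max a (max b c)) x" "supported (max a (max b c)) y" "supported (max a (max b c)) t"
    by (auto elim: supported_mono)
  then show thesis by (rule that)
qed

lemma cf_Abs: "h \<in> hecke_carrier n \<Longrightarrow> cf (Abs_hk h) = h"
  by (rule Abs_hk_inverse) blast

lemma supported_Abs: "h \<in> hecke_carrier n \<Longrightarrow> supported n (Abs_hk h)"
  by (simp add: supported_def cf_Abs)

instantiation hk :: ring_1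
begin

definition zero_hk :: hk where "0 = Abs_hk hzero"
definition one_hk :: hk where "1 = Abs_hk hone"
definition plus_hk :: "hk \<Rightarrow> hk \<Rightarrow> hk" where "x + y = Abs_hk (hadd (cf x) (cf y))"
definition uminus_hk :: "hk \<Rightarrow> hk" where "- x = Abs_hk (hscale (- 1) (cf x))"
definition minus_hk :: "hk \<Rightarrow> hk \<Rightarrow> hk" where "x - y = x + (- (y :: hk))"
text \<open>By \<open>hmul_mono\<close> every common level gives the same product; the least one is
  merely a definite choice.\<close>

definition times_hk :: "hk \<Rightarrow> hk \<Rightarrow> hk" where
  "x * y = Abs_hk (hmul (LEAST n. supported n x \<and> supported n y) (cf x) (cf y))"

lemma cf_zero: "cf 0 = hzero"
  unfolding zero_hk_def by (rule cf_Abs[of _ 0]) (simp add: hzero_def carrierI)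

lemma cf_one: "cf 1 = hone"
  unfolding one_hk_def by (rule cf_Abs[OF carrier_hone])

lemma cf_plus: "cf (x + y) = hadd (cf x) (cf y)"
proof -
  obtain n where "supported n x" "supported n y" using supported_common by blast
  then show ?thesis unfolding plus_hk_def supported_def by (intro cf_Abs carrier_hadd)
qed

lemma cf_uminus: "cf (- x) = hscale (- 1) (cf x)"
  unfolding uminus_hk_def using supported_ex[of x] cf_Abs carrier_hscale supported_def by blast

lemma cf_times:
  assumes "supported n x" "supported n y"
  shows "cf (x * y) = hmul n (cf x) (cf y)"
proof -
  define k where "k = (LEAST n. supported n x \<and> supported n y)"
  have k: "supported k x" "supported k y"
    using LeastI[of "\<lambda>n. supported n x \<and> supported n y" n] assms by (auto simp: k_def)
  have "k \<le> n" unfolding k_def by (rule Least_le) (use assms in simp)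
  then have "hmul n (cf x) (cf y) = hmul k (cf x) (cf y)"
    using k by (intro hmul_mono) (auto simp: supported_def)
  moreover have "cf (x * y) = hmul k (cf x) (cf y)"
    unfolding times_hk_def k_def[symmetric]
    by (rule cf_Abs[OF carrier_hmul]) (use k in \<open>simp add: supported_def\<close>)
  ultimately show ?thesis by simp
qed

lemma supported_times: "supported n x \<Longrightarrow> supported n y \<Longrightarrow> supported n (x * y)"
  unfolding supported_def[of _ "x * y"] by (simp add: cf_times) (simp add: supported_def carrier_hmul)

lemma supported_plus: "supported n x \<Longrightarrow> supported n y \<Longrightarrow> supported n (x + y)"
  by (simp add: supported_def cf_plus carrier_hadd)

lemma supported_one: "supported n 1"
  by (simp add: supported_def cf_one carrier_hone)

instance
proof
  fix a b c :: hk
  show "a * b * c = a * (b * c)"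
  proof -
    obtain n where n: "supported n a" "supported n b" "supported n c" using supported_common by blast
    then show ?thesis
      unfolding cf_inject[symmetric]
      by (simp add: cf_times[of n] supported_times hmul_assoc supported_def[symmetric] 
          hmul_assoc[of "cf a" n "cf b" "cf c"] n[unfolded supported_def])
  qed
  show "(a + b) * c = a * c + b * c"
  proof -
    obtain n where n: "supported n a" "supported n b" "supported n c" using supported_common by blast
    then show ?thesis
      unfolding cf_inject[symmetric]
      by (simp add: cf_times[of n] supported_plus cf_plus hmul_hadd_left)
  qed
  show "a * (b + c) = a * b + a * c"
  proof -
    obtain n where n: "supported n a" "supported n b" "supported n c" using supported_common by blast
    then show ?thesis
      unfolding cf_inject[symmetric]
      by (simp add: cf_times[of n] supported_plus cf_plus hmul_hadd_right n[unfolded supported_def])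
  qed
  show "1 * a = a"
  proof -
    obtain n where n: "supported n a" using supported_ex by blast
    then show ?thesis
      unfolding cf_inject[symmetric]
      by (simp add: cf_times[of n] supported_one cf_one hmul_hone_left n[unfolded supported_def])
  qed
  show "a * 1 = a"
  proof -
    obtain n where n: "supported n a" using supported_ex by blast
    then show ?thesis
      unfolding cf_inject[symmetric]
      by (simp add: cf_times[of n] supported_one cf_one hmul_hone_right n[unfolded supported_def])
  qed
  show "a + b + c = a + (b + c)" "a + b = b + a" "0 + a = a" "- a + a = 0" "a - b = a + - b"
    unfolding cf_inject[symmetric]
    by (simp_all add: cf_plus cf_zero cf_uminus minus_hk_def)
      (auto simp: hadd_def hzero_def hscale_def)
  have "hone id \<noteq> hzero id" by (simp add: hone_def Tb_def hzero_def)
  then show "(0 :: hk) \<noteq> 1"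
    unfolding cf_inject[symmetric] cf_zero cf_one by metis
qed

end

lemma cf_out: "\<not> fperm w \<Longrightarrow> cf x w = 0"
  using supported_ex[of x] by (auto simp: supported_def fperm_def hecke_carrier_def)

lemma cf_sum: "cf (sum f A) w = (\<Sum>x\<in>A. cf (f x) w)"
  by (induction A rule: infinite_finite_induct) (auto simp: cf_zero cf_plus hzero_def hadd_def)

definition sc :: "lpoly \<Rightarrow> hk" where
  "sc c = Abs_hk (hscale c hone)"

lemma cf_sc: "cf (sc c) = hscale c hone"
  unfolding sc_def by (rule cf_Abs[OF carrier_hscale[OF carrier_hone[of 0]]])

lemma supported_sc: "supported n (sc c)"
  unfolding supported_def cf_sc by (intro carrier_hscale carrier_hone)

lemma cf_sc_mult: "cf (sc c * x) = hscale c (cf x)"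
proof -
  obtain n where "supported n x" using supported_ex by blast
  then show ?thesis
    by (simp add: cf_times[OF supported_sc] cf_sc hmul_hscale_left hmul_hone_left supported_def)
qed

lemma sc_central: "x * sc c = sc c * x"
proof -
  obtain n where "supported n x" using supported_ex by blast
  then have "cf (x * sc c) = hscale c (cf x)"
    by (simp add: cf_times[OF _ supported_sc] cf_sc hmul_hscale_right carrier_hone hmul_hone_right supported_def)
  then show ?thesis by (simp add: cf_inject[symmetric] cf_sc_mult)
qed

lemma sc_0 [simp]: "sc 0 = 0"
  unfolding cf_inject[symmetric] cf_sc cf_zero by (simp add: hscale_def hzero_def)

lemma sc_1 [simp]: "sc 1 = 1"
  unfolding cf_inject[symmetric] cf_sc cf_one by (simp add: hscale_def)

lemma sc_add: "sc (a + b) = sc a + sc b"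
  unfolding cf_inject[symmetric] cf_plus cf_sc by (simp add: hscale_def hadd_def distrib_right)

lemma sc_mult: "sc (a * b) = sc a * sc b"
  unfolding cf_inject[symmetric] cf_sc_mult cf_sc by (simp add: hscale_def mult.assoc)

lemma sc_uminus: "sc (- a) = - sc a"
  unfolding cf_inject[symmetric] cf_uminus cf_sc by (simp add: hscale_def)

text \<open>Coefficients with respect to the basis \<open>I\<^sub>w\<close>, written \<open>bI w\<close> below.\<close>
definition co :: "hk \<Rightarrow> (nat \<Rightarrow> nat) \<Rightarrow> lpoly" where
  "co x w = vv ^ ell w * cf x w"

lemma co_out: "\<not> fperm w \<Longrightarrow> co x w = 0"
  by (simp add: co_def cf_out)

lemma co_0 [simp]: "co 0 w = 0"
  by (simp add: co_def cf_zero hzero_def)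

lemma co_add [simp]: "co (x + y) w = co x w + co y w"
  by (simp add: co_def cf_plus hadd_def distrib_left)

lemma co_uminus [simp]: "co (- x) w = - co x w"
  by (simp add: co_def cf_uminus hscale_def)

lemma co_diff [simp]: "co (x - y) w = co x w - co y w"
  using co_add[of x "- y" w] by simp

lemma co_sum: "co (sum f A) w = (\<Sum>x\<in>A. co (f x) w)"
  by (induction A rule: infinite_finite_induct) auto

lemma co_sc_mult [simp]: "co (sc c * x) w = c * co x w"
  by (simp add: co_def cf_sc_mult hscale_def)

lemma hk_eqI: assumes "\<And>w. fperm w \<Longrightarrow> co x w = co y w" shows "x = y"
proof -
  have "vinv ^ ell w * co x w = vinv ^ ell w * co y w" if "fperm w" for w
    using assms[OF that] by simp
  then have "cf x w = cf y w" for w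
    by (cases "fperm w") (simp_all add: co_def cf_out)
  then show ?thesis unfolding cf_inject[symmetric] by (rule ext)
qed

definition bI :: "(nat \<Rightarrow> nat) \<Rightarrow> hk" where
  "bI w = Abs_hk (hscale (vinv ^ ell w) (Tb w))"

lemma cf_bI: "fperm w \<Longrightarrow> cf (bI w) = hscale (vinv ^ ell w) (Tb w)"
  unfolding bI_def fperm_def using cf_Abs carrier_hscale carrier_Tb by blast

lemma supported_bI: "w \<in> perms n \<Longrightarrow> supported n (bI w)"
  unfolding supported_def by (simp add: cf_bI perms_fperm carrier_hscale carrier_Tb)

lemma co_bI: "fperm w \<Longrightarrow> co (bI w) u = (if u = w then 1 else 0)"
  by (auto simp: co_def cf_bI hscale_def Tb_def)

lemma bI_id [simp]: "bI id = 1"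
  unfolding cf_inject[symmetric] by (simp add: cf_bI cf_one hone_def hscale_def del: id_apply)

lemma finite_co_supp: "finite {w. co x w \<noteq> 0}"
proof -
  obtain n where "supported n x" using supported_ex by blast
  then have "{w. co x w \<noteq> 0} \<subseteq> perms n"
    by (auto simp: supported_def hecke_carrier_def co_def)
  then show ?thesis by (rule finite_subset) simp
qed

lemma supported_co: "supported n x \<longleftrightarrow> (\<forall>w. co x w \<noteq> 0 \<longrightarrow> w \<in> perms n)"
proof -
  have "co x w \<noteq> 0 \<longleftrightarrow> cf x w \<noteq> 0" for w
    by (simp add: co_def)
  then show ?thesis by (auto simp: supported_def hecke_carrier_def)
qed

lemma hk_expand_on:
  assumes "finite A" "\<And>w. w \<in> A \<Longrightarrow> fperm w" "\<And>w. co x w \<noteq> 0 \<Longrightarrow> w \<in> A"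
  shows "x = (\<Sum>w\<in>A. sc (co x w) * bI w)"
proof (rule hk_eqI)
  fix u
  have "(\<Sum>w\<in>A. co (sc (co x w) * bI w) u) = (\<Sum>w\<in>A. if u = w then co x w else 0)"
    by (rule sum.cong) (use assms(2) in \<open>auto simp: co_bI\<close>)
  also have "\<dots> = co x u" using assms by auto
  finally show "co x u = co (\<Sum>w\<in>A. sc (co x w) * bI w) u"
    unfolding co_sum by simp
qed

lemma hk_expand: "x = (\<Sum>w | co x w \<noteq> 0. sc (co x w) * bI w)"
  using co_out by (intro hk_expand_on finite_co_supp) auto

text \<open>Only the terms of x itself occur, with their own coefficients. This serves properties
  such as those of \<open>bar\<close>, which hold for Laurent polynomial coefficients but not for
  arbitrary Laurent series.\<close>

lemma hk_induct_terms:
  assumes each: "\<And>w. fperm w \<Longrightarrow> co x w \<noteq> 0 \<Longrightarrow> P (sc (co x w) * bI w)"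
    and zero: "P 0" and add: "\<And>x y. P x \<Longrightarrow> P y \<Longrightarrow> P (x + y)"
  shows "P x"
proof -
  have "P (\<Sum>w\<in>A. sc (co x w) * bI w)" if "finite A" "A \<subseteq> {w. co x w \<noteq> 0}" for A
    using that
  proof (induction A rule: finite_induct)
    case (insert w A)
    then show ?case using co_out by (auto intro!: add each)
  qed (simp add: zero)
  from this[OF finite_co_supp[of x]] show ?thesis by (subst hk_expand) simp
qed

lemma hk_induct_supp:
  assumes bI: "\<And>w. fperm w \<Longrightarrow> co x w \<noteq> 0 \<Longrightarrow> P (bI w)"
    and zero: "P 0" and add: "\<And>x y. P x \<Longrightarrow> P y \<Longrightarrow> P (x + y)"
    and scale: "\<And>w. P (bI w) \<Longrightarrow> P (sc (co x w) * bI w)"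
  shows "P x"
  by (rule hk_induct_terms[of x P]) (use assms in auto)

section \<open>Normalised generators, their inverses and their relations\<close>

definition gs :: "nat \<Rightarrow> hk" where "gs i = bI (sref i)"
definition gi :: "nat \<Rightarrow> hk" where "gi i = gs i - sc zz"

lemma ell_sref: "1 \<le> i \<Longrightarrow> ell (sref i) = 1"
  using ell_left_up[of id i] by (simp add: One_nat_def)

lemma supported_gs: "1 \<le> i \<Longrightarrow> i < n \<Longrightarrow> supported n (gs i)"
  unfolding gs_def by (intro supported_bI sref_perms)

lemma cf_gs: "1 \<le> i \<Longrightarrow> cf (gs i) = hscale vinv (Tb (sref i))"
  by (simp add: gs_def cf_bI fperm_sref ell_sref)

text \<open>With the normalisation by powers of v, multiplication by \<open>gs i\<close> is the
  exchange of w and s_i w plus \<open>zz\<close> times the projection to descents. This symmetric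
  matrix is what makes \<open>form\<close> invariant.\<close>

lemma co_gs_mult:
  assumes u: "fperm u" and i: "1 \<le> i"
  shows "co (gs i * x) u = co x (sref i \<circ> u) + (if inv u (Suc i) < inv u i then zz * co x u else 0)"
proof -
  obtain n where "supported n x" using supported_ex by blast
  then have n: "supported (max n (Suc i)) x" by (rule supported_mono) simp
  then have "cf (gs i * x) = hscale vinv (lamT i (cf x))"
    using i n[unfolded supported_def]
    by (simp add: cf_times[OF supported_gs n] cf_gs hmul_hscale_left hmul_Tb_sref_left)
  then have e: "co (gs i * x) u = vv ^ ell u * (vinv * lamT i (cf x) u)"
    by (simp add: co_def hscale_def)
  have "inv u i \<noteq> inv u (Suc i)" by (simp add: fperm_inj fperm_inv u)
  then consider "inv u i < inv u (Suc i)" | "inv u (Suc i) < inv u i" by linarith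
  then show ?thesis
  proof cases
    case 1
    have "vinv * (qq * c) = vv * c" for c
      by (simp add: qq_def power2_eq_square mult.assoc[symmetric])
    with 1 show ?thesis
      unfolding e by (simp add: lamT_def co_def ell_left_up[OF u 1] mult.assoc mult.left_commute)
  next
    case 2
    have "vinv * (qq - 1) = zz"
      by (simp add: qq_def zz_def power2_eq_square right_diff_distrib mult.assoc[symmetric])
    then have "vinv * (c + (qq - 1) * d) = vinv * c + zz * d" for c d
      by (metis distrib_left mult.assoc)
    moreover have "vv ^ Suc k * (vinv * c) = vv ^ k * c" for k c
    proof -
      have "vv ^ Suc k * (vinv * c) = vv * vinv * (vv ^ k * c)" by (simp only: power_Suc ac_simps)
      then show ?thesis by simp
    qed
    ultimately have "vv ^ Suc k * (vinv * (c + (qq - 1) * d)) = vv ^ k * c + zz * (vv ^ Suc k * d)" for k c d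
      by (simp only: distrib_left[of "vv ^ Suc k"] mult.left_commute[of zz])
    then show ?thesis
      using 2 unfolding e by (simp only: lamT_def co_def if_True ell_left_down[OF u i 2])
  qed
qed

lemma co_mult_gs:
  assumes u: "fperm u" and i: "1 \<le> i"
  shows "co (x * gs i) u = co x (u \<circ> sref i) + (if u (Suc i) < u i then zz * co x u else 0)"
proof -
  obtain n where "supported n x" using supported_ex by blast
  then have n: "supported (max n (Suc i)) x" by (rule supported_mono) simp
  then have "cf (x * gs i) = hscale vinv (rhoT i (cf x))"
    using i n[unfolded supported_def]
    by (simp add: cf_times[OF n supported_gs] cf_gs hmul_hscale_right carrier_Tb sref_perms
        hmul_Tb_sref_right)
  then have e: "co (x * gs i) u = vv ^ ell u * (vinv * rhoT i (cf x) u)"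
    by (simp add: co_def hscale_def)
  have "u i \<noteq> u (Suc i)" by (simp add: fperm_inj u)
  then consider "u i < u (Suc i)" | "u (Suc i) < u i" by linarith
  then show ?thesis
  proof cases
    case 1
    have "vinv * (qq * c) = vv * c" for c
      by (simp add: qq_def power2_eq_square mult.assoc[symmetric])
    with 1 show ?thesis
      unfolding e by (simp add: rhoT_def co_def ell_right_up[OF u i 1] mult.assoc mult.left_commute)
  next
    case 2
    have "vinv * (qq - 1) = zz"
      by (simp add: qq_def zz_def power2_eq_square right_diff_distrib mult.assoc[symmetric])
    then have "vinv * (c + (qq - 1) * d) = vinv * c + zz * d" for c d
      by (metis distrib_left mult.assoc)
    moreover have "vv ^ Suc k * (vinv * c) = vv ^ k * c" for k c
    proof -
      have "vv ^ Suc k * (vinv * c) = vv * vinv * (vv ^ k * c)" by (simp only: power_Suc ac_simps)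
      then show ?thesis by simp
    qed
    ultimately have "vv ^ Suc k * (vinv * (c + (qq - 1) * d)) = vv ^ k * c + zz * (vv ^ Suc k * d)" for k c d
      by (simp only: distrib_left[of "vv ^ Suc k"] mult.left_commute[of zz])
    then show ?thesis
      using 2 unfolding e by (simp only: rhoT_def co_def if_True ell_right_down[OF u i 2])
  qed
qed

lemma sref_comp_eq_iff:
  fixes u w :: "nat \<Rightarrow> nat"
  shows "sref i \<circ> u = w \<longleftrightarrow> u = sref i \<circ> w"
  by (metis sref_comp_cancel(1)[of i u] sref_comp_cancel(1)[of i w])

lemma comp_sref_eq_iff:
  fixes u w :: "nat \<Rightarrow> nat"
  shows "u \<circ> sref i = w \<longleftrightarrow> u = w \<circ> sref i"
  by (metis sref_comp_cancel(2)[of u i] sref_comp_cancel(2)[of w i])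

lemma gs_mult_bI:
  assumes w: "fperm w" and i: "1 \<le> i"
  shows "gs i * bI w = bI (sref i \<circ> w) + (if inv w (Suc i) < inv w i then sc zz * bI w else 0)"
  by (rule hk_eqI)
    (use w i in \<open>auto simp: co_gs_mult co_bI fperm_comp fperm_sref sref_comp_eq_iff\<close>)

lemma bI_mult_gs:
  assumes w: "fperm w" and i: "1 \<le> i"
  shows "bI w * gs i = bI (w \<circ> sref i) + (if w (Suc i) < w i then sc zz * bI w else 0)"
  by (rule hk_eqI)
    (use w i in \<open>auto simp: co_mult_gs co_bI fperm_comp fperm_sref comp_sref_eq_iff\<close>)

lemma gs_square: assumes "1 \<le> i" shows "gs i * gs i = 1 + sc zz * gs i"
  using gs_mult_bI[of "sref i" i] assms by (simp add: gs_def[symmetric] fperm_sref del: id_apply)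

lemma gs_commute:
  assumes "1 \<le> i" "Suc i < j"
  shows "gs i * gs j = gs j * gs i"
proof -
  have "sref i \<circ> sref j = sref j \<circ> sref i" using assms by (auto simp: sref_def sw_def)
  then show ?thesis
    using gs_mult_bI[of "sref j" i] gs_mult_bI[of "sref i" j] assms
    by (auto simp: gs_def[symmetric] fperm_sref) (auto simp: sref_def sw_def split: if_splits)
qed

lemma gs_braid:
  assumes "1 \<le> i"
  shows "gs i * gs (Suc i) * gs i = gs (Suc i) * gs i * gs (Suc i)"
proof -
  let ?a = "sref i" and ?b = "sref (Suc i)"
  have f: "fperm ?a" "fperm ?b" "fperm (?b \<circ> ?a)" "fperm (?a \<circ> ?b)"
    using assms by (auto intro!: fperm_comp fperm_sref)
  have i: "inv (?b \<circ> ?a) = ?a \<circ> ?b" "inv (?a \<circ> ?b) = ?b \<circ> ?a"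
    using f by (simp_all add: inv_comp)
  have e: "gs (Suc i) * bI ?a = bI (?b \<circ> ?a)" "gs i * bI ?b = bI (?a \<circ> ?b)"
    "gs i * bI (?b \<circ> ?a) = bI (?a \<circ> (?b \<circ> ?a))"
    "gs (Suc i) * bI (?a \<circ> ?b) = bI (?b \<circ> (?a \<circ> ?b))"
    using assms f by (simp_all only: gs_mult_bI i inv_sref) (auto simp: sref_def sw_def)
  have "gs i * gs (Suc i) * gs i = gs i * (gs (Suc i) * bI ?a)" by (simp add: gs_def mult.assoc)
  also have "\<dots> = bI (?a \<circ> (?b \<circ> ?a))" unfolding e ..
  also have "?a \<circ> (?b \<circ> ?a) = ?b \<circ> (?a \<circ> ?b)" by (auto simp: sref_def sw_def)
  also have "bI \<dots> = gs (Suc i) * (gs i * bI ?b)" unfolding e ..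
  also have "\<dots> = gs (Suc i) * gs i * gs (Suc i)" by (simp add: gs_def mult.assoc)
  finally show ?thesis .
qed

lemma gs_gi: "1 \<le> i \<Longrightarrow> gs i * gi i = 1" "1 \<le> i \<Longrightarrow> gi i * gs i = 1"
  by (simp_all add: gi_def algebra_simps gs_square sc_central)

section \<open>Words in the generators\<close>

text \<open>The last argument counts the letters, so the empty word needs no special case. The
  general monoid allows the same words for operators, in \<open>lm_asc\<close>.\<close>

definition asc :: "(nat \<Rightarrow> 'a) \<Rightarrow> nat \<Rightarrow> nat \<Rightarrow> 'a::monoid_mult" where
  "asc f a k = prod_list (map f [a..<a + k])"

definition desc :: "(nat \<Rightarrow> 'a) \<Rightarrow> nat \<Rightarrow> nat \<Rightarrow> 'a::monoid_mult" where
  "desc f a k = prod_list (map f (rev [a..<a + k]))"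

lemma asc_0 [simp]: "asc f a 0 = 1" and desc_0 [simp]: "desc f a 0 = 1"
  by (simp_all add: asc_def desc_def)

lemma asc_Suc: "asc f a (Suc k) = asc f a k * f (a + k)"
  by (simp add: asc_def)

lemma desc_Suc: "desc f a (Suc k) = f (a + k) * desc f a k"
  by (simp add: desc_def)

lemma upt_conv: "[a..<a + Suc k] = a # [Suc a..<Suc a + k]"
  by (subst upt_conv_Cons) auto

lemma asc_Suc': "asc f a (Suc k) = f a * asc f (Suc a) k"
  by (simp only: asc_def upt_conv list.map prod_list.Cons)

lemma desc_Suc': "desc f a (Suc k) = desc f (Suc a) k * f a"
  unfolding desc_def upt_conv by simp

lemma asc_1 [simp]: "asc f a 1 = f a"
  by (simp add: One_nat_def asc_Suc)

lemma asc_add: "asc f a (j + k) = asc f a j * asc f (a + j) k"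
  by (induction k) (simp_all add: asc_Suc mult.assoc add.assoc)

lemma asc_comm:
  assumes "\<And>i. a \<le> i \<Longrightarrow> i < a + k \<Longrightarrow> x * f i = f i * x"
  shows "x * asc f a k = asc f a k * x"
  using assms
proof (induction k)
  case (Suc k)
  have "x * asc f a (Suc k) = x * asc f a k * f (a + k)" by (simp add: asc_Suc mult.assoc)
  also have "\<dots> = asc f a k * (x * f (a + k))" using Suc by (simp add: mult.assoc)
  also have "\<dots> = asc f a (Suc k) * x" using Suc.prems by (simp add: asc_Suc mult.assoc)
  finally show ?case .
qed simp

lemma desc_comm:
  assumes "\<And>i. a \<le> i \<Longrightarrow> i < a + k \<Longrightarrow> x * f i = f i * x"
  shows "x * desc f a k = desc f a k * x"
  using assms
proof (induction k)
  case (Suc k)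
  have "x * desc f a (Suc k) = x * f (a + k) * desc f a k" by (simp add: desc_Suc mult.assoc)
  also have "\<dots> = f (a + k) * (x * desc f a k)" using Suc.prems by (simp add: mult.assoc)
  also have "\<dots> = desc f a (Suc k) * x" using Suc by (simp add: desc_Suc mult.assoc)
  finally show ?case .
qed simp

lemma asc_desc_inverse:
  assumes "\<And>i. a \<le> i \<Longrightarrow> f i * h i = (1::'a::monoid_mult)"
  shows "asc f a k * desc h a k = 1"
proof (induction k)
  case (Suc k)
  have "asc f a (Suc k) * desc h a (Suc k) = asc f a k * (f (a + k) * h (a + k)) * desc h a k"
    by (simp add: asc_Suc desc_Suc mult.assoc)
  then show ?case using Suc assms by simp
qed simp

lemma desc_asc_inverse:
  assumes "\<And>i. a \<le> i \<Longrightarrow> h i * f i = (1::'a::monoid_mult)"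
  shows "desc h a k * asc f a k = 1"
  using assms
proof (induction k arbitrary: a)
  case (Suc k)
  have "desc h a (Suc k) * asc f a (Suc k) = desc h (Suc a) k * (h a * f a) * asc f (Suc a) k"
    by (simp add: asc_Suc' desc_Suc' mult.assoc)
  then show ?case using Suc by simp
qed simp

lemma gs_gi_cancel [simp]:
  assumes "1 \<le> i"
  shows "gs i * (gi i * x) = x" "gi i * (gs i * x) = x" "x * gs i * gi i = x" "x * gi i * gs i = x"
  using gs_gi[OF assms] by (metis mult.assoc mult_1 mult_1_right)+

lemma asc_desc_gs:
  assumes "1 \<le> a"
  shows "asc gs a k * desc gi a k = 1" "asc gi a k * desc gs a k = 1"
    "desc gs a k * asc gi a k = 1" "desc gi a k * asc gs a k = 1"
  using assms by (auto intro!: asc_desc_inverse desc_asc_inverse simp: gs_gi)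

lemma gs_far:
  assumes "1 \<le> i" "1 \<le> j" "Suc i < j \<or> Suc j < i"
  shows "gs i * gs j = gs j * gs i"
  using assms gs_commute by metis

lemma gi_comm: "x * gs i = gs i * x \<Longrightarrow> x * gi i = gi i * x"
  by (simp add: gi_def right_diff_distrib left_diff_distrib sc_central)

text \<open>The braid relation multiplied by inverses on both sides; it lets words in the inverses
  shift letters just as words in the generators do.\<close>

lemma gi_braid:
  assumes "1 \<le> i"
  shows "gi i * gi (Suc i) * gs i = gs (Suc i) * gi i * gi (Suc i)"
proof -
  have S: "1 \<le> Suc i" by (simp add: One_nat_def)
  have "gi i * gi (Suc i) * gs i
      = gi i * gi (Suc i) * (gs i * gs (Suc i) * gs i) * gi i * gi (Suc i)"
    using assms S by (simp add: mult.assoc gs_gi)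
  also have "\<dots> = gi i * gi (Suc i) * (gs (Suc i) * gs i * gs (Suc i)) * gi i * gi (Suc i)"
    by (simp add: gs_braid[OF assms])
  also have "\<dots> = gs (Suc i) * gi i * gi (Suc i)"
    using assms S by (simp add: mult.assoc gs_gi)
  finally show ?thesis .
qed

text \<open>Only the letters j and j+1 of the word interact with \<open>gs j\<close>: the braid
  relation turns it into \<open>gs (Suc j)\<close>, and all other letters commute with it.\<close>

lemma asc_shift:
  assumes f: "f = gs \<or> f = gi" and j: "1 \<le> a" "a \<le> j" "Suc j < a + N"
  shows "asc f a N * gs j = gs (Suc j) * asc f a N"
proof -
  define r where "r = N - (j - a) - 2"
  have "N = (j - a) + (2 + r)" "a + (j - a) = j" using j by (auto simp: r_def)
  then have e: "asc f a N = asc f a (j - a) * (f j * f (Suc j) * asc f (Suc (Suc j)) r)"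
    by (metis add_2_eq_Suc asc_Suc' asc_add mult.assoc)
  have br: "f j * f (Suc j) * gs j = gs (Suc j) * f j * f (Suc j)"
    using f gi_braid[of j] gs_braid[of j] j by auto
  have c: "gs i * f k = f k * gs i" if "1 \<le> i" "1 \<le> k" "Suc i < k \<or> Suc k < i" for i k
    using f that gs_far gi_comm by metis
  have 1: "gs j * asc f (Suc (Suc j)) r = asc f (Suc (Suc j)) r * gs j"
    using j by (intro asc_comm c) auto
  have 2: "gs (Suc j) * asc f a (j - a) = asc f a (j - a) * gs (Suc j)"
    using j by (intro asc_comm c) auto
  have "asc f a N * gs j = asc f a (j - a) * (f j * f (Suc j) * gs j) * asc f (Suc (Suc j)) r"
    unfolding e by (simp only: mult.assoc 1)
  also have "\<dots> = gs (Suc j) * asc f a N"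
    unfolding br e by (simp only: mult.assoc[symmetric] 2)
  finally show ?thesis .
qed

text \<open>The rule \<open>asc_shift\<close> for the inverse word, read backwards.\<close>

lemma desc_shift:
  assumes h: "h = gs \<or> h = gi" and j: "1 \<le> a" "a \<le> j" "Suc j < a + N"
  shows "desc h a N * gs (Suc j) = gs j * desc h a N"
proof -
  obtain f where f: "f = gs \<or> f = gi" and i: "asc f a N * desc h a N = 1" "desc h a N * asc f a N = 1"
    using h asc_desc_gs[OF j(1), of N] by blast
  have "desc h a N * gs (Suc j) = desc h a N * (gs (Suc j) * asc f a N) * desc h a N"
    using i(1) by (simp add: mult.assoc)
  also have "\<dots> = desc h a N * asc f a N * gs j * desc h a N"
    using asc_shift[OF f j] by (simp add: mult.assoc)
  also have "\<dots> = gs j * desc h a N" using i(2) by simp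
  finally show ?thesis .
qed

text \<open>Scalars are Laurent polynomials although \<open>hk\<close> admits Laurent series.
  Membership thus records integrality, which the span statement and the bar involution
  require.\<close>

inductive_set galg :: "nat set \<Rightarrow> hk set" for A where
  gen: "i \<in> A \<Longrightarrow> gs i \<in> galg A"
| scalar: "is_lpoly c \<Longrightarrow> sc c \<in> galg A"
| add: "x \<in> galg A \<Longrightarrow> y \<in> galg A \<Longrightarrow> x + y \<in> galg A"
| mult: "x \<in> galg A \<Longrightarrow> y \<in> galg A \<Longrightarrow> x * y \<in> galg A"

lemma galg_mono: "x \<in> galg A \<Longrightarrow> A \<subseteq> B \<Longrightarrow> x \<in> galg B"
  by (induction rule: galg.induct) (auto intro: galg.intros)

lemma galg_0 [simp]: "0 \<in> galg A"
  using galg.scalar[of 0 A] by simp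

lemma galg_1 [simp]: "1 \<in> galg A"
  using galg.scalar[of 1 A] by simp

lemma galg_uminus: "x \<in> galg A \<Longrightarrow> - x \<in> galg A"
proof -
  assume "x \<in> galg A"
  then have "sc (- 1) * x \<in> galg A" by (intro galg.intros is_lpoly_uminus is_lpoly_1)
  then show ?thesis by (simp add: sc_uminus)
qed

lemma galg_diff: "x \<in> galg A \<Longrightarrow> y \<in> galg A \<Longrightarrow> x - y \<in> galg A"
  by (metis add_uminus_conv_diff galg.add galg_uminus)

lemma galg_gi: "i \<in> A \<Longrightarrow> gi i \<in> galg A"
  unfolding gi_def by (intro galg_diff galg.intros) simp_all

lemma galg_sum: "(\<And>x. x \<in> S \<Longrightarrow> f x \<in> galg A) \<Longrightarrow> sum f S \<in> galg A"
  by (induction S rule: infinite_finite_induct) (auto intro: galg.add)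

lemma galg_prod_list: "(\<And>x. x \<in> set xs \<Longrightarrow> x \<in> galg A) \<Longrightarrow> prod_list xs \<in> galg A"
  by (induction xs) (auto intro: galg.mult)

lemma galg_asc:
  assumes "{a..<a + k} \<subseteq> A"
  shows "asc gs a k \<in> galg A" "asc gi a k \<in> galg A" "desc gs a k \<in> galg A" "desc gi a k \<in> galg A"
  unfolding asc_def desc_def
  by (rule galg_prod_list; use assms in \<open>auto intro: galg.gen galg_gi\<close>)+

text \<open>One r serves all t in T at once. In \<open>Lop_step\<close> an element is pushed to the
  left through a word in the generators and pulled back through the word in their inverses, which
  must lead to the same r.\<close>

lemma galg_intertwine:
  assumes "\<And>i. i \<in> A \<Longrightarrow> \<exists>r\<in>galg B. \<forall>t\<in>T. t * gs i = r * t" and "x \<in> galg A"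
  shows "\<exists>r\<in>galg B. \<forall>t\<in>T. t * x = r * t"
  using assms(2)
proof (induction rule: galg.induct)
  case (scalar c)
  then show ?case using galg.scalar sc_central by blast
next
  case (add x y)
  then obtain r s where "r \<in> galg B" "s \<in> galg B" "\<forall>t\<in>T. t * x = r * t" "\<forall>t\<in>T. t * y = s * t"
    by blast
  then show ?case
    by (intro bexI[of _ "r + s"]) (auto simp: distrib_left distrib_right intro: galg.add)
next
  case (mult x y)
  then obtain r s where rs: "r \<in> galg B" "s \<in> galg B" "\<forall>t\<in>T. t * x = r * t" "\<forall>t\<in>T. t * y = s * t"
    by blast
  have "t * (x * y) = r * s * t" if "t \<in> T" for t
    using rs(3,4) that by (metis mult.assoc)
  then show ?case using rs by (intro bexI[of _ "r * s"]) (auto intro: galg.mult)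
qed (rule assms)

lemma galg_comm:
  assumes "\<And>i. i \<in> A \<Longrightarrow> x * gs i = gs i * x" and "r \<in> galg A"
  shows "x * r = r * x"
  using assms(2)
proof (induction rule: galg.induct)
  case (scalar c)
  show ?case by (rule sc_central)
next
  case (mult r s)
  then show ?case by (metis mult.assoc)
qed (auto simp: assms distrib_left distrib_right)

definition lpoly_co :: "hk \<Rightarrow> bool" where
  "lpoly_co x \<longleftrightarrow> (\<forall>w. is_lpoly (co x w))"

lemma lpoly_co_bI: "fperm w \<Longrightarrow> lpoly_co (bI w)"
  by (simp add: lpoly_co_def co_bI)

lemma lpoly_co_add: "lpoly_co x \<Longrightarrow> lpoly_co y \<Longrightarrow> lpoly_co (x + y)"
  by (simp add: lpoly_co_def is_lpoly_add)

lemma lpoly_co_galg_mult: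
  assumes "r \<in> galg A" "0 \<notin> A" "lpoly_co x"
  shows "lpoly_co (r * x)"
  using assms
proof (induction arbitrary: x rule: galg.induct)
  case (gen i)
  then have i: "1 \<le> i" by (cases i) (auto simp: One_nat_def)
  show ?case
    unfolding lpoly_co_def
  proof
    fix w
    show "is_lpoly (co (gs i * x) w)"
      using gen.prems i by (cases "fperm w")
        (auto simp: co_gs_mult lpoly_co_def co_out intro!: is_lpoly_add is_lpoly_mult)
  qed
next
  case (mult r s)
  then show ?case by (simp add: mult.assoc)
qed (auto simp: lpoly_co_def distrib_right intro: is_lpoly_mult is_lpoly_add)

lemma lpoly_co_galg: "r \<in> galg A \<Longrightarrow> 0 \<notin> A \<Longrightarrow> lpoly_co r"
  using lpoly_co_galg_mult[of r A 1] lpoly_co_bI[of id] by simp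

lemma supported_galg:
  assumes "r \<in> galg A" "A \<subseteq> {1..<n}"
  shows "supported n r"
  using assms
proof (induction rule: galg.induct)
  case (gen i)
  then show ?case by (intro supported_gs) auto
qed (auto intro: supported_sc supported_plus supported_times)

section \<open>Reduced words and coset representatives\<close>

lemma bI_left_up:
  "fperm w \<Longrightarrow> 1 \<le> i \<Longrightarrow> inv w i < inv w (Suc i) \<Longrightarrow> bI (sref i \<circ> w) = gs i * bI w"
  by (simp add: gs_mult_bI)

lemma bI_right_up:
  "fperm w \<Longrightarrow> 1 \<le> i \<Longrightarrow> w i < w (Suc i) \<Longrightarrow> bI (w \<circ> sref i) = bI w * gs i"
  by (simp add: bI_mult_gs)

lemma bI_left_down:
  assumes "fperm w" "1 \<le> i" "inv w (Suc i) < inv w i"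
  shows "bI w = gs i * bI (sref i \<circ> w)"
  using bI_left_up[of "sref i \<circ> w" i] assms by (simp add: fperm_comp fperm_sref inv_sref_comp)

text \<open>The predicate \<open>P\<close> stands for membership in a parabolic subgroup.\<close>
lemma bI_in_galg:
  assumes "w \<in> perms n" "P w"
    and desc: "\<And>w j. w \<in> perms n \<Longrightarrow> P w \<Longrightarrow> 1 \<le> j \<Longrightarrow> j < n \<Longrightarrow> inv w (Suc j) < inv w j \<Longrightarrow>
        j \<in> A \<and> P (sref j \<circ> w)"
  shows "bI w \<in> galg A"
  using assms(1,2)
proof (induction "ell w" arbitrary: w rule: less_induct)
  case less
  show ?case
  proof (cases "w = id")
    case False
    obtain j where j: "1 \<le> j" "j < n" "inv w (Suc j) < inv w j"
      using left_descent_exists[OF less.prems(1) False] .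
    have f: "fperm w" using less.prems(1) by (rule perms_fperm)
    have "bI (sref j \<circ> w) \<in> galg A"
      using ell_left_down[OF f j(1,3)] desc[OF less.prems j] less.prems j
      by (intro less.hyps) (auto simp: perms_sref_comp)
    then show ?thesis
      unfolding bI_left_down[OF f j(1,3)] using desc[OF less.prems j] by (auto intro: galg.intros)
  qed simp
qed

text \<open>The values up to k stand at their own positions, so no left descent can involve one of
  them.\<close>

lemma bI_galg_fix:
  assumes "w \<in> perms n" "\<forall>i\<in>{1..k}. w i = i"
  shows "bI w \<in> galg {Suc k..<n}"
proof (rule bI_in_galg[where P = "\<lambda>w. \<forall>i\<in>{1..k}. w i = i"])
  fix w j
  assume w: "w \<in> perms n" "\<forall>i\<in>{1..k}. w i = i" and j: "1 \<le> j" "j < n" "inv w (Suc j) < inv w j"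
  have iv: "inv w i = i" if "i \<in> {1..k}" for i
    using w(2) fperm_inv_f[OF perms_fperm[OF w(1)], of i] that by simp
  have pos: "1 \<le> inv w (Suc j)" using perms_in[OF inv_perms[OF w(1)], of "Suc j"] j by auto
  have jk: "k < j"
  proof (rule ccontr)
    assume "\<not> k < j"
    then have *: "inv w j = j" using iv j by auto
    then have "inv w (Suc j) \<in> {1..k}" using j(3) pos \<open>\<not> k < j\<close> by auto
    then have "w (inv w (Suc j)) = inv w (Suc j)" using w(2) by blast
    then show False using * j(3) by (simp add: fperm_f_inv[OF perms_fperm[OF w(1)]])
  qed
  then show "j \<in> {Suc k..<n} \<and> (\<forall>i\<in>{1..k}. (sref j \<circ> w) i = i)"
    using w(2) j by (auto simp: sref_def sw_def)
qed (use assms in auto)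

text \<open>The cycle s_a s_(a+1) ... s_(a+k-1), the permutation of the word
  \<open>asc gs a k\<close>.\<close>

definition cyc :: "nat \<Rightarrow> nat \<Rightarrow> nat \<Rightarrow> nat" where
  "cyc a k j = (if j = a + k then a else if a \<le> j \<and> j < a + k then Suc j else j)"

lemma cyc_0 [simp]: "cyc a 0 = id"
  by (auto simp: cyc_def)

lemma cyc_Suc: "cyc a (Suc k) = cyc a k \<circ> sref (a + k)"
  by (rule ext) (auto simp: cyc_def sref_def sw_def)

lemma cyc_perms: "1 \<le> a \<Longrightarrow> a + k \<le> n \<Longrightarrow> cyc a k \<in> perms n"
  by (induction k) (auto simp: cyc_Suc intro!: comp_perms sref_perms simp del: comp_apply id_apply)

text \<open>The word carries the value \<open>w a\<close> to the right past larger values, so each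
  letter increases the length.\<close>

lemma bI_mult_asc:
  assumes w: "fperm w" and a: "1 \<le> a" and less: "\<And>j. a < j \<Longrightarrow> j \<le> a + k \<Longrightarrow> w a < w j"
  shows "bI w * asc gs a k = bI (w \<circ> cyc a k)"
  using less
proof (induction k)
  case (Suc k)
  have c: "fperm (cyc a k)" using cyc_perms[OF a order_refl] by (rule perms_fperm)
  have "bI w * asc gs a (Suc k) = bI (w \<circ> cyc a k) * gs (a + k)"
  proof -
    have "bI w * asc gs a k = bI (w \<circ> cyc a k)" by (rule Suc.IH) (simp add: Suc.prems)
    then show ?thesis by (simp only: asc_Suc mult.assoc[symmetric])
  qed
  also have "\<dots> = bI ((w \<circ> cyc a k) \<circ> sref (a + k))"
    using Suc.prems a c w by (intro bI_right_up[symmetric] fperm_comp) (auto simp: cyc_def)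
  finally show ?case by (simp add: cyc_Suc comp_assoc del: comp_apply)
qed (simp del: id_apply)

text \<open>The cycle brings the value a home from its position \<open>inv w a\<close>; what remains
  also fixes a, and the lengths add. Repeated use strips the values 1, 2 and so on.\<close>

lemma bI_factor:
  assumes w: "w \<in> perms n" and a: "1 \<le> a" "a \<le> n" and fx: "\<forall>i\<in>{1..<a}. w i = i"
  obtains b where "b \<in> perms n" "\<forall>i\<in>{1..a}. b i = i" "a \<le> inv w a" "inv w a \<le> n"
    "bI w = bI b * asc gs a (inv w a - a)"
proof -
  have f: "fperm w" using w by (rule perms_fperm)
  define k where "k = inv w a - a"
  have in_n: "inv w a \<in> {1..n}" using perms_in[OF inv_perms[OF w], of a] a by auto
  have "a \<le> inv w a"
  proof (rule ccontr)
    assume "\<not> a \<le> inv w a"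
    then have "w (inv w a) = inv w a" using fx in_n by auto
    then show False using \<open>\<not> a \<le> inv w a\<close> by (simp add: fperm_f_inv[OF f])
  qed
  then have k: "inv w a = a + k" by (simp add: k_def)
  have c: "cyc a k \<in> perms n" using a in_n k by (intro cyc_perms) auto
  note fc = perms_fperm[OF c]
  define b where "b = w \<circ> inv (cyc a k)"
  have b: "b \<in> perms n" unfolding b_def using w c by (intro comp_perms inv_perms)
  have wb: "w = b \<circ> cyc a k" using fc by (auto simp: b_def fperm_inv_f)
  have bf: "b i = i" if i: "i \<in> {1..a}" for i
  proof (cases "i = a")
    case True
    have "b a = w (a + k)" using wb by (simp add: cyc_def)
    then show ?thesis using True k fperm_f_inv[OF f, of a] by simp
  next
    case False
    then have "b i = w i" using wb i by (auto simp: cyc_def)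
    then show ?thesis using fx i False by auto
  qed
  have "b a < b j" if "a < j" for j
  proof (rule ccontr)
    assume n: "\<not> b a < b j"
    have j0: "b j \<noteq> 0" using fperm_0[OF perms_fperm[OF b]] fperm_inj[OF perms_fperm[OF b], of j 0] that by auto
    have "b a = a" using bf a by auto
    then have "b j \<in> {1..a}" using n j0 by (cases "b j") (auto simp: One_nat_def)
    then have "b (b j) = b j" by (rule bf)
    then have "b j = j" using fperm_inj[OF perms_fperm[OF b]] by auto
    then show False using n that \<open>b a = a\<close> by simp
  qed
  then have "bI b * asc gs a k = bI (b \<circ> cyc a k)"
    using perms_fperm[OF b] a(1) by (intro bI_mult_asc)
  then have "bI w = bI b * asc gs a k" by (simp only: wb[symmetric])
  then have e: "bI w = bI b * asc gs a (inv w a - a)" by (simp only: k_def)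
  show thesis
    using \<open>a \<le> inv w a\<close> in_n by (intro that[OF b _ _ _ e] ballI bf) auto
qed

section \<open>Jucys-Murphy elements of type B\<close>

text \<open>Stated over an abstract ring because the model consists of operators on
  \<open>hk\<close>; the scalar of the quadratic relation is then itself a ring element z commuting
  with the generators.\<close>

locale type_B =
  fixes t z :: "'a::ring_1" and g :: "nat \<Rightarrow> 'a"
  assumes square: "1 \<le> i \<Longrightarrow> g i * g i = 1 + z * g i"
    and far: "1 \<le> i \<Longrightarrow> Suc i < j \<Longrightarrow> g i * g j = g j * g i"
    and braid: "1 \<le> i \<Longrightarrow> g i * g (Suc i) * g i = g (Suc i) * g i * g (Suc i)"
    and t_far: "1 < i \<Longrightarrow> t * g i = g i * t"
    and t_braid: "t * g 1 * t * g 1 = g 1 * t * g 1 * t"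
    and z_g: "1 \<le> i \<Longrightarrow> z * g i = g i * z"
    and z_t: "z * t = t * z"
begin

text \<open>The index starts at 0: \<open>L k\<close> is L_(k+1) of the overview, while
  \<open>u k\<close> is u_k there.\<close>

primrec L :: "nat \<Rightarrow> 'a" where
  "L 0 = t"
| "L (Suc k) = g (Suc k) * L k * g (Suc k)"

primrec u :: "nat \<Rightarrow> 'a" where
  "u 0 = 1"
| "u (Suc k) = (1 - L k) * u k"

lemma comm3: "x * a = a * x \<Longrightarrow> x * b = b * x \<Longrightarrow> x * (a * b * a) = a * b * a * (x :: 'a)"
  by (metis mult.assoc)

lemma L_far: "Suc k < i \<Longrightarrow> g i * L k = L k * g i"
proof (induction k)
  case 0
  then show ?case using t_far[of i] by (simp add: One_nat_def)
next
  case (Suc k)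
  have "g i * g (Suc k) = g (Suc k) * g i"
    using far[of "Suc k" i] Suc.prems by (simp add: One_nat_def)
  then show ?case unfolding L.simps using Suc by (intro comm3) auto
qed

text \<open>The essential case is i = k - 1 for \<open>L k\<close>: two braid relations carry the
  letter from the outside through both layers of conjugation, past the inner \<open>L\<close>, and
  out again.\<close>

lemma L_near: "1 \<le> i \<Longrightarrow> i < k \<Longrightarrow> g i * L k = L k * g i"
proof (induction k)
  case (Suc k)
  show ?case
  proof (cases "i < k")
    case True
    then have "g i * g (Suc k) = g (Suc k) * g i" using far[of i "Suc k"] Suc.prems by simp
    then show ?thesis unfolding L.simps using Suc True by (intro comm3) auto
  next
    case False
    then have i: "i = k" using Suc.prems by simp
    then obtain j where j: "k = Suc j" using Suc.prems by (cases k) (auto simp: One_nat_def)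
    have b: "g k * g (Suc k) * g k = g (Suc k) * g k * g (Suc k)" using braid Suc.prems i by auto
    have c: "g (Suc k) * L j = L j * g (Suc k)" using L_far j by simp
    have "g k * L (Suc k) = g k * g (Suc k) * g k * L j * g k * g (Suc k)"
      using j by (simp add: mult.assoc)
    also have "\<dots> = g (Suc k) * g k * (g (Suc k) * L j) * g k * g (Suc k)"
      unfolding b by (simp add: mult.assoc)
    also have "\<dots> = g (Suc k) * g k * L j * (g (Suc k) * g k * g (Suc k))"
      unfolding c by (simp add: mult.assoc)
    also have "\<dots> = L (Suc k) * g k"
      unfolding b[symmetric] using j by (simp add: mult.assoc)
    finally show ?thesis using i by simp
  qed
qed simp

lemma t_L: "t * L k = L k * t"
proof (induction k)
  case (Suc k)
  show ?case
  proof (cases "k = 0")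
    case True
    then show ?thesis using t_braid by (simp add: One_nat_def mult.assoc)
  next
    case False
    then have "t * g (Suc k) = g (Suc k) * t" by (intro t_far) (simp add: One_nat_def)
    then show ?thesis unfolding L.simps using Suc by (intro comm3)
  qed
qed simp

lemma L_comm_le: "j \<le> k \<Longrightarrow> L j * L k = L k * L j"
proof (induction j)
  case 0
  show ?case by (simp add: t_L)
next
  case (Suc j)
  show ?case
  proof (cases "Suc j = k")
    case False
    then have "g (Suc j) * L k = L k * g (Suc j)"
      using Suc.prems L_near[of "Suc j" k] by (simp add: One_nat_def)
    then show ?thesis unfolding L.simps using Suc comm3[of "L k" "g (Suc j)" "L j"] by simp
  qed simp
qed

lemma L_comm: "L j * L k = L k * L j"
  using L_comm_le[of j k] L_comm_le[of k j] by (cases "j \<le> k") auto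

text \<open>By the quadratic relation \<open>g (Suc k)\<close> commutes with the sum of
  \<open>L k\<close> and \<open>L (Suc k)\<close>, and by their commutativity it commutes with their
  product.\<close>

lemma L_pair: "g (Suc k) * ((1 - L (Suc k)) * (1 - L k)) = (1 - L (Suc k)) * (1 - L k) * g (Suc k)"
proof -
  define a s where "a = L k" and "s = g (Suc k)"
  have comm: "s * a * s * a = a * s * a * s"
    using L_comm[of "Suc k" k] by (simp add: a_def s_def mult.assoc)
  have sq: "s * s = 1 + z * s" using square by (simp add: s_def One_nat_def)
  have zs: "z * s = s * z" using z_g by (simp add: s_def One_nat_def)
  have za: "z * a = a * z"
    unfolding a_def
  proof (induction k)
    case (Suc k)
    have "z * g (Suc k) = g (Suc k) * z" by (intro z_g) (simp add: One_nat_def)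
    then show ?case unfolding L.simps using Suc by (intro comm3)
  qed (simp add: z_t)
  have 1: "s * (s * a * s) = a * s + z * (s * a * s)"
  proof -
    have "s * (s * a * s) = (s * s) * a * s" by (simp add: mult.assoc)
    then show ?thesis unfolding sq by (simp add: distrib_right mult.assoc)
  qed
  have 2: "(s * a * s) * s = s * a + z * (s * a * s)"
  proof -
    have "(s * a * s) * s = s * a * (s * s)" by (simp add: mult.assoc)
    also have "\<dots> = s * a + (s * a * z) * s" unfolding sq by (simp add: distrib_left mult.assoc)
    also have "s * a * z = z * s * a" using zs za by (metis mult.assoc)
    finally show ?thesis by (simp add: mult.assoc)
  qed
  have 3: "s * (s * a * s * a) = s * a * s * a * s"
  proof -
    have "s * (s * a * s * a) = s * (a * s * a * s)" by (simp only: comm)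
    then show ?thesis by (simp add: mult.assoc)
  qed
  have "s * ((1 - s * a * s) * (1 - a)) = s - s * (s * a * s) - s * a + s * (s * a * s * a)"
    by (simp add: algebra_simps)
  also have "\<dots> = s - (s * a * s) * s - a * s + s * a * s * a * s"
    unfolding 1 2 3 by (simp add: algebra_simps)
  also have "\<dots> = (1 - s * a * s) * (1 - a) * s"
    by (simp add: algebra_simps)
  finally show ?thesis by (simp add: a_def s_def)
qed

lemma u_far: "k < i \<Longrightarrow> g i * u k = u k * g i"
proof (induction k)
  case (Suc k)
  have "g i * (1 - L k) = (1 - L k) * g i"
    using L_far[of k i] Suc.prems by (simp add: algebra_simps)
  then show ?case using Suc by (simp, metis Suc_lessD mult.assoc)
qed simp

lemma u_near: "1 \<le> i \<Longrightarrow> i < k \<Longrightarrow> g i * u k = u k * g i"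
proof (induction k)
  case (Suc k)
  show ?case
  proof (cases "i < k")
    case True
    have "g i * (1 - L k) = (1 - L k) * g i"
      using L_near[of i k] Suc.prems True by (simp add: algebra_simps)
    then show ?thesis using Suc True by (simp, metis mult.assoc)
  next
    case False
    then have "i = k" using Suc.prems by simp
    then obtain j where j: "k = Suc j" "i = Suc j"
      using Suc.prems(1) by (cases k) (simp_all add: One_nat_def)
    have "g i * u j = u j * g i" using u_far j by simp
    moreover have "g i * ((1 - L k) * (1 - L j)) = (1 - L k) * (1 - L j) * g i"
      using L_pair[of j] j by simp
    moreover have "u (Suc k) = (1 - L k) * (1 - L j) * u j" using j by (simp add: mult.assoc)
    ultimately show ?thesis by (metis mult.assoc)
  qed
qed simp

lemma u_factor: "\<exists>w. u (Suc k) = w * (1 - t)"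
proof (induction k)
  case 0
  show ?case by (intro exI[of _ 1]) simp
next
  case (Suc k)
  then obtain w where "u (Suc k) = w * (1 - t)" by blast
  then have "u (Suc (Suc k)) = (1 - L (Suc k)) * w * (1 - t)" by (simp add: mult.assoc)
  then show ?case by blast
qed

lemma L_asc: "L k = desc g 1 k * t * asc g 1 k"
  by (induction k) (simp_all add: asc_Suc desc_Suc mult.assoc plus_1_eq_Suc)

end

section \<open>The type B action\<close>

definition hlin :: "(hk \<Rightarrow> hk) \<Rightarrow> bool" where
  "hlin F \<longleftrightarrow> (\<forall>x y. F (x + y) = F x + F y) \<and> (\<forall>c x. F (sc c * x) = sc c * F x)"

lemma hlinD: "hlin F \<Longrightarrow> F (x + y) = F x + F y" "hlin F \<Longrightarrow> F (sc c * x) = sc c * F x"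
  by (simp_all add: hlin_def)

lemma hlin_0: "hlin F \<Longrightarrow> F 0 = 0"
  using hlinD(2)[of F 0 0] by simp

lemma hlin_uminus: "hlin F \<Longrightarrow> F (- x) = - F x"
  using hlinD(2)[of F "- 1" x] by (simp add: sc_uminus)

lemma sc_left_comm: "x * (sc c * y) = sc c * (x * y)"
  by (metis mult.assoc sc_central)

lemma hlin_comp: "hlin F \<Longrightarrow> hlin G \<Longrightarrow> hlin (\<lambda>x. F (G x))"
  by (simp add: hlin_def)

lemma hlin_left: "hlin (\<lambda>x. a * x)" and hlin_right: "hlin (\<lambda>x. x * a)"
  by (simp_all add: hlin_def distrib_left distrib_right sc_left_comm mult.assoc)

lemma hlin_sub: "hlin F \<Longrightarrow> hlin G \<Longrightarrow> hlin (\<lambda>x. F x - G x)"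
  by (simp add: hlin_def algebra_simps)

lemma hlin_eq:
  assumes "hlin F" "hlin G" "\<And>w. fperm w \<Longrightarrow> co x w \<noteq> 0 \<Longrightarrow> F (bI w) = G (bI w)"
  shows "F x = G x"
proof (rule hk_induct_supp[where P = "\<lambda>x. F x = G x"])
qed (use assms in \<open>auto simp: hlinD hlin_0\<close>)

definition lext :: "((nat \<Rightarrow> nat) \<Rightarrow> hk) \<Rightarrow> hk \<Rightarrow> hk" where
  "lext F x = (\<Sum>w | co x w \<noteq> 0. sc (co x w) * F w)"

lemma lext_on:
  assumes "finite A" "{w. co x w \<noteq> 0} \<subseteq> A"
  shows "lext F x = (\<Sum>w\<in>A. sc (co x w) * F w)"
  unfolding lext_def by (rule sum.mono_neutral_left) (use assms in auto)

lemma hlin_lext: "hlin (lext F)"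
  unfolding hlin_def
proof (intro conjI allI)
  fix x y c
  let ?A = "{w. co x w \<noteq> 0} \<union> {w. co y w \<noteq> 0}"
  have A: "finite ?A" by (simp add: finite_co_supp)
  have "lext F (x + y) = (\<Sum>w\<in>?A. sc (co (x + y) w) * F w)" by (rule lext_on[OF A]) auto
  moreover have "lext F x = (\<Sum>w\<in>?A. sc (co x w) * F w)" by (rule lext_on[OF A]) auto
  moreover have "lext F y = (\<Sum>w\<in>?A. sc (co y w) * F w)" by (rule lext_on[OF A]) auto
  ultimately show "lext F (x + y) = lext F x + lext F y"
    by (simp add: sc_add distrib_right sum.distrib)
  have "lext F (sc c * x) = (\<Sum>w | co x w \<noteq> 0. sc (co (sc c * x) w) * F w)"
    by (rule lext_on[OF finite_co_supp]) auto
  then show "lext F (sc c * x) = sc c * lext F x"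
    by (simp add: lext_def sc_mult sum_distrib_left mult.assoc)
qed

lemma lext_bI: assumes "fperm w" shows "lext F (bI w) = F w"
proof -
  have "lext F (bI w) = (\<Sum>u\<in>{w}. sc (co (bI w) u) * F u)"
    by (rule lext_on) (use assms in \<open>auto simp: co_bI split: if_splits\<close>)
  then show ?thesis using assms by (simp add: co_bI)
qed

text \<open>The generator T_0 of the second block is g_m ... g_1 T_0 g_1 ... g_m and has to act on 1
  by -1. Hence \<open>theta m\<close> must send \<open>asc gs 1 m\<close> to
  \<open>- asc gi 1 m\<close>, which determines the initial value. The later values are conjugates,
  so that \<open>theta m\<close> commutes with right multiplication by the second block.\<close>

primrec tauD :: "nat \<Rightarrow> nat \<Rightarrow> hk" where
  "tauD m 0 = - (desc gi 1 m * asc gi 1 m)"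
| "tauD m (Suc d) = gi (Suc (m + d)) * tauD m d * gs (Suc (m + d))"

definition tau :: "nat \<Rightarrow> nat \<Rightarrow> hk" where
  "tau m k = (if k \<le> m then 1 else tauD m (k - Suc m))"

text \<open>\<open>theta m\<close> plays the part of the generator \<open>T\<^sub>0\<close>, with \<open>T\<^sub>0\<^sup>2 = 1\<close>, of a type B Hecke algebra acting on
  the algebra from the left: it is the module induced from the representation of
  \<open>H(B\<^sub>m) \<otimes> H(B\<^sub>m)\<close> in which the two copies of \<open>T\<^sub>0\<close> act by \<open>1\<close> and by \<open>-1\<close>.\<close>
definition theta :: "nat \<Rightarrow> hk \<Rightarrow> hk" where
  "theta m = lext (\<lambda>w. bI w * tau m (inv w 1))"

lemma hlin_theta: "hlin (theta m)"
  unfolding theta_def by (rule hlin_lext)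

lemma theta_bI: "fperm w \<Longrightarrow> theta m (bI w) = bI w * tau m (inv w 1)"
  by (simp add: theta_def lext_bI)

text \<open>The compatibility needed when the value 1 moves between the positions j and j+1 of one
  block; j = m is the passage between the blocks.\<close>

lemma tau_step:
  assumes "1 \<le> j" "j \<noteq> m"
  shows "gs j * tau m (Suc j) = tau m j * gs j"
proof (cases "j < m")
  case True
  then show ?thesis by (simp add: tau_def)
next
  case False
  then obtain d where "j = Suc (m + d)"
    using assms by (metis less_imp_Suc_add linorder_neqE_nat)
  then show ?thesis using assms by (simp add: tau_def mult.assoc)
qed

lemma tauD_far:
  assumes "Suc (m + d) < j"
  shows "gs j * tauD m d = tauD m d * gs j"
  using assms
proof (induction d)
  case 0
  have "gs j * gi i = gi i * gs j" if "1 \<le> i" "i < 1 + m" for i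
    using that 0 by (intro gi_comm gs_far) auto
  then have "gs j * desc gi 1 m = desc gi 1 m * gs j" "gs j * asc gi 1 m = asc gi 1 m * gs j"
    by (auto intro: asc_comm desc_comm)
  then have "gs j * (desc gi 1 m * asc gi 1 m) = desc gi 1 m * asc gi 1 m * gs j"
    by (metis mult.assoc)
  then show ?case by simp
next
  case (Suc d)
  let ?i = "Suc (m + d)"
  have c: "gs j * gs ?i = gs ?i * gs j"
    using Suc.prems by (intro gs_far) (auto simp: One_nat_def)
  have "gs j * tauD m d = tauD m d * gs j" using Suc by simp
  then show ?case using c gi_comm[OF c] by simp (metis mult.assoc)
qed

text \<open>Initially, for j < m, the right word turns \<open>gs j\<close> into
  \<open>gs (Suc j)\<close> and the left word turns it back.\<close>

lemma tauD_comm: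
  assumes "1 \<le> j" "j \<noteq> m" "j \<noteq> Suc (m + d)" "j \<noteq> m + d"
  shows "gs j * tauD m d = tauD m d * gs j"
  using assms
proof (induction d arbitrary: j)
  case 0
  show ?case
  proof (cases "j < m")
    case True
    have "desc gi 1 m * asc gi 1 m * gs j = desc gi 1 m * gs (Suc j) * asc gi 1 m"
      using asc_shift[of gi 1 j m] 0 True by (simp add: mult.assoc)
    also have "\<dots> = gs j * (desc gi 1 m * asc gi 1 m)"
      using desc_shift[of gi 1 j m] 0 True by (simp add: mult.assoc)
    finally show ?thesis by simp
  next
    case False
    then show ?thesis using 0 by (intro tauD_far) simp
  qed
next
  case (Suc d)
  let ?i = "Suc (m + d)"
  consider "j = ?i" | "j \<noteq> ?i" "j \<noteq> m + d" | "j = m + d" "j \<noteq> ?i" by blast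
  then show ?case
  proof cases
    case 1
    then show ?thesis using Suc.prems by simp
  next
    case 2
    have c: "gs j * gs ?i = gs ?i * gs j"
      using 2 Suc.prems by (intro gs_far) auto
    have "gs j * tauD m (Suc d) = (gs j * gi ?i) * tauD m d * gs ?i" by (simp add: mult.assoc)
    also have "gs j * gi ?i = gi ?i * gs j" by (rule gi_comm[OF c])
    also have "gi ?i * gs j * tauD m d * gs ?i = gi ?i * (gs j * tauD m d) * gs ?i"
      by (simp add: mult.assoc)
    also have "gs j * tauD m d = tauD m d * gs j" using Suc 2 by blast
    also have "gi ?i * (tauD m d * gs j) * gs ?i = gi ?i * tauD m d * (gs j * gs ?i)"
      by (simp add: mult.assoc)
    finally show ?thesis unfolding c by (simp add: mult.assoc)
  next
    case 3
    \<comment> \<open>Here \<open>gs j\<close> meets the two outermost conjugations. It passes them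
      as \<open>gs (Suc j)\<close>, which commutes with the inner \<open>tauD m e\<close>, and
      reappears on the other side as \<open>gs j\<close>.\<close>
    then obtain e where d: "d = Suc e" using Suc.prems by (cases d) auto
    have ij: "?i = Suc j" using 3 by simp
    have je: "j = Suc (m + e)" using 3 d by simp
    have t: "tauD m (Suc d) = gi (Suc j) * gi j * tauD m e * (gs j * gs (Suc j))"
      using je by (simp add: d mult.assoc)
    have j1: "1 \<le> j" "1 \<le> Suc j" using je by (simp_all add: One_nat_def)
    have b1: "gs j * gi (Suc j) * gi j = gi (Suc j) * gi j * gs (Suc j)"
    proof -
      have "gs j * gi (Suc j) * gi j = gi (Suc j) * gi j * (gs j * gs (Suc j) * gs j) * gi (Suc j) * gi j"
        using j1 by (simp add: mult.assoc gs_gi)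
      also have "\<dots> = gi (Suc j) * gi j * (gs (Suc j) * gs j * gs (Suc j)) * gi (Suc j) * gi j"
        by (simp only: gs_braid[OF j1(1)])
      also have "\<dots> = gi (Suc j) * gi j * gs (Suc j)"
        using j1 by (simp add: mult.assoc gs_gi)
      finally show ?thesis .
    qed
    have c: "gs (Suc j) * tauD m e = tauD m e * gs (Suc j)"
      using je by (intro tauD_far) simp
    have "gs j * tauD m (Suc d) = gs j * gi (Suc j) * gi j * tauD m e * (gs j * gs (Suc j))"
      unfolding t by (simp add: mult.assoc)
    also have "\<dots> = gi (Suc j) * gi j * (gs (Suc j) * tauD m e) * (gs j * gs (Suc j))"
      unfolding b1 by (simp add: mult.assoc)
    also have "\<dots> = gi (Suc j) * gi j * tauD m e * (gs (Suc j) * gs j * gs (Suc j))"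
      unfolding c by (simp add: mult.assoc)
    also have "\<dots> = tauD m (Suc d) * gs j"
      unfolding t using gs_braid[OF j1(1)] by (simp add: mult.assoc)
    finally show ?thesis .
  qed
qed

lemma tau_comm:
  assumes "1 \<le> j" "j \<noteq> m" "j \<noteq> k" "Suc j \<noteq> k"
  shows "gs j * tau m k = tau m k * gs j"
  using tauD_comm[of j m "k - Suc m"] assms by (auto simp: tau_def)

text \<open>A generator with index above 1 exchanges two values other than 1 and leaves the position
  of 1, hence the factor \<open>tau\<close>, unchanged.\<close>

lemma theta_left: assumes j: "1 < j" shows "theta m (gs j * x) = gs j * theta m x"
proof (rule hlin_eq[where F = "\<lambda>x. theta m (gs j * x)" and G = "\<lambda>x. gs j * theta m x"])
  show "hlin (\<lambda>x. theta m (gs j * x))" "hlin (\<lambda>x. gs j * theta m x)"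
    by (rule hlin_comp[OF hlin_theta hlin_left] hlin_comp[OF hlin_left hlin_theta])+
  fix w assume w: "fperm w"
  have j1: "1 \<le> j" using j by simp
  have "inv (sref j \<circ> w) 1 = inv w 1"
    unfolding inv_sref_comp[OF w j1] using j by (simp add: sref_def sw_def)
  then show "theta m (gs j * bI w) = gs j * theta m (bI w)"
    using w j1 fperm_comp[OF fperm_sref[OF j1] w]
    by (auto simp: gs_mult_bI hlinD[OF hlin_theta] hlin_0[OF hlin_theta] theta_bI mult.assoc[symmetric] distrib_right
        simp del: comp_apply)
qed

text \<open>Right multiplication may move the value 1 to a neighbouring position. As 1 is the least
  value, its direction decides whether the length grows, and \<open>tau_step\<close> supplies the
  change of the factor.\<close>

lemma theta_right: assumes j: "1 \<le> j" "j \<noteq> m" shows "theta m (x * gs j) = theta m x * gs j"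
proof (rule hlin_eq[where F = "\<lambda>x. theta m (x * gs j)" and G = "\<lambda>x. theta m x * gs j"])
  show "hlin (\<lambda>x. theta m (x * gs j))" "hlin (\<lambda>x. theta m x * gs j)"
    by (rule hlin_comp[OF hlin_theta hlin_right] hlin_comp[OF hlin_right hlin_theta])+
  fix w assume w: "fperm w"
  have fs: "fperm (w \<circ> sref j)" using w j by (intro fperm_comp fperm_sref)
  have iv: "inv (w \<circ> sref j) 1 = sref j (inv w 1)" by (simp add: inv_comp_sref[OF w j(1)])
  consider "inv w 1 \<noteq> j" "inv w 1 \<noteq> Suc j" | "inv w 1 = j" | "inv w 1 = Suc j" by blast
  then show "theta m (bI w * gs j) = theta m (bI w) * gs j"
  proof cases
    case 1
    then have "inv (w \<circ> sref j) 1 = inv w 1" unfolding iv by (simp add: sref_def sw_def)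
    moreover have "tau m (inv w 1) * gs j = gs j * tau m (inv w 1)"
      using tau_comm[of j m "inv w 1"] j 1 by auto
    moreover have "theta m (bI w * gs j) = (bI w * gs j) * tau m (inv w 1)"
      using calculation(1) w fs j
      by (simp add: bI_mult_gs hlinD[OF hlin_theta] hlin_0[OF hlin_theta] theta_bI distrib_right mult.assoc del: comp_apply)
    ultimately show ?thesis by (simp add: theta_bI w mult.assoc)
  next
    case 2
    then have wj: "w j = 1" using fperm_f_inv[OF w, of 1] by simp
    have "w (Suc j) \<noteq> 0" using fperm_0[OF w] fperm_inj[OF w, of "Suc j" 0] by auto
    moreover have "w (Suc j) \<noteq> 1" using fperm_inj[OF w, of "Suc j" j] wj by auto
    ultimately have "w j < w (Suc j)" using wj by simp
    then have e: "bI (w \<circ> sref j) = bI w * gs j" using w j by (intro bI_right_up)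
    have "theta m (bI w * gs j) = bI w * gs j * tau m (Suc j)"
      unfolding e[symmetric] using fs iv 2 by (simp add: theta_bI del: comp_apply)
    then show ?thesis using tau_step[OF j] 2 by (simp add: theta_bI w mult.assoc)
  next
    case 3
    then have wj: "w (Suc j) = 1" using fperm_f_inv[OF w, of 1] by simp
    have "w j \<noteq> 0" using fperm_0[OF w] fperm_inj[OF w, of j 0] j by auto
    moreover have "w j \<noteq> 1" using fperm_inj[OF w, of "Suc j" j] wj by auto
    ultimately have d: "w (Suc j) < w j" using wj by simp
    define y where "y = w \<circ> sref j"
    have y: "fperm y" "w = y \<circ> sref j" using fs by (simp_all add: y_def del: comp_apply)
    have e: "bI w = bI y * gs j"
      unfolding y(2) using y(1) j d by (intro bI_right_up) (simp_all add: y_def)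
    have ty: "inv y 1 = j" unfolding y_def iv 3 by simp
    have "bI w * gs j = bI y + sc zz * bI w"
      unfolding e by (simp add: mult.assoc gs_square[OF j(1)] distrib_left sc_left_comm)
    then have "theta m (bI w * gs j) = bI y * tau m j + sc zz * (bI w * tau m (Suc j))"
      using w y 3 ty by (simp add: hlinD[OF hlin_theta] theta_bI)
    also have "bI y * tau m j = bI w * gi j * tau m j"
      unfolding e using j by simp
    \<comment> \<open>This is \<open>tau_step\<close> multiplied by \<open>gi j\<close> on both
      sides; the remaining summand with \<open>sc zz\<close> then turns \<open>gi j\<close> back
      into \<open>gs j\<close>.\<close>
    also have "gi j * tau m j = tau m (Suc j) * gi j"
    proof -
      have "gi j * tau m j = gi j * (tau m j * gs j) * gi j" using j by (simp add: mult.assoc gs_gi)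
      then show ?thesis unfolding tau_step[OF j, symmetric] using j by simp
    qed
    then have "bI w * gi j * tau m j = bI w * tau m (Suc j) * gi j"
      by (simp add: mult.assoc)
    finally have "theta m (bI w * gs j) = bI w * tau m (Suc j) * (gi j + sc zz)"
      by (simp add: distrib_left mult.assoc sc_central sc_left_comm)
    then show ?thesis using w 3 by (simp add: theta_bI gi_def)
  qed
qed

lemma theta_galg_left: "b \<in> galg A \<Longrightarrow> A \<subseteq> {2..} \<Longrightarrow> theta m (b * x) = b * theta m x"
proof (induction arbitrary: x rule: galg.induct)
  case (gen i)
  then show ?case by (intro theta_left) auto
qed (simp_all add: hlinD[OF hlin_theta] distrib_right mult.assoc)

lemma theta_galg_right: "a \<in> galg A \<Longrightarrow> A \<subseteq> {1..} - {m} \<Longrightarrow> theta m (x * a) = theta m x * a"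
proof (induction arbitrary: x rule: galg.induct)
  case (gen i)
  then show ?case by (intro theta_right) auto
next
  case (mult a b)
  then show ?case by (simp add: mult.assoc[symmetric])
qed (simp_all add: hlinD[OF hlin_theta] distrib_left sc_central)

lemma theta_1: "1 \<le> m \<Longrightarrow> theta m 1 = 1"
  using theta_bI[of id m] by (simp add: tau_def)

lemma bI_cyc: assumes "1 \<le> a" shows "bI (cyc a k) = asc gs a k"
proof -
  have "bI id * asc gs a k = bI (id \<circ> cyc a k)" using assms by (intro bI_mult_asc) auto
  then show ?thesis by simp
qed

lemma theta_asc: "theta m (asc gs 1 m) = - asc gi 1 m"
proof -
  have f: "fperm (cyc 1 m)" using cyc_perms[of 1 m "1 + m"] by (intro perms_fperm) auto
  have "inv (cyc 1 m) 1 = Suc m"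
    using fperm_inv_f[OF f, of "Suc m"] by (simp add: cyc_def)
  then have "theta m (asc gs 1 m) = - (asc gs 1 m * desc gi 1 m * asc gi 1 m)"
    using theta_bI[OF f, of m] by (simp add: bI_cyc tau_def mult.assoc)
  then show ?thesis by (simp add: asc_desc_gs)
qed

text \<open>Since \<open>thD m (g\<^sub>1 x) = - g\<^sub>1\<^sup>-\<^sup>1 thD m x\<close>, the braid relation has to be checked only on three double coset
  representatives.\<close>
definition thD :: "nat \<Rightarrow> hk \<Rightarrow> hk" where
  "thD m x = theta m (gs 1 * theta m (gs 1 * x)) - gs 1 * theta m (gs 1 * theta m x)"

lemma hlin_thD: "hlin (thD m)"
  unfolding thD_def
  by (intro hlin_sub hlin_comp[OF hlin_theta] hlin_comp[OF hlin_left] hlin_theta hlin_left)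

lemma gs_square_mult: "1 \<le> i \<Longrightarrow> gs i * (gs i * x) = x + sc zz * (gs i * x)"
  by (simp add: mult.assoc[symmetric] gs_square distrib_right)

text \<open>The quadratic relation expands the first term of \<open>thD\<close>, and in the second
  the factor \<open>gi 1\<close> cancels the outer \<open>gs 1\<close>.\<close>

lemma thD_1_left: "thD m (gs 1 * x) = - (gi 1 * thD m x)"
proof -
  have a: "theta m (gs 1 * theta m (gs 1 * (gs 1 * x)))
      = theta m (gs 1 * theta m x) + sc zz * theta m (gs 1 * theta m (gs 1 * x))"
    by (simp add: gs_square_mult hlinD[OF hlin_theta] distrib_left sc_left_comm)
  have b: "gi 1 * (gs 1 * theta m (gs 1 * theta m x)) = theta m (gs 1 * theta m x)" by simp
  show ?thesis
    by (simp add: thD_def a right_diff_distrib b) (simp add: gi_def algebra_simps)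
qed

lemma thD_left: "b \<in> galg A \<Longrightarrow> A \<subseteq> {3..} \<Longrightarrow> thD m (b * x) = b * thD m x"
proof (induction arbitrary: x rule: galg.induct)
  case (gen i)
  then have i: "3 \<le> i" by auto
  then have c: "gs 1 * (gs i * y) = gs i * (gs 1 * y)" for y
    using gs_far[of 1 i] by (simp add: mult.assoc[symmetric])
  have "theta m (gs i * y) = gs i * theta m y" for y using i by (intro theta_left) simp
  then show ?case by (simp add: thD_def c right_diff_distrib)
next
  case (scalar c)
  show ?case by (simp add: hlinD[OF hlin_thD])
next
  case (add r s)
  then show ?case by (simp add: hlinD[OF hlin_thD] distrib_right)
qed (simp add: mult.assoc)

lemma thD_right: assumes "a \<in> galg A" "A \<subseteq> {1..} - {m}" shows "thD m (x * a) = thD m x * a"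
proof -
  have "theta m (y * a) = theta m y * a" for y by (rule theta_galg_right[OF assms])
  then show ?thesis by (simp add: thD_def mult.assoc[symmetric] left_diff_distrib)
qed

lemma thD_1: assumes "1 \<le> m" shows "thD m 1 = 0"
proof (cases "m = 1")
  case True
  have "theta m (gs 1) = - gi 1" using theta_asc[of m] True by simp
  then show ?thesis
    using assms by (simp add: thD_def theta_1 hlin_uminus[OF hlin_theta] gs_gi)
next
  case False
  then have "theta m (1 * gs 1) = gs 1" "theta m (1 * (gs 1 * gs 1)) = gs 1 * gs 1"
    using theta_galg_right[OF galg.gen, of 1 "{1}" m 1] theta_galg_right[OF galg.mult[OF galg.gen galg.gen], of 1 "{1}" 1 m 1] assms
    by (auto simp: theta_1)
  then show ?thesis using assms by (simp add: thD_def theta_1)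
qed

text \<open>The representative with the value 1 in the first block and the value 2 in the
  second.\<close>

lemma thD_W1: assumes "1 \<le> m" shows "thD m (asc gs 2 (m - 1)) = 0"
proof -
  let ?W = "asc gs 2 (m - 1)" and ?V = "asc gi 2 (m - 1)"
  have m: "Suc (m - 1) = m" using assms by simp
  have W: "gs 1 * ?W = asc gs 1 m" "gi 1 * ?V = asc gi 1 m"
    using asc_Suc'[of gs 1 "m - 1"] asc_Suc'[of gi 1 "m - 1"] unfolding m by (simp_all add: One_nat_def numeral_2_eq_2)
  have g: "?W \<in> galg {2..}" "?V \<in> galg {2..}" by (rule galg_asc; auto)+
  have W1: "theta m ?W = ?W" "theta m ?V = ?V"
    using theta_galg_left[OF g(1), of m 1] theta_galg_left[OF g(2), of m 1] assms by (auto simp: theta_1)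
  have "gs 1 * theta m (gs 1 * ?W) = - ?V"
    unfolding W(1) theta_asc W(2)[symmetric] by simp
  then show ?thesis by (simp add: thD_def W1 hlin_uminus[OF hlin_theta])
qed

lemma asc_swap:
  assumes f: "f = gs \<or> f = gi" and h: "h = gs \<or> h = gi" and a: "1 \<le> a" and n: "n \<le> m"
  shows "asc f a (Suc m) * asc h a n = asc h (Suc a) n * asc f a (Suc m)"
  using n
proof (induction n)
  case (Suc n)
  have "asc f a (Suc m) * gs (a + n) = gs (Suc a + n) * asc f a (Suc m)"
    using asc_shift[OF f a, of "a + n" "Suc m"] Suc.prems by simp
  then have "asc f a (Suc m) * h (a + n) = h (Suc a + n) * asc f a (Suc m)"
    using h by (auto simp: gi_def right_diff_distrib left_diff_distrib sc_central)
  then show ?case using Suc by (simp add: asc_Suc) (metis mult.assoc)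
qed simp

text \<open>The representative with both values 1 and 2 in the second block. Left multiplication by
  \<open>gs 1\<close> becomes right multiplication by \<open>gs (Suc m)\<close>, with which
  \<open>theta m\<close> commutes.\<close>

lemma thD_W2: assumes "1 \<le> m" shows "thD m (asc gs 2 m * asc gs 1 m) = 0"
proof -
  have T: "Suc 1 = 2" by simp
  let ?g = "gs (Suc m)"
  have right: "theta m (x * ?g) = theta m x * ?g" for x by (rule theta_right) auto
  define W X Y Z where "W = asc gs 2 m * asc gs 1 m" and "X = asc gs 2 m * asc gi 1 m"
    and "Y = asc gi 2 m * asc gs 1 m" and "Z = asc gi 2 m * asc gi 1 m"
  have s1: "asc gs 1 (Suc m) = gs 1 * asc gs 2 m" "asc gs 1 (Suc m) = asc gs 1 m * ?g"
    by (simp only: asc_Suc' T) (simp add: asc_Suc plus_1_eq_Suc)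
  have i1: "asc gi 1 (Suc m) = gi 1 * asc gi 2 m" "asc gi 1 (Suc m) = asc gi 1 m * gi (Suc m)"
    by (simp only: asc_Suc' T) (simp add: asc_Suc plus_1_eq_Suc)
  have g: "asc gs 2 m \<in> galg {2..}" "asc gi 2 m \<in> galg {2..}" by (rule galg_asc; auto)+
  have thW: "theta m W = - X"
    unfolding W_def X_def theta_galg_left[OF g(1) order_refl] theta_asc by simp
  have thY: "theta m Y = - Z"
    unfolding Y_def Z_def theta_galg_left[OF g(2) order_refl] theta_asc by simp
  have gW: "gs 1 * W = W * ?g"
  proof -
    have "gs 1 * W = asc gs 1 (Suc m) * asc gs 1 m" by (simp add: W_def s1(1) mult.assoc)
    also have "\<dots> = asc gs 2 m * asc gs 1 (Suc m)"
      using asc_swap[of gs gs 1 m m] by (simp add: T)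
    finally show ?thesis by (simp add: W_def s1(2) mult.assoc)
  qed
  have gX: "gs 1 * X = Y * ?g"
  proof -
    have "gs 1 * X = asc gs 1 (Suc m) * asc gi 1 m" by (simp add: X_def s1(1) mult.assoc)
    also have "\<dots> = asc gi 2 m * asc gs 1 (Suc m)"
      using asc_swap[of gs gi 1 m m] by (simp add: T)
    finally show ?thesis by (simp add: Y_def s1(2) mult.assoc)
  qed
  have gZ: "gs 1 * Z = Z * ?g"
  proof -
    have "gi 1 * Z = asc gi 1 (Suc m) * asc gi 1 m" by (simp add: Z_def i1(1) mult.assoc)
    also have "\<dots> = asc gi 2 m * asc gi 1 (Suc m)"
      using asc_swap[of gi gi 1 m m] by (simp add: T)
    finally have "gi 1 * Z = Z * gi (Suc m)" by (simp add: Z_def i1(2) mult.assoc)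
    then show ?thesis
      by (simp add: gi_def right_diff_distrib left_diff_distrib sc_central)
  qed
  have "theta m (gs 1 * theta m (gs 1 * W)) = - (theta m (gs 1 * X) * ?g)"
    by (simp add: gW right thW hlin_uminus[OF hlin_theta] mult.assoc[symmetric])
  also have "\<dots> = Z * ?g * ?g" by (simp add: gX right thY)
  also have "\<dots> = gs 1 * theta m (gs 1 * theta m W)"
    by (simp add: thW gX right thY hlin_uminus[OF hlin_theta] gZ mult.assoc[symmetric])
  finally show ?thesis by (simp add: thD_def W_def)
qed

lemma thD_0: assumes m: "1 \<le> m" shows "thD m x = 0"
proof (rule hlin_eq[where F = "thD m" and G = "\<lambda>x. 0"])
  show "hlin (thD m)" "hlin (\<lambda>x. 0)" by (rule hlin_thD, simp add: hlin_def)
  fix w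
  assume "fperm w"
  then obtain n0 where "w \<in> perms n0" by (auto simp: fperm_def)
  then obtain n where w: "w \<in> perms n" and n: "2 \<le> n"
    using perms_mono[of w n0 "max n0 2"] by (meson max.cobounded1 max.cobounded2)
  obtain b where b: "b \<in> perms n" "\<forall>i\<in>{1..1}. b i = i" "1 \<le> inv w 1"
    "bI w = bI b * asc gs 1 (inv w 1 - 1)"
    by (rule bI_factor[OF w, of 1]) (use n in auto)
  obtain c where c: "c \<in> perms n" "\<forall>i\<in>{1..2}. c i = i" "2 \<le> inv b 2"
    "bI b = bI c * asc gs 2 (inv b 2 - 2)"
    by (rule bI_factor[OF b(1), of 2]) (use n b(2) in \<open>auto simp: numeral_2_eq_2 One_nat_def\<close>)
  define k l where "k = inv w 1 - 1" and "l = inv b 2 - 2"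
  have cg: "bI c \<in> galg {3..<n}" using bI_galg_fix[OF c(1,2)] by (simp add: numeral_3_eq_3 numeral_2_eq_2)
  have e: "thD m (bI w) = bI c * thD m (asc gs 2 l * asc gs 1 k)"
    unfolding b(4) c(4) k_def[symmetric] l_def[symmetric]
    unfolding mult.assoc by (rule thD_left[OF cg]) auto
  have right: "thD m (x * asc gs a r) = thD m x * asc gs a r"
    if "1 \<le> a" "a + r \<le> m \<or> m < a" for x a r
    by (rule thD_right[of _ "{a..<a + r}"]) (use that in \<open>auto intro: galg_asc\<close>)
  \<comment> \<open>The value 1 is in the first block here; the two cases ask for the block of the
    value 2.\<close>
  have left_part: "thD m (asc gs 2 l) = 0" for l
  proof (cases "2 + l \<le> m")
    case True
    then show ?thesis using right[of 2 l 1] m by (simp add: thD_1)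
  next
    case False
    then have "l = (m - 1) + (l - (m - 1))" "2 + (m - 1) = Suc m" using m by auto
    then have "asc gs 2 l = asc gs 2 (m - 1) * asc gs (Suc m) (l - (m - 1))" by (metis asc_add)
    then show ?thesis using right[of "Suc m" _ "asc gs 2 (m - 1)"] m by (simp add: thD_W1)
  qed
  have "thD m (asc gs 2 l * asc gs 1 k) = 0"
  proof (cases "k < m")
    case True
    then show ?thesis using right[of 1 k "asc gs 2 l"] by (simp add: left_part)
  next
    case False
    then have "k = m + (k - m)" by simp
    then have "asc gs 1 k = asc gs 1 m * asc gs (1 + m) (k - m)" by (metis asc_add)
    then have e1: "thD m (asc gs 2 l * asc gs 1 k) = thD m (asc gs 2 l * asc gs 1 m) * asc gs (1 + m) (k - m)"
      using right[of "1 + m" "k - m" "asc gs 2 l * asc gs 1 m"] by (simp add: mult.assoc)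
    have "thD m (asc gs 2 l * asc gs 1 m) = 0"
    proof (cases "l < m")
      case True
      \<comment> \<open>Here 1 is in the second block and 2 in the first. Sliding the words past
        each other exposes a left factor \<open>gs 1\<close>, which reduces this case to
        \<open>thD_W1\<close>.\<close>
      have "m = Suc (m - 1)" using m by simp
      then have "asc gs 2 l * asc gs 1 m = asc gs 1 m * asc gs 1 l"
        using asc_swap[of gs gs 1 l "m - 1"] True by (simp add: One_nat_def numeral_2_eq_2)
      moreover have "asc gs 1 m = gs 1 * asc gs 2 (m - 1)"
        using asc_Suc'[of gs 1 "m - 1"] m by (simp add: One_nat_def numeral_2_eq_2)
      ultimately show ?thesis
        using right[of 1 l "asc gs 1 m"] True m by (simp add: thD_1_left thD_W1)
    next
      case False
      then have "l = m + (l - m)" by simp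
      then have "asc gs 2 l = asc gs 2 m * asc gs (2 + m) (l - m)" by (metis asc_add)
      moreover have "asc gs 1 m * asc gs (2 + m) (l - m) = asc gs (2 + m) (l - m) * asc gs 1 m"
        by (intro asc_comm asc_comm[symmetric] gs_far) auto
      ultimately have "asc gs 2 l * asc gs 1 m = asc gs 2 m * asc gs 1 m * asc gs (2 + m) (l - m)"
        by (simp add: mult.assoc)
      then show ?thesis using right[of "2 + m" "l - m" "asc gs 2 m * asc gs 1 m"] m by (simp add: thD_W2)
    qed
    then show ?thesis using e1 by simp
  qed
  then show "thD m (bI w) = 0" using e by simp
qed

lemma theta_braid: "1 \<le> m \<Longrightarrow> theta m (gs 1 * theta m (gs 1 * x)) = gs 1 * theta m (gs 1 * theta m x)"
  using thD_0[of m x] by (simp add: thD_def)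

text \<open>The additive endomorphisms form the ring in which left multiplications and
  \<open>theta m\<close> together satisfy the assumptions of \<open>type_B\<close>.\<close>

typedef endo = "{f :: hk \<Rightarrow> hk. \<forall>x y. f (x + y) = f x + f y}" morphisms ap Abs_endo
  by (rule exI[of _ "\<lambda>x. x"]) simp

lemma ap_add: "ap f (x + y) = ap f x + ap f y"
  using ap[of f] by simp

lemma ap_0 [simp]: "ap f 0 = 0"
  using ap_add[of f 0 0] by simp

lemma endo_eqI: "(\<And>x. ap f x = ap g x) \<Longrightarrow> f = g"
  by (simp add: ap_inject[symmetric] fun_eq_iff)

instantiation endo :: ring_1
begin

definition zero_endo :: endo where "0 = Abs_endo (\<lambda>x. 0)"
definition one_endo :: endo where "1 = Abs_endo (\<lambda>x. x)"
definition plus_endo :: "endo \<Rightarrow> endo \<Rightarrow> endo" where "f + g = Abs_endo (\<lambda>x. ap f x + ap g x)"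
definition uminus_endo :: "endo \<Rightarrow> endo" where "- f = Abs_endo (\<lambda>x. - ap f x)"
definition minus_endo :: "endo \<Rightarrow> endo \<Rightarrow> endo" where "f - g = Abs_endo (\<lambda>x. ap f x - ap g x)"
definition times_endo :: "endo \<Rightarrow> endo \<Rightarrow> endo" where "f * g = Abs_endo (\<lambda>x. ap f (ap g x))"

lemma ap_simps [simp]:
  "ap 0 x = 0" "ap 1 x = x" "ap (f + g) x = ap f x + ap g x" "ap (- f) x = - ap f x"
  "ap (f - g) x = ap f x - ap g x" "ap (f * g) x = ap f (ap g x)"
  by (simp_all add: zero_endo_def one_endo_def plus_endo_def uminus_endo_def minus_endo_def
      times_endo_def Abs_endo_inverse ap_add)

instance
proof
  have "ap (0 :: endo) 1 \<noteq> ap 1 1" by simp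
  then show "(0 :: endo) \<noteq> 1" by metis
qed (rule endo_eqI; simp add: ap_add add.assoc add.commute)+

end

definition lm :: "hk \<Rightarrow> endo" where "lm a = Abs_endo (\<lambda>x. a * x)"
definition theta_endo :: "nat \<Rightarrow> endo" where "theta_endo m = Abs_endo (theta m)"

lemma ap_lm [simp]: "ap (lm a) x = a * x"
  by (simp add: lm_def Abs_endo_inverse distrib_left)

lemma ap_theta_endo [simp]: "ap (theta_endo m) x = theta m x"
  by (simp add: theta_endo_def Abs_endo_inverse hlinD[OF hlin_theta])

lemma type_B_theta_endo:
  assumes "1 \<le> m"
  shows "type_B (theta_endo m) (lm (sc zz)) (\<lambda>i. lm (gs i))"
proof
  fix i j :: nat
  show "lm (gs i) * lm (gs i) = 1 + lm (sc zz) * lm (gs i)" if "1 \<le> i"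
    using that by (intro endo_eqI) (simp add: gs_square_mult)
  show "lm (gs i) * lm (gs j) = lm (gs j) * lm (gs i)" if "1 \<le> i" "Suc i < j"
    using gs_commute[OF that] by (intro endo_eqI) (simp add: mult.assoc[symmetric])
  show "lm (gs i) * lm (gs (Suc i)) * lm (gs i) = lm (gs (Suc i)) * lm (gs i) * lm (gs (Suc i))" if "1 \<le> i"
    using gs_braid[OF that] by (intro endo_eqI) (simp add: mult.assoc[symmetric])
  show "theta_endo m * lm (gs i) = lm (gs i) * theta_endo m" if "1 < i"
    using that by (intro endo_eqI) (simp add: theta_left)
  show "theta_endo m * lm (gs 1) * theta_endo m * lm (gs 1) = lm (gs 1) * theta_endo m * lm (gs 1) * theta_endo m"
    by (intro endo_eqI) (simp add: theta_braid assms)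
  show "lm (sc zz) * lm (gs i) = lm (gs i) * lm (sc zz)"
    by (intro endo_eqI) (simp add: sc_left_comm)
  show "lm (sc zz) * theta_endo m = theta_endo m * lm (sc zz)"
    by (intro endo_eqI) (simp add: hlinD[OF hlin_theta])
qed

section \<open>The products u_k as operators on the Hecke algebra\<close>

definition uop :: "nat \<Rightarrow> nat \<Rightarrow> hk \<Rightarrow> hk" where
  "uop m k = ap (type_B.u (theta_endo m) (\<lambda>i. lm (gs i)) k)"

definition Lop :: "nat \<Rightarrow> nat \<Rightarrow> hk \<Rightarrow> hk" where
  "Lop m k x = desc gs 1 k * theta m (asc gs 1 k * x)"

lemma lm_asc: "asc (\<lambda>i. lm (gs i)) a k = lm (asc gs a k)" "desc (\<lambda>i. lm (gs i)) a k = lm (desc gs a k)"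
  by (induction k; intro endo_eqI; simp add: asc_Suc desc_Suc mult.assoc)+

context
  fixes m :: nat
  assumes m: "1 \<le> m"
begin

lemma uop_0: "uop m 0 x = x"
  by (simp add: uop_def type_B.u.simps[OF type_B_theta_endo[OF m]])

lemma uop_Suc: "uop m (Suc k) x = uop m k x - Lop m k (uop m k x)"
  by (simp add: uop_def Lop_def type_B.u.simps[OF type_B_theta_endo[OF m]] type_B.L_asc[OF type_B_theta_endo[OF m]]
      lm_asc)

lemma uop_left:
  assumes "1 \<le> i" "i \<noteq> k"
  shows "uop m k (gs i * x) = gs i * uop m k x"
proof -
  have "lm (gs i) * type_B.u (theta_endo m) (\<lambda>i. lm (gs i)) k = type_B.u (theta_endo m) (\<lambda>i. lm (gs i)) k * lm (gs i)"
    using type_B.u_far[OF type_B_theta_endo[OF m], of k i] type_B.u_near[OF type_B_theta_endo[OF m], of i k] assms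
    by (cases "i < k") auto
  then have "ap (lm (gs i) * type_B.u (theta_endo m) (\<lambda>i. lm (gs i)) k) x
      = ap (type_B.u (theta_endo m) (\<lambda>i. lm (gs i)) k * lm (gs i)) x" by simp
  then show ?thesis by (simp add: uop_def)
qed

lemma uop_add: "uop m k (x + y) = uop m k x + uop m k y"
  by (simp add: uop_def ap_add)

lemma uop_right:
  assumes "1 \<le> j" "j \<noteq> m"
  shows "uop m k (x * gs j) = uop m k x * gs j"
proof (induction k)
  case (Suc k)
  then show ?case
    using theta_right[OF assms, of "asc gs 1 k * uop m k x"]
    by (simp add: uop_Suc Lop_def left_diff_distrib mult.assoc)
qed (simp add: uop_0)

text \<open>The rightmost factor of every nonempty product u is 1 - \<open>theta m\<close>.\<close>

lemma uop_kill: assumes "theta m x = x" shows "uop m (Suc k) x = 0"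
proof -
  obtain w where w: "type_B.u (theta_endo m) (\<lambda>i. lm (gs i)) (Suc k) = w * (1 - theta_endo m)"
    using type_B.u_factor[OF type_B_theta_endo[OF m]] by blast
  show ?thesis unfolding uop_def w using assms by simp
qed

lemma uop_scale: "uop m k (sc c * x) = sc c * uop m k x"
proof (induction k)
  case (Suc k)
  then show ?case
    by (simp add: uop_Suc Lop_def right_diff_distrib sc_left_comm hlinD[OF hlin_theta])
qed (simp add: uop_0)

lemma hlin_uop: "hlin (uop m k)"
  by (simp add: hlin_def uop_add uop_scale)

lemma uop_galg: "r \<in> galg A \<Longrightarrow> A \<subseteq> {1..} - {k} \<Longrightarrow> uop m k (r * x) = r * uop m k x"
proof (induction arbitrary: x rule: galg.induct)
  case (gen i)
  then show ?case by (intro uop_left) auto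
qed (simp_all add: uop_add uop_scale distrib_right mult.assoc)

end

section \<open>The commutation rule for H1 and its square\<close>

abbreviation young_gens :: "nat \<Rightarrow> nat set" where
  "young_gens m \<equiv> {1..<2 * m} - {m}"

text \<open>\<open>jucys m j\<close> is \<open>c\<^bsub>m,j\<^esub>\<close>, and \<open>Hpart m k\<close> is the part of \<open>\<Sum>\<^sub>\<epsilon> I\<^sub>\<epsilon> C\<^sub>\<epsilon>\<close> made of the last
  \<open>k\<close> factors of each \<open>I\<^sub>\<epsilon>\<close>; the recursion moves \<open>c\<^bsub>m,k\<^esub>\<close> to the right end.\<close>
definition jucys :: "nat \<Rightarrow> nat \<Rightarrow> hk" where
  "jucys m j = desc gs (Suc m) j * asc gs (Suc m) j"

primrec Hpart :: "nat \<Rightarrow> nat \<Rightarrow> hk" where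
  "Hpart m 0 = 1"
| "Hpart m (Suc k) = asc gs (Suc k) m * Hpart m k + asc gi (Suc k) m * Hpart m k * jucys m k"

text \<open>The basis element of the permutation \<open>tk m k\<close>, by \<open>tpart_bI\<close>;
  for k = m this is I_(t_1).\<close>

primrec tpart :: "nat \<Rightarrow> nat \<Rightarrow> hk" where
  "tpart m 0 = 1"
| "tpart m (Suc k) = asc gs (Suc k) m * tpart m k"

lemma jucys_galg: "jucys m k \<in> galg {Suc m..m + k}"
  unfolding jucys_def by (rule galg.mult; rule galg_asc) auto

lemma Hpart_galg: "Hpart m k \<in> galg {1..<m + k}"
proof (induction k)
  case (Suc k)
  have "Hpart m k \<in> galg {1..<m + Suc k}" using Suc by (rule galg_mono) auto
  moreover have "jucys m k \<in> galg {1..<m + Suc k}" by (rule galg_mono[OF jucys_galg]) auto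
  moreover have "asc gs (Suc k) m \<in> galg {1..<m + Suc k}" "asc gi (Suc k) m \<in> galg {1..<m + Suc k}"
    by (rule galg_asc; auto)+
  ultimately show ?case unfolding Hpart.simps by (intro galg.add galg.mult)
qed simp

text \<open>Pushed left through the full word of length m + k, R becomes an r in letters above 1 and
  so passes \<open>theta m\<close>, which then replaces \<open>asc gs 1 m\<close> by
  \<open>- asc gi 1 m\<close>. Completing that to the full inverse word lets r return as R and
  leaves the Jucys-Murphy element on the right.\<close>

lemma Lop_step:
  assumes R: "R \<in> galg {1..<m + k}"
  shows "Lop m k (asc gs (Suc k) m * R) = - (asc gi (Suc k) m * R * jucys m k)"
proof -
  let ?T = "{asc gs 1 (m + k), asc gi 1 (m + k)}"
  have "\<exists>r\<in>galg {2..}. \<forall>t\<in>?T. t * R = r * t"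
  proof (rule galg_intertwine[OF _ R])
    fix i assume i: "i \<in> {1..<m + k}"
    then have "\<forall>t\<in>?T. t * gs i = gs (Suc i) * t"
      using asc_shift[of gs 1 i "m + k"] asc_shift[of gi 1 i "m + k"] by auto
    moreover have "gs (Suc i) \<in> galg {2..}" using i by (intro galg.gen) auto
    ultimately show "\<exists>r\<in>galg {2..}. \<forall>t\<in>?T. t * gs i = r * t" by blast
  qed
  then obtain r where r: "r \<in> galg {2..}" "asc gs 1 (m + k) * R = r * asc gs 1 (m + k)"
    "asc gi 1 (m + k) * R = r * asc gi 1 (m + k)" by blast
  have ik: "asc gs 1 k * asc gs (Suc k) m = asc gs 1 (m + k)"
    "asc gi 1 k * asc gi (Suc k) m = asc gi 1 (m + k)"
    unfolding add.commute[of m k] by (simp_all add: asc_add plus_1_eq_Suc)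
  have im: "asc gs 1 (m + k) = asc gs 1 m * asc gs (Suc m) k"
    "asc gi 1 (m + k) = asc gi 1 m * asc gi (Suc m) k"
    using asc_add[of _ 1 m k] by (simp_all add: plus_1_eq_Suc)
  have up: "asc gs (Suc m) k \<in> galg {Suc m..}" by (rule galg_asc) auto
  have "theta m (asc gs 1 k * (asc gs (Suc k) m * R)) = theta m (r * (asc gs 1 m * asc gs (Suc m) k))"
    using r(2) ik(1) im(1) by (simp add: mult.assoc[symmetric])
  also have "\<dots> = r * (theta m (asc gs 1 m) * asc gs (Suc m) k)"
    unfolding theta_galg_left[OF r(1) order_refl] by (subst theta_galg_right[OF up]) auto
  also have "\<dots> = - (r * asc gi 1 m * asc gs (Suc m) k)"
    by (simp add: theta_asc mult.assoc)
  also have "asc gi 1 m = asc gi 1 (m + k) * desc gs (Suc m) k"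
    unfolding im by (simp add: mult.assoc asc_desc_gs One_nat_def)
  also have "r * (asc gi 1 (m + k) * desc gs (Suc m) k) * asc gs (Suc m) k = asc gi 1 (m + k) * R * jucys m k"
    unfolding r(3) by (simp add: jucys_def mult.assoc)
  also have "desc gs 1 k * - (asc gi 1 (m + k) * R * jucys m k)
      = - (desc gs 1 k * asc gi 1 k * asc gi (Suc k) m * R * jucys m k)"
    unfolding ik(2)[symmetric] by (simp add: mult.assoc)
  finally show ?thesis unfolding Lop_def by (simp add: asc_desc_gs)
qed

text \<open>The new string of letters lies above k and commutes with u_k. The factor 1 - L_(k+1)
  then creates both summands of the recursion, the sign being absorbed by
  \<open>Lop_step\<close>.\<close>

lemma uop_tpart: assumes m: "1 \<le> m" shows "uop m k (tpart m k) = Hpart m k"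
proof (induction k)
  case (Suc k)
  have "asc gs (Suc k) m \<in> galg {Suc k..}" by (rule galg_asc) auto
  then have "uop m k (tpart m (Suc k)) = asc gs (Suc k) m * Hpart m k"
    unfolding tpart.simps Suc[symmetric] by (rule uop_galg[OF m]) auto
  then show ?case unfolding uop_Suc[OF m] by (simp add: Lop_step[OF Hpart_galg])
qed (simp add: uop_0[OF m])

lemma tpart_high:
  assumes "1 \<le> i" "i < m"
  shows "gs (i + k) * tpart m k = tpart m k * gs i"
proof (induction k)
  case (Suc k)
  have "gs (i + Suc k) * tpart m (Suc k) = gs (Suc (i + k)) * asc gs (Suc k) m * tpart m k"
    by (simp add: mult.assoc)
  also have "gs (Suc (i + k)) * asc gs (Suc k) m = asc gs (Suc k) m * gs (i + k)"
    using assms by (intro asc_shift[symmetric]) auto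
  also have "asc gs (Suc k) m * gs (i + k) * tpart m k = asc gs (Suc k) m * (gs (i + k) * tpart m k)"
    by (rule mult.assoc)
  finally show ?case unfolding Suc by (simp add: mult.assoc)
qed simp

lemma tpart_galg: "tpart m k \<in> galg {1..<m + k}"
proof (induction k)
  case (Suc k)
  have "tpart m k \<in> galg {1..<m + Suc k}" using Suc by (rule galg_mono) auto
  moreover have "asc gs (Suc k) m \<in> galg {1..<m + Suc k}" by (rule galg_asc) auto
  ultimately show ?case unfolding tpart.simps by (intro galg.mult)
qed simp

text \<open>A letter below the top string commutes with that string. At i = k the two topmost
  strings slide over each other and the letter emerges as k + m.\<close>

lemma tpart_low:
  assumes "1 \<le> i" "i < k"
  shows "gs i * tpart m k = tpart m k * gs (i + m)"
  using assms(2)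
proof (induction k)
  case (Suc k)
  show ?case
  proof (cases "i = k")
    case False
    then have "gs i * asc gs (Suc k) m = asc gs (Suc k) m * gs i"
      using Suc.prems assms(1) by (intro asc_comm gs_far) auto
    then have "gs i * tpart m (Suc k) = asc gs (Suc k) m * (gs i * tpart m k)"
      by (simp add: mult.assoc[symmetric])
    then show ?thesis using Suc False by (simp add: mult.assoc)
  next
    case True
    obtain j where k: "k = Suc j" using assms(1) True by (cases k) auto
    have c: "gs (k + m) * tpart m j = tpart m j * gs (k + m)"
      by (rule galg_comm[OF gs_far tpart_galg]) (use k in auto)
    have "gs k * (asc gs (Suc k) m * asc gs k m) = asc gs k (Suc m) * asc gs k m"
      by (simp add: asc_Suc' mult.assoc)
    also have "\<dots> = asc gs (Suc k) m * asc gs k (Suc m)"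
      using asc_swap[of gs gs k m m] assms(1) True by simp
    also have "\<dots> = asc gs (Suc k) m * asc gs k m * gs (k + m)"
      by (simp add: asc_Suc mult.assoc)
    finally have "gs k * tpart m (Suc k) = asc gs (Suc k) m * asc gs k m * (gs (k + m) * tpart m j)"
      by (simp add: k mult.assoc[symmetric])
    then show ?thesis unfolding c True by (simp add: k mult.assoc)
  qed
qed simp

context
  fixes m :: nat
  assumes m: "1 \<le> m"
begin

lemma Hpart_low:
  assumes "1 \<le> i" "i < m"
  shows "gs i * Hpart m m = Hpart m m * gs (i + m)"
proof -
  have "gs i * Hpart m m = uop m m (gs i * tpart m m)"
    using uop_left[OF m, of i m "tpart m m"] assms by (simp add: uop_tpart[OF m])
  also have "\<dots> = Hpart m m * gs (i + m)"
    using uop_right[OF m, of "i + m" m "tpart m m"] assms by (simp add: tpart_low uop_tpart[OF m])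
  finally show ?thesis .
qed

lemma Hpart_high:
  assumes "1 \<le> i" "i < m"
  shows "gs (i + m) * Hpart m m = Hpart m m * gs i"
proof -
  have "gs (i + m) * Hpart m m = uop m m (gs (i + m) * tpart m m)"
    using uop_left[OF m, of "i + m" m "tpart m m"] assms by (simp add: uop_tpart[OF m])
  also have "\<dots> = Hpart m m * gs i"
    using uop_right[OF m, of i m "tpart m m"] assms by (simp add: tpart_high uop_tpart[OF m])
  finally show ?thesis .
qed

lemma uop_Suc_zero:
  assumes x: "supported (2 * m) x"
  shows "uop m (Suc m) x = 0"
proof -
  have kill: "uop m (Suc m) (bI w) = 0" if "w \<in> perms (2 * m)" "1 \<le> i" "i \<le> Suc m" "inv w i \<le> m" for i w
    using that
  proof (induction i arbitrary: w)
    case (Suc i)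
    have f: "fperm w" using Suc.prems(1) by (rule perms_fperm)
    show ?case
    proof (cases "i = 0")
      case True
      then have "theta m (bI w) = bI w" using Suc.prems f by (simp add: theta_bI tau_def One_nat_def)
      then show ?thesis by (rule uop_kill[OF m])
    next
      case False
      then have i: "1 \<le> i" "i \<le> Suc m" "i \<noteq> Suc m" "i < 2 * m" using Suc.prems m by auto
      show ?thesis
      proof (cases "inv w i \<le> m")
        case True
        then show ?thesis using Suc i by blast
      next
        case False
        \<comment> \<open>The value i+1 is in the first block and i is not, so i is a left descent;
          and \<open>gs i\<close> commutes with \<open>uop m (Suc m)\<close> because i is not
          m+1.\<close>
        then have d: "inv w (Suc i) < inv w i" using Suc.prems by simp
        have "inv (sref i \<circ> w) i \<le> m" using Suc.prems by (simp add: inv_sref_comp[OF f i(1)])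
        then have "uop m (Suc m) (bI (sref i \<circ> w)) = 0"
          using Suc.prems i by (intro Suc.IH perms_sref_comp)
        then show ?thesis
          unfolding bI_left_down[OF f i(1) d] uop_left[OF m i(1,3)] by simp
      qed
    qed
  qed simp
  have zero: "uop m (Suc m) (bI w) = 0" if w: "w \<in> perms (2 * m)" for w
  proof -
    have "\<exists>i\<in>{1..Suc m}. inv w i \<le> m"
    proof (rule ccontr)
      assume n: "\<not> (\<exists>i\<in>{1..Suc m}. inv w i \<le> m)"
      have iv: "inv w i \<in> {1..2 * m}" if "i \<in> {1..Suc m}" for i
        using perms_in[OF inv_perms[OF w], of i] that m by auto
      have "inv w ` {1..Suc m} \<subseteq> {Suc m..2 * m}"
        using n iv by (force simp: not_le Suc_le_eq)
      then have "card (inv w ` {1..Suc m}) \<le> card {Suc m..2 * m}" by (intro card_mono) auto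
      moreover have "inj_on (inv w) {1..Suc m}"
        using fperm_inj[OF fperm_inv[OF perms_fperm[OF w]]] by (auto simp: inj_on_def)
      ultimately show False by (simp add: card_image)
    qed
    then show ?thesis using kill w by auto
  qed
  show ?thesis
    by (rule hlin_eq[OF hlin_uop[OF m]]) (use x zero in \<open>auto simp: hlin_def supported_co\<close>)
qed

lemma theta_asc_Hpart: "theta m (asc gs 1 m * Hpart m m) = asc gi 1 m * Hpart m m"
proof -
  have "supported (2 * m) (tpart m m)"
    using m by (intro supported_galg[OF tpart_galg]) auto
  then have "Hpart m m = desc gs 1 m * theta m (asc gs 1 m * Hpart m m)"
    using uop_Suc_zero[of "tpart m m"] by (simp add: uop_Suc[OF m] uop_tpart[OF m] Lop_def)
  then have "asc gi 1 m * Hpart m m = asc gi 1 m * desc gs 1 m * theta m (asc gs 1 m * Hpart m m)"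
    by (metis mult.assoc)
  then show ?thesis by (simp add: asc_desc_gs)
qed

text \<open>This span is stable under left multiplication by letters above 1 and under right
  multiplication by Young generators, the moves needed to propagate membership.\<close>

definition front :: "hk set" where
  "front = {x. \<forall>w. co x w \<noteq> 0 \<longrightarrow> inv w 1 \<le> m}"

lemma front_add: "x \<in> front \<Longrightarrow> y \<in> front \<Longrightarrow> x + y \<in> front"
  by (auto simp: front_def) (metis add.left_neutral)

lemma front_0: "0 \<in> front" and front_1: "1 \<in> front" and front_sc: "x \<in> front \<Longrightarrow> sc c * x \<in> front"
  using m co_bI[of id] by (auto simp: front_def split: if_splits)

lemma front_left: "b \<in> galg A \<Longrightarrow> A \<subseteq> {2..} \<Longrightarrow> x \<in> front \<Longrightarrow> b * x \<in> front"
proof (induction arbitrary: x rule: galg.induct)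
  case (gen j)
  then have j: "1 < j" "1 \<le> j" by auto
  have "inv w 1 \<le> m" if w: "co (gs j * x) w \<noteq> 0" for w
  proof -
    have f: "fperm w" using w co_out by blast
    have "inv (sref j \<circ> w) 1 = inv w 1"
      unfolding inv_sref_comp[OF f j(2)] using j by (simp add: sref_def sw_def)
    moreover have "co x (sref j \<circ> w) \<noteq> 0 \<or> co x w \<noteq> 0"
      using w by (auto simp: co_gs_mult[OF f j(2)] split: if_splits)
    ultimately show ?thesis using gen(3) by (auto simp: front_def)
  qed
  then show ?case by (simp add: front_def)
qed (simp_all add: front_sc front_add distrib_right mult.assoc)

lemma front_right: "a \<in> galg A \<Longrightarrow> A \<subseteq> {1..} - {m} \<Longrightarrow> x \<in> front \<Longrightarrow> x * a \<in> front"
proof (induction arbitrary: x rule: galg.induct)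
  case (gen j)
  then have j: "j \<noteq> m" "1 \<le> j" by auto
  have "inv w 1 \<le> m" if w: "co (x * gs j) w \<noteq> 0" for w
  proof -
    have f: "fperm w" using w co_out by blast
    have "inv (w \<circ> sref j) 1 = sref j (inv w 1)"
      by (simp add: inv_comp_sref[OF f j(2)])
    then have "inv (w \<circ> sref j) 1 \<le> m \<longleftrightarrow> inv w 1 \<le> m"
      using j by (auto simp: sref_def sw_def)
    moreover have "co x (w \<circ> sref j) \<noteq> 0 \<or> co x w \<noteq> 0"
      using w by (auto simp: co_mult_gs[OF f j(2)] split: if_splits)
    ultimately show ?thesis using gen(3) by (auto simp: front_def)
  qed
  then show ?case by (simp add: front_def)
next
  case (mult a b)
  then show ?case by (simp add: mult.assoc[symmetric])
qed (simp_all add: front_sc front_add distrib_left sc_central)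

text \<open>Exchanging a letter for its inverse costs a multiple of the word without this letter.
  Such a word splits at the gap into two commuting pieces and cannot carry the value 1 past position
  m.\<close>

lemma asc_diff_front:
  assumes "j + r = m"
  shows "asc gs 1 j * (asc gs (Suc j) r - asc gi (Suc j) r) \<in> front"
  using assms
proof (induction r arbitrary: j)
  case (Suc r)
  let ?x = "asc gs (Suc (Suc j)) r" and ?y = "asc gi (Suc (Suc j)) r"
  have "asc gs (Suc j) (Suc r) - asc gi (Suc j) (Suc r) = gs (Suc j) * (?x - ?y) + sc zz * ?y"
    by (simp add: asc_Suc' gi_def algebra_simps)
  then have "asc gs 1 j * (asc gs (Suc j) (Suc r) - asc gi (Suc j) (Suc r))
      = asc gs 1 (Suc j) * (?x - ?y) + sc zz * (asc gs 1 j * ?y)"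
    by (simp add: asc_Suc distrib_left sc_left_comm mult.assoc plus_1_eq_Suc)
  also have "asc gs 1 j * ?y = ?y * asc gs 1 j"
    by (intro asc_comm asc_comm[symmetric] gi_comm gs_far gi_comm[symmetric]) auto
  finally have e: "asc gs 1 j * (asc gs (Suc j) (Suc r) - asc gi (Suc j) (Suc r))
      = asc gs 1 (Suc j) * (?x - ?y) + sc zz * (?y * asc gs 1 j)" .
  have "?y * 1 * asc gs 1 j \<in> front"
  proof (rule front_right[OF _ _ front_left[OF _ _ front_1]])
    show "asc gs 1 j \<in> galg {1..<1 + j}" "?y \<in> galg {2..}" by (rule galg_asc; auto)+
  qed (use Suc.prems in auto)
  then show ?case unfolding e using Suc by (intro front_add front_sc) auto
qed (simp add: front_0)

text \<open>Modulo \<open>front\<close>, \<open>theta m\<close> is -1. A basis element with 1 in the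
  second block factors through \<open>asc gs 1 m\<close>, whose image \<open>- asc gi 1 m\<close> is
  congruent to \<open>- asc gs 1 m\<close>.\<close>

lemma theta_front: "theta m x + x \<in> front"
proof (rule hk_induct_supp[where P = "\<lambda>x. theta m x + x \<in> front"])
  fix w assume w0: "fperm w"
  have k0: "inv w 1 \<noteq> 0"
    using fperm_0[OF fperm_inv[OF w0]] fperm_inj[OF fperm_inv[OF w0], of 1 0] by auto
  show "theta m (bI w) + bI w \<in> front"
  proof (cases "inv w 1 \<le> m")
    case True
    then have "bI w \<in> front" by (simp add: front_def co_bI w0)
    then show ?thesis using True by (simp add: theta_bI[OF w0] tau_def front_add)
  next
    case False
    obtain n0 where "w \<in> perms n0" using w0 by (auto simp: fperm_def)
    then obtain n where w: "w \<in> perms n" and n: "1 \<le> n"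
      using perms_mono[of w n0 "max n0 1"] by (meson max.cobounded1 max.cobounded2)
    obtain b where b: "b \<in> perms n" "\<forall>i\<in>{1..1}. b i = i" "bI w = bI b * asc gs 1 (inv w 1 - 1)"
      by (rule bI_factor[OF w, of 1]) (use n in auto)
    define r where "r = inv w 1 - Suc m"
    have "inv w 1 - 1 = m + r" using False by (simp add: r_def)
    then have e: "bI w = bI b * (asc gs 1 m * asc gs (Suc m) r)"
      using b(3) by (simp add: asc_add plus_1_eq_Suc)
    have bg: "bI b \<in> galg {2..<n}"
      using bI_galg_fix[OF b(1,2)] by (simp add: numeral_2_eq_2 One_nat_def)
    have up: "asc gs (Suc m) r \<in> galg {Suc m..}" by (rule galg_asc) auto
    have "theta m (x * asc gs (Suc m) r) = theta m x * asc gs (Suc m) r" for x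
      by (rule theta_galg_right[OF up]) auto
    moreover have "theta m (bI b * x) = bI b * theta m x" for x
      by (rule theta_galg_left[OF bg]) auto
    ultimately have "theta m (bI w) = bI b * (theta m (asc gs 1 m) * asc gs (Suc m) r)"
      unfolding e by simp
    then have "theta m (bI w) + bI w = bI b * ((asc gs 1 m - asc gi 1 m) * asc gs (Suc m) r)"
      unfolding e by (simp add: theta_asc algebra_simps)
    also have "\<dots> \<in> front"
      using asc_diff_front[of 0 m]
      by (intro front_left[OF bg] front_right[OF up]) (auto simp: One_nat_def)
    finally show ?thesis .
  qed
next
  fix x y assume "theta m x + x \<in> front" "theta m y + y \<in> front"
  then have "(theta m x + x) + (theta m y + y) \<in> front" by (rule front_add)
  then show "theta m (x + y) + (x + y) \<in> front" by (simp add: hlinD[OF hlin_theta] add.assoc add.left_commute)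
next
  fix w assume "theta m (bI w) + bI w \<in> front"
  then have "sc (co x w) * (theta m (bI w) + bI w) \<in> front" by (rule front_sc)
  then show "theta m (sc (co x w) * bI w) + sc (co x w) * bI w \<in> front"
    by (simp add: hlinD[OF hlin_theta] distrib_left)
qed (simp add: hlin_0[OF hlin_theta] front_0)

lemma zeta_Hpart: "(asc gs 1 m + asc gi 1 m) * Hpart m m \<in> front"
  using theta_front[of "asc gs 1 m * Hpart m m"] by (simp add: theta_asc_Hpart distrib_right add.commute)

lemma Hpart_gs: assumes "i \<in> young_gens m" obtains j where "j \<in> young_gens m" "gs i * Hpart m m = Hpart m m * gs j" "gs j * Hpart m m = Hpart m m * gs i"
proof (cases "i < m")
  case True
  then show thesis using that[of "i + m"] Hpart_low[of i] Hpart_high[of i] assms by auto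
next
  case False
  then have i: "1 \<le> i - m" "i - m < m" "i = (i - m) + m" using assms by auto
  then show thesis using that[of "i - m"] Hpart_low[of "i - m"] Hpart_high[of "i - m"] by auto
qed

text \<open>One d works in both directions because the exchange of the two blocks is an
  involution.\<close>

lemma Hpart_swap: "c \<in> galg (young_gens m) \<Longrightarrow> \<exists>d\<in>galg (young_gens m). c * Hpart m m = Hpart m m * d \<and> d * Hpart m m = Hpart m m * c"
proof (induction rule: galg.induct)
  case (gen i)
  then obtain j where "j \<in> young_gens m" "gs i * Hpart m m = Hpart m m * gs j" "gs j * Hpart m m = Hpart m m * gs i"
    by (rule Hpart_gs)
  then show ?case by (intro bexI[of _ "gs j"] galg.gen conjI)
next
  case (scalar c)
  then show ?case by (intro bexI[of _ "sc c"] galg.scalar) (simp_all add: sc_central)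
next
  case (add x y)
  then obtain r s where "r \<in> galg (young_gens m)" "s \<in> galg (young_gens m)" "x * Hpart m m = Hpart m m * r" "y * Hpart m m = Hpart m m * s"
    "r * Hpart m m = Hpart m m * x" "s * Hpart m m = Hpart m m * y"
    by blast
  then show ?case
    by (intro bexI[of _ "r + s"]) (auto simp: distrib_left distrib_right intro: galg.add)
next
  case (mult x y)
  then obtain r s where rs: "r \<in> galg (young_gens m)" "s \<in> galg (young_gens m)" "x * Hpart m m = Hpart m m * r" "y * Hpart m m = Hpart m m * s"
    "r * Hpart m m = Hpart m m * x" "s * Hpart m m = Hpart m m * y"
    by blast
  then have "x * y * Hpart m m = Hpart m m * (r * s)" "r * s * Hpart m m = Hpart m m * (x * y)"
    by (metis mult.assoc)+
  then show ?case by (intro bexI[of _ "r * s"] galg.mult rs(1,2) conjI)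
qed

lemma Hpart_swap': "c \<in> galg (young_gens m) \<Longrightarrow> \<exists>d\<in>galg (young_gens m). Hpart m m * c = d * Hpart m m"
  using Hpart_swap by metis

text \<open>The outer strings use letters above 1 and keep \<open>front\<close> stable. The
  innermost one is the sum of \<open>asc gs 1 m\<close> and \<open>asc gi 1 m\<close>, handled by
  \<open>zeta_Hpart\<close>. The factor c collects the Jucys-Murphy elements met on the way.\<close>

lemma Hpart_front:
  assumes "1 \<le> k" "k \<le> m" "c \<in> galg {Suc m..<2 * m}"
  shows "Hpart m k * c * Hpart m m \<in> front"
  using assms
proof (induction k arbitrary: c)
  case (Suc k)
  have cY: "c \<in> galg (young_gens m)" using Suc.prems(3) by (rule galg_mono) (use m in auto)
  show ?case
  proof (cases "k = 0")
    case True
    obtain d where d: "d \<in> galg (young_gens m)" "c * Hpart m m = Hpart m m * d" using Hpart_swap[OF cY] by blast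
    have "Hpart m (Suc k) * c * Hpart m m = (asc gs 1 m + asc gi 1 m) * Hpart m m * d"
      using True d(2) by (simp add: jucys_def One_nat_def mult.assoc distrib_right)
    then show ?thesis using zeta_Hpart d(1) by (auto intro: front_right)
  next
    case False
    have "jucys m k \<in> galg {Suc m..<2 * m}"
      by (rule galg_mono[OF jucys_galg]) (use Suc.prems in auto)
    then have i: "Hpart m k * (jucys m k * c) * Hpart m m \<in> front" "Hpart m k * c * Hpart m m \<in> front"
      using Suc False by (auto intro: galg.mult)
    have a: "asc gs (Suc k) m \<in> galg {2..}" "asc gi (Suc k) m \<in> galg {2..}"
      by (rule galg_asc; use False in auto)+
    have "asc gs (Suc k) m * (Hpart m k * c * Hpart m m)
        + asc gi (Suc k) m * (Hpart m k * (jucys m k * c) * Hpart m m) \<in> front"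
      by (rule front_add[OF front_left[OF a(1) order_refl i(2)] front_left[OF a(2) order_refl i(1)]])
    then show ?thesis by (simp add: distrib_right mult.assoc)
  qed
qed simp

lemma Hpart_square_front: "Hpart m m * Hpart m m \<in> front"
  using Hpart_front[of m 1] m by simp

lemma Hpart_square_comm: "i \<in> young_gens m \<Longrightarrow> gs i * (Hpart m m * Hpart m m) = Hpart m m * Hpart m m * gs i"
  by (metis Hpart_gs mult.assoc)

text \<open>Suppose w has the value k+1 beyond position m. Compare the coefficients of
  \<open>sref k \<circ> w\<close> in g_k R^2 = R^2 g_k: by induction all of them vanish except that
  of w, which must therefore vanish as well.\<close>

lemma Hpart_square_low:
  assumes "k \<le> m" "co (Hpart m m * Hpart m m) w \<noteq> 0" "i \<in> {1..k}"
  shows "inv w i \<le> m"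
  using assms
proof (induction k arbitrary: w i)
  case (Suc k)
  let ?q = "Hpart m m * Hpart m m"
  show ?case
  proof (cases "i \<le> k")
    case True
    then show ?thesis using Suc by auto
  next
    case False
    then have i: "i = Suc k" using Suc.prems by auto
    show ?thesis
    proof (cases "k = 0")
      case True
      then show ?thesis using Hpart_square_front Suc.prems(2) i by (auto simp: front_def One_nat_def)
    next
      case False
      then have k: "1 \<le> k" "k \<in> young_gens m" "k \<noteq> m" using Suc.prems by auto
      have w: "fperm w" using Suc.prems(2) co_out by blast
      show ?thesis
      proof (rule ccontr)
        assume n: "\<not> inv w i \<le> m"
        define y where "y = sref k \<circ> w"
        have y: "fperm y" "sref k \<circ> y = w" "inv y k = inv w i"
          using k w i by (simp_all add: y_def fperm_comp fperm_sref inv_sref_comp del: comp_apply)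
            (simp add: inv_sref_comp)
        have "co ?q y = 0" using Suc.IH[of y k] Suc.prems(1) k n y(3) by auto
        moreover have "co (?q * gs k) y = 0"
        proof -
          have "inv (y \<circ> sref k) k = sref k (inv y k)" by (simp add: inv_comp_sref[OF y(1) k(1)])
          then have "\<not> inv (y \<circ> sref k) k \<le> m"
            using n y(3) k(3) by (auto simp: sref_def sw_def)
          then have "co ?q (y \<circ> sref k) = 0" using Suc.IH[OF _ _, of "y \<circ> sref k" k] Suc.prems(1) k
            by (auto simp del: comp_apply)
          then show ?thesis using \<open>co ?q y = 0\<close> by (simp add: co_mult_gs[OF y(1) k(1)])
        qed
        moreover have "co (gs k * ?q) y = co ?q w + (if inv y (Suc k) < inv y k then zz * co ?q y else 0)"
          using co_gs_mult[OF y(1) k(1), of ?q] y(2) by simp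
        ultimately have "co ?q w = 0" unfolding Hpart_square_comm[OF k(2)] by (simp split: if_splits)
        then show False using Suc.prems(2) by simp
      qed
    qed
  qed
qed simp

section \<open>The subalgebra of the Young subgroup\<close>

lemma youngI:
  assumes w: "w \<in> perms (2 * m)" and le: "\<And>i. i \<in> {1..m} \<Longrightarrow> inv w i \<le> m"
  shows "w \<in> young m"
proof -
  have f: "fperm w" using w by (rule perms_fperm)
  have "inv w i \<in> {1..m}" if "i \<in> {1..m}" for i
    using le[OF that] perms_in[OF inv_perms[OF w], of i] that by auto
  then have "inv w ` {1..m} \<subseteq> {1..m}" by blast
  moreover have "inj_on (inv w) {1..m}"
    using fperm_inj[OF fperm_inv[OF f]] by (auto simp: inj_on_def)
  ultimately have "inv w ` {1..m} = {1..m}" by (simp add: endo_inj_surj)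
  then have "w ` (inv w ` {1..m}) = w ` {1..m}" by simp
  moreover have "w ` (inv w ` {1..m}) = {1..m}"
    using fperm_f_inv[OF f] by (auto simp: image_image)
  ultimately show ?thesis using w by (simp add: young_def)
qed

lemma young_iff: "w \<in> young m \<Longrightarrow> w i \<in> {1..m} \<longleftrightarrow> i \<in> {1..m}"
  using inj_image_mem_iff[of w i "{1..m}"] bij_is_inj[OF fperm_bij[OF perms_fperm[of w "2 * m"]]]
  by (simp add: young_def)

lemma young_sref: 
  assumes "j \<in> young_gens m" "w \<in> young m"
  shows "sref j \<circ> w \<in> young m" "w \<circ> sref j \<in> young m"
proof -
  have j: "1 \<le> j" "j < 2 * m" "j \<noteq> m" using assms by auto
  have s: "sref j ` {1..m} = {1..m}"
  proof -
    have "sref j i \<in> {1..m}" if "i \<in> {1..m}" for i using that j by (auto simp: sref_def sw_def)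
    then show ?thesis
      by (intro endo_inj_surj) (auto intro!: inj_onI dest: arg_cong[where f = "sref j"])
  qed
  have "(sref j \<circ> w) ` {1..m} = sref j ` (w ` {1..m})" "(w \<circ> sref j) ` {1..m} = w ` (sref j ` {1..m})"
    by (auto simp: image_image)
  then show "sref j \<circ> w \<in> young m" "w \<circ> sref j \<in> young m"
    using assms s j by (auto simp: young_def perms_sref_comp perms_comp_sref simp del: comp_apply)
qed

lemma bI_young: assumes "w \<in> young m" shows "bI w \<in> galg (young_gens m)"
proof (rule bI_in_galg[where P = "\<lambda>w. w \<in> young m"])
  show "w \<in> perms (2 * m)" "w \<in> young m" using assms by (auto simp: young_def)
  fix w j
  assume w: "w \<in> perms (2 * m)" "w \<in> young m" and j: "1 \<le> j" "j < 2 * m" "inv w (Suc j) < inv w j"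
  have f: "fperm w" using w(1) by (rule perms_fperm)
  have "j \<noteq> m"
  proof
    assume jm: "j = m"
    have "inv w m \<in> {1..m}" using young_iff[OF w(2), of "inv w m"] m by (simp add: fperm_f_inv[OF f])
    moreover have "inv w (Suc m) \<notin> {1..m}"
      using young_iff[OF w(2), of "inv w (Suc m)"] by (simp add: fperm_f_inv[OF f])
    moreover have "inv w (Suc m) \<in> {1..2 * m}"
      using perms_in[OF inv_perms[OF w(1)], of "Suc m"] m by auto
    ultimately show False using j jm by auto
  qed
  then show "j \<in> young_gens m \<and> sref j \<circ> w \<in> young m" using j w young_sref by auto
qed

lemma galg_young: "r \<in> galg (young_gens m) \<Longrightarrow> (\<And>w. co x w \<noteq> 0 \<Longrightarrow> w \<in> young m) \<Longrightarrow> co (r * x) w \<noteq> 0 \<Longrightarrow> w \<in> young m"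
proof (induction arbitrary: x w rule: galg.induct)
  case (gen j)
  have f: "fperm w" using gen.prems(2) co_out by blast
  have j: "1 \<le> j" using gen by auto
  have "co x (sref j \<circ> w) \<noteq> 0 \<or> co x w \<noteq> 0"
    using gen.prems(2) by (auto simp: co_gs_mult[OF f j] split: if_splits)
  then have "sref j \<circ> w \<in> young m \<or> w \<in> young m" using gen.prems(1) by blast
  then show ?case using young_sref(1)[OF gen(1), of "sref j \<circ> w"] by auto
next
  case (add r s)
  have "co (r * x) w \<noteq> 0 \<or> co (s * x) w \<noteq> 0"
    using add.prems(2) by (auto simp: distrib_right)
  then show ?case using add.IH add.prems(1) by blast
next
  case (mult r s)
  have "co (s * x) u \<noteq> 0 \<Longrightarrow> u \<in> young m" for u by (rule mult.IH(2)[OF mult.prems(1)])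
  then show ?case using mult.prems(2) by (intro mult.IH(1)[of "s * x" w]) (auto simp: mult.assoc)
qed auto

lemma id_young: "id \<in> young m"
  by (simp add: young_def)

lemma galg_young_iff: "x \<in> galg (young_gens m) \<longleftrightarrow> lpoly_co x \<and> (\<forall>w. co x w \<noteq> 0 \<longrightarrow> w \<in> young m)"
proof
  assume x: "x \<in> galg (young_gens m)"
  have "co 1 w \<noteq> 0 \<Longrightarrow> w \<in> young m" for w
    using co_bI[of id w] id_young by (auto split: if_splits)
  then show "lpoly_co x \<and> (\<forall>w. co x w \<noteq> 0 \<longrightarrow> w \<in> young m)"
    using galg_young[OF x, of 1] lpoly_co_galg[OF x] by auto
next
  assume x: "lpoly_co x \<and> (\<forall>w. co x w \<noteq> 0 \<longrightarrow> w \<in> young m)"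
  show "x \<in> galg (young_gens m)"
    by (subst hk_expand) (use x in \<open>auto intro!: galg_sum galg.mult galg.scalar bI_young simp: lpoly_co_def\<close>)
qed

lemma Hpart_square: "Hpart m m * Hpart m m \<in> galg (young_gens m)"
  unfolding galg_young_iff
proof (intro conjI allI impI)
  have g: "Hpart m m * Hpart m m \<in> galg {1..<2 * m}"
    using Hpart_galg[of m m] by (auto intro: galg.mult simp: mult_2)
  show "lpoly_co (Hpart m m * Hpart m m)" by (rule lpoly_co_galg[OF g]) auto
  fix w assume w: "co (Hpart m m * Hpart m m) w \<noteq> 0"
  have "w \<in> perms (2 * m)" using supported_galg[OF g order_refl] w by (auto simp: supported_co)
  then show "w \<in> young m" using Hpart_square_low[OF order_refl w] by (intro youngI)
qed

end

section \<open>Commutation and inverses of the Jucys-Murphy elements\<close>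

lemma jucys_comm:
  assumes "1 \<le> i" "i < k"
  shows "gs (m + i) * jucys m k = jucys m k * gs (m + i)"
proof -
  have "jucys m k * gs (m + i) = desc gs (Suc m) k * gs (Suc (m + i)) * asc gs (Suc m) k"
    using asc_shift[of gs "Suc m" "m + i" k] assms by (simp add: jucys_def mult.assoc)
  also have "\<dots> = gs (m + i) * jucys m k"
    using desc_shift[of gs "Suc m" "m + i" k] assms by (simp add: jucys_def mult.assoc)
  finally show ?thesis by simp
qed

lemma jucys_comm_galg: "x \<in> galg {Suc m..<m + k} \<Longrightarrow> jucys m k * x = x * jucys m k"
proof (rule galg_comm)
  fix i assume i: "i \<in> {Suc m..<m + k}"
  then have "1 \<le> i - m" "i - m < k" "m + (i - m) = i" by auto
  then show "jucys m k * gs i = gs i * jucys m k" using jucys_comm[of "i - m" k m] by simp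
qed

definition jucys_inv :: "nat \<Rightarrow> nat \<Rightarrow> hk" where
  "jucys_inv m k = desc gi (Suc m) k * asc gi (Suc m) k"

lemma jucys_jucys_inv: "jucys m k * jucys_inv m k = 1" "jucys_inv m k * jucys m k = 1"
proof -
  have s: "1 \<le> Suc m" by simp
  have "jucys m k * jucys_inv m k = desc gs (Suc m) k * (asc gs (Suc m) k * desc gi (Suc m) k) * asc gi (Suc m) k"
    by (simp add: jucys_def jucys_inv_def mult.assoc)
  then show "jucys m k * jucys_inv m k = 1" by (simp add: asc_desc_gs[OF s])
  have "jucys_inv m k * jucys m k = desc gi (Suc m) k * (asc gi (Suc m) k * desc gs (Suc m) k) * asc gs (Suc m) k"
    by (simp add: jucys_def jucys_inv_def mult.assoc)
  then show "jucys_inv m k * jucys m k = 1" by (simp add: asc_desc_gs[OF s])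
qed

lemma inverse_comm:
  fixes a b x :: "'a::monoid_mult"
  assumes "a * b = 1" "b * a = 1" "a * x = x * a"
  shows "b * x = x * b"
  using assms by (metis mult.assoc mult_1 mult_1_right)

lemma jucys_inv_comm_galg: "x \<in> galg {Suc m..<m + k} \<Longrightarrow> jucys_inv m k * x = x * jucys_inv m k"
  by (rule inverse_comm[OF jucys_jucys_inv jucys_comm_galg])

lemma jucys_inv_galg: "jucys_inv m k \<in> galg {Suc m..m + k}"
  unfolding jucys_inv_def by (rule galg.mult; rule galg_asc) auto

primrec Gprod :: "nat \<Rightarrow> nat \<Rightarrow> hk" where
  "Gprod m 0 = 1"
| "Gprod m (Suc k) = Gprod m k * (1 + jucys m k)"

section \<open>Linear independence\<close>

text \<open>In twice the least degree occurring among the series, the sum of the squares has as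
  coefficient a sum of integer squares, not all zero.\<close>

lemma sum_squares_zero:
  fixes f :: "'a \<Rightarrow> int fls"
  assumes "finite A" "(\<Sum>a\<in>A. f a * f a) = 0" "a \<in> A"
  shows "f a = 0"
proof (rule ccontr)
  assume a: "f a \<noteq> 0"
  define S where "S = {a \<in> A. f a \<noteq> 0}"
  define d where "d = Min ((\<lambda>a. fls_subdegree (f a)) ` S)"
  have S: "finite S" "S \<noteq> {}" using assms a by (auto simp: S_def)
  have le: "d \<le> fls_subdegree (f b)" if "b \<in> S" for b
    unfolding d_def using S that by (intro Min_le) auto
  have "d \<in> (\<lambda>a. fls_subdegree (f a)) ` S"
    unfolding d_def using S by (intro Min_in) auto
  then obtain b where b: "b \<in> S" "fls_subdegree (f b) = d" by auto
  have nth: "fls_nth (f c * f c) (2 * d) = (fls_nth (f c) d)\<^sup>2" if "c \<in> A" for c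
  proof (cases "c \<in> S \<and> fls_subdegree (f c) = d")
    case True
    then show ?thesis by (simp add: fls_times_nth(2) power2_eq_square)
  next
    case False
    show ?thesis
    proof (cases "f c = 0")
      case nz: False
      then have "d < fls_subdegree (f c)" using le[of c] False that by (auto simp: S_def)
      then show ?thesis by (simp add: fls_times_nth_eq0)
    qed simp
  qed
  have "0 = fls_nth (\<Sum>a\<in>A. f a * f a) (2 * d)" using assms(2) by simp
  also have "\<dots> = (\<Sum>a\<in>A. (fls_nth (f a) d)\<^sup>2)"
    unfolding fls_nth_sum by (rule sum.cong) (simp_all add: nth)
  finally have "(\<Sum>a\<in>A. (fls_nth (f a) d)\<^sup>2) = 0" by simp
  then have "(fls_nth (f b) d)\<^sup>2 = 0"
    using b(1) assms(1) by (subst (asm) sum_nonneg_eq_0_iff) (auto simp: S_def)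
  then show False using b by (auto simp: S_def)
qed

definition form :: "nat \<Rightarrow> hk \<Rightarrow> hk \<Rightarrow> lpoly" where
  "form n x y = (\<Sum>w\<in>perms n. co x w * co y w)"

text \<open>Each generator is self-adjoint because its matrix in the orthonormal basis is symmetric;
  reversed words are then adjoint to each other.\<close>

lemma form_gs:
  assumes "1 \<le> i" "i < n"
  shows "form n (gs i * x) y = form n x (gs i * y)"
proof -
  have r: "(\<Sum>w\<in>perms n. co x (sref i \<circ> w) * co y w) = (\<Sum>w\<in>perms n. co x w * co y (sref i \<circ> w))"
    by (rule sum.reindex_bij_witness[where i = "\<lambda>w. sref i \<circ> w" and j = "\<lambda>w. sref i \<circ> w"])
      (use assms in \<open>auto simp: perms_sref_comp simp del: comp_apply\<close>)
  have "form n (gs i * x) y = (\<Sum>w\<in>perms n. co x (sref i \<circ> w) * co y w)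
      + (\<Sum>w\<in>perms n. (if inv w (Suc i) < inv w i then zz * co x w * co y w else 0))"
    unfolding form_def sum.distrib[symmetric]
    by (rule sum.cong) (auto simp: co_gs_mult perms_fperm assms distrib_right)
  also have "\<dots> = form n x (gs i * y)"
    unfolding r form_def sum.distrib[symmetric]
    by (rule sum.cong) (auto simp: co_gs_mult perms_fperm assms distrib_left)
  finally show ?thesis .
qed

lemma form_desc:
  assumes "1 \<le> a" "a + k \<le> n"
  shows "form n (desc gs a k * x) y = form n x (asc gs a k * y)"
  using assms(2)
proof (induction k arbitrary: y)
  case (Suc k)
  then show ?case
    using assms(1) by (simp add: asc_Suc desc_Suc mult.assoc form_gs)
qed simp

lemma one_plus_jucys_injective:
  assumes "(1 + jucys m k) * x = 0"
  shows "x = 0"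
proof -
  obtain n0 where "supported n0 x" using supported_ex by blast
  then obtain n where n: "supported n x" "Suc m + k \<le> n"
    using supported_mono[of n0 x "max n0 (Suc m + k)"] by (meson max.cobounded1 max.cobounded2)
  let ?y = "asc gs (Suc m) k * x"
  have "form n ((1 + jucys m k) * x) x = form n x x + form n ?y ?y"
    using form_desc[of "Suc m" k n ?y x] n(2)
    by (simp add: jucys_def distrib_right mult.assoc form_def sum.distrib)
  then have "form n x x + form n ?y ?y = 0" by (simp add: assms form_def)
  \<comment> \<open>The Boolean merges the two forms into a single sum of squares.\<close>
  then have "(\<Sum>(w, b)\<in>perms n \<times> UNIV. (if b then co x w else co ?y w) * (if b then co x w else co ?y w)) = 0"
    by (simp add: form_def sum.cartesian_product[symmetric] UNIV_bool sum.distrib add.commute)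
  then have "(\<Sum>p\<in>perms n \<times> UNIV. (\<lambda>(w, b). if b then co x w else co ?y w) p * (\<lambda>(w, b). if b then co x w else co ?y w) p) = 0"
    by (simp add: case_prod_unfold)
  from sum_squares_zero[OF _ this, of "(_, True)"]
  have "co x w = 0" if "w \<in> perms n" for w using that by simp
  then show ?thesis using n(1) by (intro hk_eqI) (auto simp: supported_co)
qed

lemma Gprod_injective: "Gprod m k * x = 0 \<Longrightarrow> x = 0"
proof (induction k arbitrary: x)
  case (Suc k)
  then have "Gprod m k * ((1 + jucys m k) * x) = 0" by (simp add: mult.assoc)
  then show ?case using Suc.IH one_plus_jucys_injective by blast
qed simp

section \<open>The leading term with respect to length\<close>

definition short :: "nat \<Rightarrow> hk set" where
  "short r = {x. \<forall>w. co x w \<noteq> 0 \<longrightarrow> ell w < r}"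

lemma short_mono: "x \<in> short r \<Longrightarrow> r \<le> s \<Longrightarrow> x \<in> short s"
  by (fastforce simp: short_def)

lemma short_add: "x \<in> short r \<Longrightarrow> y \<in> short r \<Longrightarrow> x + y \<in> short r"
  by (auto simp: short_def) (metis add.left_neutral)

lemma short_sc: "x \<in> short r \<Longrightarrow> sc c * x \<in> short r"
  by (auto simp: short_def)

lemma short_gs: assumes i: "1 \<le> i" and x: "x \<in> short r" shows "gs i * x \<in> short (Suc r)"
proof -
  have "ell w < Suc r" if c: "co (gs i * x) w \<noteq> 0" for w
  proof -
    have f: "fperm w" using c co_out by blast
    have "inv w i \<noteq> inv w (Suc i)" by (simp add: fperm_inj fperm_inv f)
    then have "ell w \<le> Suc (ell (sref i \<circ> w))"
      using ell_left_up[OF f, of i] ell_left_down[OF f i] by (cases "inv w i < inv w (Suc i)") auto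
    moreover have "co x (sref i \<circ> w) \<noteq> 0 \<or> co x w \<noteq> 0"
      using c by (auto simp: co_gs_mult[OF f i] split: if_splits)
    ultimately show ?thesis using x by (auto simp: short_def)
  qed
  then show ?thesis by (simp add: short_def)
qed

lemma short_gi: assumes "1 \<le> i" "x \<in> short r" shows "gi i * x \<in> short (Suc r)"
proof -
  have "gs i * x + sc (- zz) * x \<in> short (Suc r)"
    using assms by (intro short_add short_gs short_sc) (auto intro: short_mono)
  then show ?thesis by (simp add: gi_def left_diff_distrib sc_uminus)
qed

lemma short_asc: "1 \<le> a \<Longrightarrow> f = gs \<or> f = gi \<Longrightarrow> x \<in> short r \<Longrightarrow> asc f a k * x \<in> short (r + k)"
proof (induction k arbitrary: x r)
  case (Suc k)
  have "f (a + k) * x \<in> short (Suc r)" using Suc.prems by (auto intro: short_gs short_gi)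
  then have "asc f a k * (f (a + k) * x) \<in> short (Suc r + k)" using Suc by blast
  then show ?case by (simp add: asc_Suc mult.assoc)
qed simp

text \<open>\<open>gi\<close> and \<open>gs\<close> differ by a scalar, so the longest terms cancel
  and the bound is one better than \<open>short_asc\<close> gives for each word.\<close>

lemma short_asc_diff: "1 \<le> a \<Longrightarrow> x \<in> short (Suc r) \<Longrightarrow> asc gi a k * x - asc gs a k * x \<in> short (r + k)"
proof (induction k arbitrary: x r)
  case (Suc k)
  have e: "asc gi a (Suc k) * x - asc gs a (Suc k) * x
      = (asc gi a k * (gs (a + k) * x) - asc gs a k * (gs (a + k) * x)) + sc (- zz) * (asc gi a k * x)"
    by (simp add: asc_Suc gi_def mult.assoc left_diff_distrib right_diff_distrib sc_left_comm sc_uminus)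
  have "gs (a + k) * x \<in> short (Suc (Suc r))" using Suc.prems by (intro short_gs) auto
  then have 1: "asc gi a k * (gs (a + k) * x) - asc gs a k * (gs (a + k) * x) \<in> short (Suc r + k)"
    using Suc by blast
  have 2: "asc gi a k * x \<in> short (Suc r + k)" using Suc.prems by (intro short_asc) auto
  show ?case unfolding e using short_add[OF 1 short_sc[OF 2]] by simp
qed (simp add: short_def)

lemma tpart_short: "tpart m k \<in> short (Suc (m * k))"
proof (induction k)
  case 0
  have "co 1 w \<noteq> 0 \<Longrightarrow> ell w = 0" for w using co_bI[of id w] by (auto split: if_splits)
  then show ?case by (auto simp: short_def)
next
  case (Suc k)
  have "asc gs (Suc k) m * tpart m k \<in> short (Suc (m * k) + m)"
    by (rule short_asc) (use Suc in auto)
  then show ?case by (simp add: add.commute)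
qed

text \<open>Filtering by length alone would not do, since the factors \<open>C\<^sub>\<epsilon>\<close> contribute length as well.\<close>
inductive_set lower :: "nat \<Rightarrow> nat \<Rightarrow> hk set" for m r where
  gen: "f \<in> short r \<Longrightarrow> c \<in> galg {Suc m..} \<Longrightarrow> f * c \<in> lower m r"
| add: "x \<in> lower m r \<Longrightarrow> y \<in> lower m r \<Longrightarrow> x + y \<in> lower m r"

lemma lower_right: "x \<in> lower m r \<Longrightarrow> c \<in> galg {Suc m..} \<Longrightarrow> x * c \<in> lower m r"
proof (induction rule: lower.induct)
  case (gen f d)
  then show ?case unfolding mult.assoc by (intro lower.gen galg.mult)
next
  case (add x y)
  then show ?case unfolding distrib_right by (intro lower.add)
qed

lemma lower_left: "x \<in> lower m r \<Longrightarrow> 1 \<le> a \<Longrightarrow> f = gs \<or> f = gi \<Longrightarrow> asc f a k * x \<in> lower m (r + k)"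
proof (induction rule: lower.induct)
  case (gen h d)
  then show ?case unfolding mult.assoc[symmetric] by (intro lower.gen short_asc)
next
  case (add x y)
  then show ?case unfolding distrib_left by (intro lower.add)
qed

lemma Gprod_galg: "Gprod m k \<in> galg {Suc m..<m + k}"
proof (induction k)
  case (Suc k)
  have "Gprod m k \<in> galg {Suc m..<m + Suc k}" using Suc by (rule galg_mono) auto
  moreover have "jucys m k \<in> galg {Suc m..<m + Suc k}" by (rule galg_mono[OF jucys_galg]) auto
  ultimately show ?case unfolding Gprod.simps by (intro galg.mult galg.add galg_1)
qed simp

lemma Hpart_leading: "Hpart m k - tpart m k * Gprod m k \<in> lower m (m * k)"
proof (induction k)
  case 0
  have "0 * 1 \<in> lower m 0" by (rule lower.gen) (auto simp: short_def)
  then show ?case by simp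
next
  case (Suc k)
  define N where "N = Hpart m k - tpart m k * Gprod m k"
  let ?p = "asc gs (Suc k) m" and ?q = "asc gi (Suc k) m" and ?c = "jucys m k"
  have N: "N \<in> lower m (m * k)" using Suc by (simp add: N_def)
  have R: "Hpart m k = tpart m k * Gprod m k + N" by (simp add: N_def)
  have c: "?c \<in> galg {Suc m..}" by (rule galg_mono[OF jucys_galg]) auto
  have g: "Gprod m k * ?c \<in> galg {Suc m..}"
    by (rule galg.mult[OF galg_mono[OF Gprod_galg] c]) auto
  \<comment> \<open>Substituting the induction hypothesis: were the inverse string equal to the
    direct one, the leading parts would combine to 1 + c times the old product. The first summand is
    the error of this replacement, and the second carries the old error along.\<close>
  have e: "Hpart m (Suc k) - tpart m (Suc k) * Gprod m (Suc k)
      = (?q * tpart m k - ?p * tpart m k) * (Gprod m k * ?c) + (?p * N + ?q * (N * ?c))"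
    unfolding Hpart.simps tpart.simps Gprod.simps R by (simp add: algebra_simps)
  have "?q * tpart m k - ?p * tpart m k \<in> short (m * k + m)"
    using tpart_short by (intro short_asc_diff) auto
  then have "(?q * tpart m k - ?p * tpart m k) * (Gprod m k * ?c) \<in> lower m (m * k + m)"
    using g by (rule lower.gen)
  moreover have "?p * N \<in> lower m (m * k + m)" "?q * (N * ?c) \<in> lower m (m * k + m)"
    by (rule lower_left[OF N] lower_left[OF lower_right[OF N c]]; simp add: One_nat_def)+
  ultimately show ?case unfolding e by (simp add: lower.add add.commute)
qed

text \<open>Within the symmetric group on 2m letters this is the coset of t_1 modulo the Young
  subgroup.\<close>

definition swaps :: "nat \<Rightarrow> (nat \<Rightarrow> nat) \<Rightarrow> bool" where
  "swaps m w \<longleftrightarrow> (\<forall>i\<in>{1..m}. m < w i)"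

lemma swaps_sref: "1 \<le> j \<Longrightarrow> j \<noteq> m \<Longrightarrow> swaps m (w \<circ> sref j) \<longleftrightarrow> swaps m w"
proof -
  assume j: "1 \<le> j" "j \<noteq> m"
  have "sref j i \<in> {1..m} \<longleftrightarrow> i \<in> {1..m}" for i using j by (auto simp: sref_def sw_def)
  then show ?thesis unfolding swaps_def comp_apply by (metis sref_sref)
qed

text \<open>Every position of the first block forms an inversion with the position of every value up
  to m. Hence t_1 has minimal length in its coset, and shorter elements lie outside.\<close>

lemma swaps_ell:
  assumes w: "fperm w" and s: "swaps m w"
  shows "m * m \<le> ell w"
proof -
  have iv: "inv w j \<notin> {1..m}" "1 \<le> inv w j" if "j \<in> {1..m}" for j
  proof -
    show "inv w j \<notin> {1..m}"
      using s that fperm_f_inv[OF w, of j] by (force simp: swaps_def)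
    have "inv w j \<noteq> inv w 0" using that fperm_inj[OF fperm_inv[OF w], of j 0] by auto
    then show "1 \<le> inv w j" using fperm_0[OF fperm_inv[OF w]] by (simp add: One_nat_def)
  qed
  have "{1..m} \<times> inv w ` {1..m} \<subseteq> Inv w"
  proof
    fix p assume "p \<in> {1..m} \<times> inv w ` {1..m}"
    then obtain i j where p: "p = (i, inv w j)" "i \<in> {1..m}" "j \<in> {1..m}" by auto
    have "i < inv w j" using iv[OF p(3)] p(2) by auto
    moreover have "w (inv w j) < w i" using s p fperm_f_inv[OF w, of j] by (force simp: swaps_def)
    ultimately show "p \<in> Inv w" by (simp add: p Inv_def)
  qed
  then have "card ({1..m} \<times> inv w ` {1..m}) \<le> ell w"
    unfolding ell_def by (rule card_mono[OF finite_Inv[OF w]])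
  moreover have "inj_on (inv w) {1..m}"
    using fperm_inj[OF fperm_inv[OF w]] by (auto simp: inj_on_def)
  ultimately show ?thesis by (simp add: card_cartesian_product card_image)
qed

lemma coset_right:
  assumes P: "\<And>w j. 1 \<le> j \<Longrightarrow> j \<noteq> m \<Longrightarrow> P (w \<circ> sref j) \<longleftrightarrow> P w"
    and c: "c \<in> galg A" "A \<subseteq> {1..} - {m}"
    and x: "\<And>w. co x w \<noteq> 0 \<Longrightarrow> P w"
  shows "co (x * c) w \<noteq> 0 \<Longrightarrow> P w"
  using c x
proof (induction arbitrary: x w rule: galg.induct)
  case (gen j)
  have f: "fperm w" using gen.prems(1) co_out by blast
  have j: "1 \<le> j" "j \<noteq> m" using gen by auto
  have "co x (w \<circ> sref j) \<noteq> 0 \<or> co x w \<noteq> 0"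
    using gen.prems(1) by (auto simp: co_mult_gs[OF f j(1)] split: if_splits)
  then have "P (w \<circ> sref j) \<or> P w" using gen.prems(3) by blast
  then show ?case using P[OF j] by blast
next
  case (scalar c)
  then show ?case by (simp add: sc_central)
next
  case (add r s)
  have "co (x * r) w \<noteq> 0 \<or> co (x * s) w \<noteq> 0" using add.prems(1) by (auto simp: distrib_left)
  then show ?case using add.IH add.prems(2,3) by blast
next
  case (mult r s)
  have "co (x * r) u \<noteq> 0 \<Longrightarrow> P u" for u using mult.IH(1) mult.prems(2,3) by blast
  then show ?case using mult.IH(2)[of "x * r" w] mult.prems(1,2) by (simp add: mult.assoc)
qed

lemma asc_mult_bI:
  assumes "fperm w" "1 \<le> a" "\<And>j. a \<le> j \<Longrightarrow> j < a + k \<Longrightarrow> inv w j < inv w (a + k)"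
  shows "asc gs a k * bI w = bI (cyc a k \<circ> w)"
  using assms
proof (induction k arbitrary: w)
  case (Suc k)
  have ak: "1 \<le> a + k" using Suc.prems by simp
  define s where "s = sref (a + k) \<circ> w"
  have s: "fperm s" unfolding s_def using Suc.prems ak by (intro fperm_comp fperm_sref)
  have iv: "inv s = inv w \<circ> sref (a + k)" unfolding s_def using Suc.prems ak by (intro inv_sref_comp)
  have "gs (a + k) * bI w = bI s"
    unfolding s_def using Suc.prems ak by (intro bI_left_up[symmetric]) auto
  then have "asc gs a (Suc k) * bI w = asc gs a k * bI s" by (simp add: asc_Suc mult.assoc)
  also have "\<dots> = bI (cyc a k \<circ> s)"
  proof (rule Suc.IH[OF s])
    fix j assume "a \<le> j" "j < a + k"
    then show "inv s j < inv s (a + k)" using Suc.prems(3)[of j] by (simp add: iv) (simp add: sref_def sw_def)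
  qed (use Suc.prems in auto)
  also have "cyc a k \<circ> s = cyc a (Suc k) \<circ> w" by (simp add: s_def cyc_Suc comp_assoc del: comp_apply)
  finally show ?case .
qed (simp del: id_apply)

definition tk :: "nat \<Rightarrow> nat \<Rightarrow> nat \<Rightarrow> nat" where
  "tk m k j = (if 1 \<le> j \<and> j \<le> m then j + k else if m < j \<and> j \<le> m + k then j - m else j)"

lemma tpart_bI: "tk m k \<in> perms (m + k) \<and> tpart m k = bI (tk m k)"
proof (induction k)
  case 0
  have "tk m 0 = id" by (auto simp: tk_def)
  then show ?case by (simp del: id_apply)
next
  case (Suc k)
  have f: "fperm (tk m k)" using Suc perms_fperm by blast
  have e: "cyc (Suc k) m \<circ> tk m k = tk m (Suc k)"
    by (rule ext) (auto simp: tk_def cyc_def One_nat_def)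
  have iv: "inv (tk m k) j = (if j = Suc k + m then j else j - k)" if "Suc k \<le> j" "j \<le> Suc k + m" for j
  proof -
    have "tk m k (if j = Suc k + m then j else j - k) = j" using that by (auto simp: tk_def One_nat_def)
    then show ?thesis using fperm_inv_f[OF f] by metis
  qed
  have "asc gs (Suc k) m * bI (tk m k) = bI (cyc (Suc k) m \<circ> tk m k)"
    by (rule asc_mult_bI[OF f]) (auto simp: iv)
  moreover have "tk m (Suc k) \<in> perms (m + Suc k)"
    unfolding e[symmetric] using Suc perms_mono[of "tk m k" "m + k" "m + Suc k"]
    by (intro comp_perms cyc_perms) auto
  ultimately show ?case using Suc e by simp
qed

lemma t1_tk: "t1 m = tk m m"
  by (rule ext) (auto simp: t1_def tk_def)

lemma tpart_cancel: assumes "tpart m k * x = 0" shows "x = 0"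
  using assms
proof (induction k)
  case (Suc k)
  have "desc gi (Suc k) m * (asc gs (Suc k) m * (tpart m k * x)) = 0"
    using Suc.prems by (simp add: mult.assoc)
  then show ?case using Suc.IH asc_desc_gs(4)[of "Suc k" m] by (simp add: mult.assoc[symmetric])
qed simp

text \<open>Restrict to the coset \<open>swaps\<close>: neither a nor the lower terms meet it, so
  the leading part of R times b vanishes alone. Then \<open>tpart\<close> cancels because it is
  invertible, and \<open>Gprod\<close> because it is injective.\<close>

lemma Hpart_independent:
  assumes m: "1 \<le> m" and ab: "a + Hpart m m * b = 0"
    and a: "a \<in> galg ({1..<2 * m} - {m})" and b: "b \<in> galg ({1..<2 * m} - {m})"
  shows "a = 0" "b = 0"
proof -
  let ?Y = "{1..<2 * m} - {m}"
  have Y: "?Y \<subseteq> {1..} - {m}" by auto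
  define N where "N = Hpart m m - tpart m m * Gprod m m"
  have nJ: "co x w \<noteq> 0 \<Longrightarrow> \<not> swaps m w" if "x \<in> lower m (m * m)" for x w
    using that
  proof (induction arbitrary: w rule: lower.induct)
    case (gen f c)
    show ?case
    proof (rule coset_right[where m = m and P = "\<lambda>w. \<not> swaps m w", OF _ gen(2) _ _ gen(3)])
      fix u assume "co f u \<noteq> 0"
      then show "\<not> swaps m u" using gen(1) swaps_ell[of u m] co_out[of u f] by (force simp: short_def)
    qed (auto simp: swaps_sref)
  next
    case (add x y)
    then show ?case by (metis add.left_neutral co_add)
  qed
  have NJ: "N \<in> lower m (m * m)" unfolding N_def by (rule Hpart_leading)
  have Nb: "co (N * b) w \<noteq> 0 \<Longrightarrow> \<not> swaps m w" for w
    by (rule coset_right[where m = m and P = "\<lambda>w. \<not> swaps m w", OF _ b Y])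
      (use nJ[OF NJ] in \<open>auto simp: swaps_sref\<close>)
  have na: "co a w \<noteq> 0 \<Longrightarrow> \<not> swaps m w" for w
  proof -
    assume "co a w \<noteq> 0"
    then have "w \<in> young m" using a by (simp add: galg_young_iff[OF m])
    then have "w 1 \<in> {1..m}" using young_iff[OF m, of w 1] m by simp
    then have "\<not> m < w 1" "1 \<in> {1..m}" using m by auto
    then show ?thesis unfolding swaps_def by blast
  qed
  let ?g = "Gprod m m * b"
  have gY: "?g \<in> galg ?Y"
    by (rule galg.mult[OF galg_mono[OF Gprod_galg] b]) auto
  have sA: "co (tpart m m * ?g) w \<noteq> 0 \<Longrightarrow> swaps m w" for w
  proof (rule coset_right[where m = m and P = "swaps m", OF _ gY Y])
    fix u assume "co (tpart m m) u \<noteq> 0"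
    then have "u = tk m m" using tpart_bI[of m m] perms_fperm by (auto simp: co_bI split: if_splits)
    then show "swaps m u" by (auto simp: swaps_def tk_def)
  qed (auto simp: swaps_sref)
  have "tpart m m * ?g + (a + N * b) = 0" using ab by (simp add: N_def algebra_simps)
  then have s0: "co (tpart m m * ?g) w + (co a w + co (N * b) w) = 0" for w
    by (metis co_0 co_add)
  have "tpart m m * ?g = 0"
  proof (rule hk_eqI)
    fix w
    show "co (tpart m m * ?g) w = co 0 w"
    proof (cases "swaps m w")
      case True
      then have "co a w = 0" "co (N * b) w = 0" using na Nb by blast+
      then show ?thesis using s0[of w] by simp
    next
      case False
      then show ?thesis using sA[of w] by auto
    qed
  qed
  then show "b = 0" using tpart_cancel Gprod_injective by blast
  then show "a = 0" using ab by simp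
qed

section \<open>The bar involution\<close>

lemma lpoly_expand:
  assumes "is_lpoly f"
  shows "f = (\<Sum>k | fls_nth f k \<noteq> 0. fls_const (fls_nth f k) * fls_X_intpow k)"
proof (rule fls_eqI)
  fix n
  have "fls_nth (\<Sum>k | fls_nth f k \<noteq> 0. fls_const (fls_nth f k) * fls_X_intpow k) n
      = (\<Sum>k | fls_nth f k \<noteq> 0. if k = n then fls_nth f n else 0)"
    unfolding fls_nth_sum by (rule sum.cong) (auto simp: fls_X_intpow_times_conv_shift)
  then show "fls_nth f n = fls_nth (\<Sum>k | fls_nth f k \<noteq> 0. fls_const (fls_nth f k) * fls_X_intpow k) n"
    using assms by (simp add: is_lpoly_def)
qed

lemma is_lpoly_monom: "is_lpoly (fls_const c * fls_X_intpow k)"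
  unfolding is_lpoly_def
  by (rule finite_subset[of _ "{k}"]) (auto simp: fls_X_intpow_times_conv_shift)

text \<open>A monomial merely shifts and rescales coefficients, which is compatible with their
  reflection; general multiplicativity follows by additivity.\<close>

lemma lbar_monom_mult:
  assumes g: "is_lpoly g"
  shows "lbar (fls_const c * fls_X_intpow k * g) = lbar (fls_const c * fls_X_intpow k) * lbar g"
proof -
  have e: "fls_const c * fls_shift j 1 * h = fls_const c * fls_shift j h" for j h
    using fls_X_intpow_times_conv_shift(1)[of "- j" h] by (simp only: mult.assoc minus_minus)
  have m: "lbar (fls_const c * fls_X_intpow k) = fls_const c * fls_X_intpow (- k)"
    by (rule fls_eqI, subst nth_lbar[OF is_lpoly_monom]) (auto simp: fls_X_intpow_times_conv_shift)
  have l: "is_lpoly (fls_const c * fls_X_intpow k * g)"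
    by (rule is_lpoly_mult[OF is_lpoly_monom g])
  show ?thesis
    by (rule fls_eqI) (use nth_lbar[OF l] nth_lbar[OF g] in \<open>simp add: m e\<close>)
qed

lemma lbar_sum: "(\<And>x. x \<in> A \<Longrightarrow> is_lpoly (f x)) \<Longrightarrow> lbar (sum f A) = (\<Sum>x\<in>A. lbar (f x))"
  by (induction A rule: infinite_finite_induct) (auto simp: lbar_add is_lpoly_sum)

lemma lbar_mult:
  assumes f: "is_lpoly f" and g: "is_lpoly g"
  shows "lbar (f * g) = lbar f * lbar g"
proof -
  let ?S = "{k. fls_nth f k \<noteq> 0}" and ?t = "\<lambda>k. fls_const (fls_nth f k) * fls_X_intpow k"
  have "lbar (f * g) = lbar (\<Sum>k\<in>?S. ?t k * g)"
    unfolding sum_distrib_right[symmetric] lpoly_expand[OF f, symmetric] ..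
  also have "\<dots> = (\<Sum>k\<in>?S. lbar (?t k) * lbar g)"
    by (subst lbar_sum) (simp_all only: is_lpoly_mult[OF is_lpoly_monom g] lbar_monom_mult[OF g])
  also have "\<dots> = lbar (\<Sum>k\<in>?S. ?t k) * lbar g"
    by (subst lbar_sum) (simp_all only: is_lpoly_monom sum_distrib_right)
  finally show ?thesis unfolding lpoly_expand[OF f, symmetric] .
qed

definition barI :: "(nat \<Rightarrow> nat) \<Rightarrow> hk" where
  "barI w = (THE y. bI (inv w) * y = 1 \<and> y * bI (inv w) = 1)"

text \<open>The counterpart of \<open>hbar\<close> on \<open>hk\<close>. Since \<open>lbar\<close>
  is a finite sum only for Laurent polynomials, its algebraic rules are stated under
  \<open>lpoly_co\<close>.\<close>

definition bar :: "hk \<Rightarrow> hk" where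
  "bar x = (\<Sum>w | co x w \<noteq> 0. sc (lbar (co x w)) * barI w)"

lemma barI_eqI:
  assumes "bI (inv w) * y = 1" "y * bI (inv w) = 1"
  shows "barI w = y"
  unfolding barI_def
proof (rule the_equality)
  fix z assume "bI (inv w) * z = 1 \<and> z * bI (inv w) = 1"
  then show "z = y" using assms by (metis mult.assoc mult_1 mult_1_right)
qed (use assms in simp)

lemma barI_id [simp]: "barI id = 1"
  by (rule barI_eqI) (simp_all del: id_apply)

lemma barI_inverse:
  assumes "w \<in> perms n"
  shows "bI (inv w) * barI w = 1 \<and> barI w * bI (inv w) = 1 \<and> barI w \<in> galg {1..<n}"
    (is "?P w")
proof -
  have "\<exists>y\<in>galg {1..<n}. bI (inv w) * y = 1 \<and> y * bI (inv w) = 1"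
    using assms
  proof (induction rule: perms_left_induct)
    case id
    show ?case by (intro bexI[of _ 1]) (simp_all del: id_apply)
  next
    case (step w j)
    then obtain y where y: "y \<in> galg {1..<n}" "bI (inv w) * y = 1" "y * bI (inv w) = 1" by blast
    have f: "fperm w" using step(1) by (rule perms_fperm)
    have e: "bI (inv (sref j \<circ> w)) = bI (inv w) * gs j"
      unfolding inv_sref_comp[OF f step(2)] using step f by (intro bI_right_up fperm_inv)
    have g: "gi j * y \<in> galg {1..<n}" using step y by (intro galg.mult galg_gi) auto
    have "bI (inv w) * gs j * (gi j * y) = 1" "gi j * y * (bI (inv w) * gs j) = 1"
      using y step(2) by (simp_all add: mult.assoc gs_gi) (metis gs_gi(2) mult.assoc mult_1 y(3))
    then show ?case unfolding e using g by blast
  qed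
  then obtain y where "y \<in> galg {1..<n}" "bI (inv w) * y = 1" "y * bI (inv w) = 1" by blast
  then show ?thesis using barI_eqI by simp
qed

lemma barI_up:
  assumes w: "fperm w" and i: "1 \<le> i" and up: "inv w i < inv w (Suc i)"
  shows "barI (sref i \<circ> w) = gi i * barI w"
proof (rule barI_eqI)
  obtain n where "w \<in> perms n" using w by (auto simp: fperm_def)
  note b = barI_inverse[OF this]
  have e: "bI (inv (sref i \<circ> w)) = bI (inv w) * gs i"
    unfolding inv_sref_comp[OF w i] using up i by (intro bI_right_up fperm_inv w)
  show "bI (inv (sref i \<circ> w)) * (gi i * barI w) = 1"
    using b i by (simp add: e mult.assoc)
  have "gi i * barI w * bI (inv (sref i \<circ> w)) = gi i * (barI w * bI (inv w)) * gs i"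
    by (simp add: e mult.assoc)
  then show "gi i * barI w * bI (inv (sref i \<circ> w)) = 1" using b i by (simp add: gs_gi)
qed

text \<open>The rule \<open>gs_mult_bI\<close> with \<open>zz\<close> negated, that is, replaced by
  its bar image; this is why \<open>bar\<close> turns multiplication by \<open>gs i\<close> into
  multiplication by \<open>gi i\<close>.\<close>

lemma gi_barI:
  assumes w: "fperm w" and i: "1 \<le> i"
  shows "gi i * barI w = barI (sref i \<circ> w) - (if inv w (Suc i) < inv w i then sc zz * barI w else 0)"
proof (cases "inv w i < inv w (Suc i)")
  case True
  then show ?thesis by (simp add: barI_up[OF w i])
next
  case False
  then have d: "inv w (Suc i) < inv w i"
    using fperm_inj[OF fperm_inv[OF w], of i "Suc i"] by simp
  let ?s = "sref i \<circ> w"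
  have s: "fperm ?s" using w i by (intro fperm_comp fperm_sref)
  have "barI (sref i \<circ> ?s) = gi i * barI ?s"
    using d by (intro barI_up s i) (simp add: inv_sref_comp[OF w i])
  then have e: "barI w = gi i * barI ?s" by simp
  then have "barI ?s = gs i * barI w" using i by simp
  then show ?thesis using d by (simp add: gi_def left_diff_distrib)
qed

lemma bar_on:
  assumes "finite A" "{w. co x w \<noteq> 0} \<subseteq> A"
  shows "bar x = (\<Sum>w\<in>A. sc (lbar (co x w)) * barI w)"
  unfolding bar_def by (rule sum.mono_neutral_left) (use assms in auto)

lemma bar_add: assumes "lpoly_co x" "lpoly_co y" shows "bar (x + y) = bar x + bar y"
proof -
  let ?A = "{w. co x w \<noteq> 0} \<union> {w. co y w \<noteq> 0}"
  have A: "finite ?A" by (simp add: finite_co_supp)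
  have "bar (x + y) = (\<Sum>w\<in>?A. sc (lbar (co (x + y) w)) * barI w)" by (rule bar_on[OF A]) auto
  moreover have "bar x = (\<Sum>w\<in>?A. sc (lbar (co x w)) * barI w)" by (rule bar_on[OF A]) auto
  moreover have "bar y = (\<Sum>w\<in>?A. sc (lbar (co y w)) * barI w)" by (rule bar_on[OF A]) auto
  ultimately show ?thesis
    using assms by (simp add: lbar_add lpoly_co_def sc_add distrib_right sum.distrib)
qed

lemma bar_0 [simp]: "bar 0 = 0"
  by (simp add: bar_def)

lemma bar_scale: assumes "is_lpoly c" "lpoly_co x" shows "bar (sc c * x) = sc (lbar c) * bar x"
proof -
  have "bar (sc c * x) = (\<Sum>w | co x w \<noteq> 0. sc (lbar (co (sc c * x) w)) * barI w)"
    by (rule bar_on[OF finite_co_supp]) auto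
  then show ?thesis
    using assms by (simp add: bar_def lbar_mult lpoly_co_def sc_mult sum_distrib_left mult.assoc)
qed

lemma bar_bI: assumes "fperm w" shows "bar (bI w) = barI w"
proof -
  have "bar (bI w) = (\<Sum>u\<in>{w}. sc (lbar (co (bI w) u)) * barI u)"
    by (rule bar_on) (use assms in \<open>auto simp: co_bI split: if_splits\<close>)
  then show ?thesis using assms by (simp add: co_bI)
qed

lemma bar_1 [simp]: "bar 1 = 1"
  using bar_bI[of id] by (simp del: id_apply)

lemma lpoly_co_scale: "is_lpoly c \<Longrightarrow> lpoly_co x \<Longrightarrow> lpoly_co (sc c * x)"
  by (simp add: lpoly_co_def is_lpoly_mult)

lemma lpoly_co_0 [simp]: "lpoly_co 0"
  by (simp add: lpoly_co_def)

lemma lpoly_co_1 [simp]: "lpoly_co 1"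
  using lpoly_co_bI[of id] by simp

lemma lpoly_co_gs: "1 \<le> i \<Longrightarrow> lpoly_co x \<Longrightarrow> lpoly_co (gs i * x)"
  by (rule lpoly_co_galg_mult[of _ "{i}"]) (auto intro: galg.gen)

lemma lbar_zz: "lbar zz = - zz"
  using lbar_zz_mult[of 1] by simp

lemma bar_gs_mult:
  assumes i: "1 \<le> i" and x: "lpoly_co x"
  shows "bar (gs i * x) = gi i * bar x"
proof -
  have "lpoly_co x \<Longrightarrow> lpoly_co y \<Longrightarrow> bar (gs i * y) = gi i * bar y" for y
  proof -
    assume "lpoly_co y"
    \<comment> \<open>The predicate includes \<open>lpoly_co\<close> because additivity of
      \<open>bar\<close> requires it of the partial sums.\<close>
    have "(bar (gs i * y) = gi i * bar y) \<and> lpoly_co y"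
    proof (rule hk_induct_terms[of y "\<lambda>y. bar (gs i * y) = gi i * bar y \<and> lpoly_co y"])
      fix w assume w: "fperm w"
      define c where "c = co y w"
      have c: "is_lpoly c" using \<open>lpoly_co y\<close> by (simp add: c_def lpoly_co_def)
      have s: "fperm (sref i \<circ> w)" using w i by (intro fperm_comp fperm_sref)
      have "bar (gs i * bI w) = gi i * barI w"
        using w i s
        by (auto simp: gs_mult_bI gi_barI bar_add bar_scale bar_bI lpoly_co_bI lpoly_co_scale lbar_zz sc_uminus
            simp del: comp_apply)
      moreover have "gs i * (sc c * bI w) = sc c * (gs i * bI w)" by (rule sc_left_comm)
      ultimately show "bar (gs i * (sc (co y w) * bI w)) = gi i * bar (sc (co y w) * bI w)
          \<and> lpoly_co (sc (co y w) * bI w)"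
        unfolding c_def[symmetric] using c w i
        by (simp add: bar_scale lpoly_co_bI lpoly_co_gs lpoly_co_scale bar_bI sc_left_comm)
    qed (auto simp: distrib_left bar_add lpoly_co_add lpoly_co_gs i)
    then show ?thesis ..
  qed
  then show ?thesis using x by blast
qed

lemma bar_gs: "1 \<le> i \<Longrightarrow> bar (gs i) = gi i"
  using bar_gs_mult[of i 1] by simp

lemma bar_sc: "is_lpoly c \<Longrightarrow> bar (sc c) = sc (lbar c)"
  using bar_scale[of c 1] by simp

lemma bar_mult:
  assumes "r \<in> galg A" "0 \<notin> A" "lpoly_co x"
  shows "bar (r * x) = bar r * bar x"
  using assms
proof (induction arbitrary: x rule: galg.induct)
  case (gen i)
  then have "1 \<le> i" by (cases i) (auto simp: One_nat_def)
  then show ?case using gen by (simp add: bar_gs_mult bar_gs)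
next
  case (scalar c)
  then show ?case by (simp add: bar_scale bar_sc)
next
  case (add r s)
  have l: "lpoly_co (r * x)" "lpoly_co (s * x)" "lpoly_co r" "lpoly_co s"
    using add lpoly_co_galg_mult lpoly_co_galg by blast+
  show ?case
    unfolding distrib_right bar_add[OF l(1,2)] bar_add[OF l(3,4)]
    using add by simp
next
  case (mult r s)
  have "lpoly_co (s * x)" "lpoly_co s" using mult lpoly_co_galg_mult lpoly_co_galg by blast+
  then show ?case using mult by (simp add: mult.assoc)
qed

lemma lbar_uminus: "is_lpoly f \<Longrightarrow> lbar (- f) = - lbar f"
  by (rule fls_eqI) (simp add: nth_lbar is_lpoly_uminus)

lemma bar_gi: assumes "1 \<le> i" shows "bar (gi i) = gs i"
proof -
  have "bar (gs i + sc (- zz)) = bar (gs i) + bar (sc (- zz))"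
    using assms lpoly_co_gs[of i 1] lpoly_co_scale[of "- zz" 1] by (intro bar_add) (auto simp: is_lpoly_uminus)
  moreover have "lbar (- zz) = zz"
    by (simp add: lbar_uminus lbar_zz)
  ultimately show ?thesis
    using assms by (simp add: gi_def sc_uminus[symmetric] bar_gs bar_sc is_lpoly_uminus) (simp add: gi_def sc_uminus)
qed

lemma bar_asc:
  assumes a: "1 \<le> a"
  shows "bar (asc gs a k) = asc gi a k" "bar (asc gi a k) = asc gs a k" "bar (desc gs a k) = desc gi a k"
proof -
  have g: "asc gs a k \<in> galg {1..}" "asc gi a k \<in> galg {1..}" "desc gs a k \<in> galg {1..}" for k
    by (rule galg_asc; use a in auto)+
  have h: "gs (a + k) \<in> galg {1..}" "gi (a + k) \<in> galg {1..}" for k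
    using a by (auto intro: galg.gen galg_gi)
  have l: "lpoly_co x" if "x \<in> galg {1..}" for x by (rule lpoly_co_galg[OF that]) auto
  have m: "bar (x * y) = bar x * bar y" if "x \<in> galg {1..}" "y \<in> galg {1..}" for x y
    by (rule bar_mult[OF that(1) _ l[OF that(2)]]) auto
  show "bar (asc gs a k) = asc gi a k" "bar (asc gi a k) = asc gs a k"
    by (induction k) (use a in \<open>simp_all add: asc_Suc m g h bar_gs bar_gi\<close>)
  show "bar (desc gs a k) = desc gi a k"
    by (induction k) (use a in \<open>simp_all add: desc_Suc m g h bar_gs bar_gi\<close>)
qed

primrec Ginv :: "nat \<Rightarrow> nat \<Rightarrow> hk" where
  "Ginv m 0 = 1"
| "Ginv m (Suc k) = jucys_inv m k * Ginv m k"

lemma Ginv_galg: "Ginv m k \<in> galg {Suc m..<m + k}"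
proof (induction k)
  case (Suc k)
  have "Ginv m k \<in> galg {Suc m..<m + Suc k}" using Suc by (rule galg_mono) auto
  moreover have "jucys_inv m k \<in> galg {Suc m..<m + Suc k}" by (rule galg_mono[OF jucys_inv_galg]) auto
  ultimately show ?case unfolding Ginv.simps by (intro galg.mult)
qed simp

text \<open>The bar involution exchanges the two strings of the recursion. Taking the inverse of
  c_(m,k) out to the right puts the missing c_(m,k) on the other summand.\<close>

lemma bar_Hpart: "bar (Hpart m k) = Hpart m k * Ginv m k"
proof (induction k)
  case (Suc k)
  have l: "lpoly_co x" if "x \<in> galg {1..}" for x by (rule lpoly_co_galg[OF that]) auto
  have m: "bar (x * y) = bar x * bar y" if "x \<in> galg {1..}" "y \<in> galg {1..}" for x y
    by (rule bar_mult[OF that(1) _ l[OF that(2)]]) auto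
  have g: "asc gs (Suc k) m \<in> galg {1..}" "asc gi (Suc k) m \<in> galg {1..}" "Hpart m k \<in> galg {1..}"
    "jucys m k \<in> galg {1..}" "desc gs (Suc m) k \<in> galg {1..}" "asc gs (Suc m) k \<in> galg {1..}"
    by (rule galg_asc galg_mono[OF Hpart_galg] galg_mono[OF jucys_galg]; auto)+
  have b: "bar (jucys m k) = jucys_inv m k"
    by (simp add: jucys_def jucys_inv_def m g bar_asc)
  have "bar (Hpart m (Suc k)) = bar (asc gs (Suc k) m * Hpart m k) + bar (asc gi (Suc k) m * Hpart m k * jucys m k)"
    unfolding Hpart.simps by (rule bar_add) (auto intro!: l galg.mult g)
  also have "\<dots> = asc gi (Suc k) m * (Hpart m k * Ginv m k) + asc gs (Suc k) m * (Hpart m k * Ginv m k) * jucys_inv m k"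
    using Suc by (simp add: m g galg.mult b bar_asc)
  also have "\<dots> = asc gi (Suc k) m * Hpart m k * (jucys m k * jucys_inv m k) * Ginv m k
      + asc gs (Suc k) m * Hpart m k * (Ginv m k * jucys_inv m k)"
    by (simp add: jucys_jucys_inv mult.assoc)
  also have "Ginv m k * jucys_inv m k = jucys_inv m k * Ginv m k"
    using jucys_inv_comm_galg[OF Ginv_galg] by simp
  finally show ?case by (simp add: algebra_simps)
qed simp

text \<open>A reduced word for the longest permutation of k consecutive letters starting at m+1; for
  k = m it gives gamma.\<close>

primrec half_twist :: "nat \<Rightarrow> nat \<Rightarrow> hk" where
  "half_twist m 0 = 1"
| "half_twist m (Suc k) = half_twist m k * desc gs (Suc m) k"

primrec half_twist_inv :: "nat \<Rightarrow> nat \<Rightarrow> hk" where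
  "half_twist_inv m 0 = 1"
| "half_twist_inv m (Suc k) = asc gi (Suc m) k * half_twist_inv m k"

lemma half_twist_galg: "half_twist m k \<in> galg {Suc m..<m + k}" "half_twist_inv m k \<in> galg {Suc m..<m + k}"
proof (induction k)
  case (Suc k)
  have "desc gs (Suc m) k \<in> galg {Suc m..<m + Suc k}" "asc gi (Suc m) k \<in> galg {Suc m..<m + Suc k}"
    by (rule galg_asc; auto)+
  moreover have "half_twist m k \<in> galg {Suc m..<m + Suc k}" "half_twist_inv m k \<in> galg {Suc m..<m + Suc k}"
    by (rule galg_mono[OF Suc(1)] galg_mono[OF Suc(2)]; auto)+
  ultimately show "half_twist m (Suc k) \<in> galg {Suc m..<m + Suc k}" "half_twist_inv m (Suc k) \<in> galg {Suc m..<m + Suc k}"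
    by (auto intro: galg.mult)
qed simp_all

lemma half_twist_half_twist_inv: "half_twist m k * half_twist_inv m k = 1" "half_twist_inv m k * half_twist m k = 1"
proof (induction k)
  case (Suc k)
  have s: "1 \<le> Suc m" by simp
  have "half_twist m (Suc k) * half_twist_inv m (Suc k) = half_twist m k * (desc gs (Suc m) k * asc gi (Suc m) k) * half_twist_inv m k"
    by (simp add: mult.assoc)
  then show "half_twist m (Suc k) * half_twist_inv m (Suc k) = 1" using Suc asc_desc_gs[OF s] by simp
  have "half_twist_inv m (Suc k) * half_twist m (Suc k) = asc gi (Suc m) k * (half_twist_inv m k * half_twist m k) * desc gs (Suc m) k"
    by (simp add: mult.assoc)
  then show "half_twist_inv m (Suc k) * half_twist m (Suc k) = 1" using Suc asc_desc_gs[OF s] by simp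
qed simp_all

text \<open>Two ways of building the half twist on k+1 strands from the one on k strands.\<close>

lemma half_twist_flip: "half_twist m k * desc gs (Suc m) k = asc gs (Suc m) k * half_twist m k"
proof (induction k)
  case (Suc k)
  let ?g = "gs (Suc m + k)"
  have c: "?g * half_twist m k = half_twist m k * ?g"
    by (rule galg_comm[OF _ half_twist_galg(1)]) (intro gs_far, auto)
  have "asc gs (Suc m) (Suc k) * half_twist m (Suc k) = asc gs (Suc m) k * (?g * half_twist m k) * desc gs (Suc m) k"
    by (simp add: asc_Suc mult.assoc)
  also have "\<dots> = (asc gs (Suc m) k * half_twist m k) * (?g * desc gs (Suc m) k)"
    unfolding c by (simp add: mult.assoc)
  also have "\<dots> = half_twist m (Suc k) * desc gs (Suc m) (Suc k)"
    unfolding Suc[symmetric] by (simp add: desc_Suc mult.assoc)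
  finally show ?case by simp
qed simp

text \<open>The square of \<open>half_twist\<close> is the full twist of the second block, which is the product of its
  Jucys-Murphy elements \<open>jucys\<close>.\<close>
lemma Ginv_half_twist: "Ginv m k * (half_twist m k * half_twist m k) = 1"
proof (induction k)
  case (Suc k)
  have "half_twist m (Suc k) * half_twist m (Suc k) = half_twist m k * desc gs (Suc m) k * (asc gs (Suc m) k * half_twist m k)"
    by (simp add: half_twist_flip)
  also have "\<dots> = half_twist m k * (jucys m k * half_twist m k)" by (simp add: jucys_def mult.assoc)
  also have "\<dots> = half_twist m k * half_twist m k * jucys m k"
    unfolding jucys_comm_galg[OF half_twist_galg(1)] by (simp add: mult.assoc)
  finally have "Ginv m (Suc k) * (half_twist m (Suc k) * half_twist m (Suc k))
      = jucys_inv m k * (Ginv m k * (half_twist m k * half_twist m k)) * jucys m k"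
    by (simp add: mult.assoc)
  then show ?case using Suc by (simp add: jucys_jucys_inv)
qed simp

lemma Ginv_half_twist_inv: "Ginv m k = half_twist_inv m k * half_twist_inv m k"
proof -
  have "Ginv m k = Ginv m k * (half_twist m k * (half_twist m k * half_twist_inv m k) * half_twist_inv m k)" by (simp add: half_twist_half_twist_inv)
  also have "\<dots> = Ginv m k * (half_twist m k * half_twist m k) * (half_twist_inv m k * half_twist_inv m k)" by (simp add: mult.assoc)
  finally show ?thesis by (simp add: Ginv_half_twist)
qed

definition dcyc :: "nat \<Rightarrow> nat \<Rightarrow> nat \<Rightarrow> nat" where
  "dcyc a k j = (if j = a then a + k else if a < j \<and> j \<le> a + k then j - 1 else j)"

lemma dcyc_Suc: "dcyc a (Suc k) = sref (a + k) \<circ> dcyc a k"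
  by (rule ext) (auto simp: dcyc_def sref_def sw_def)

lemma dcyc_0 [simp]: "dcyc a 0 = id"
  by (auto simp: dcyc_def)

lemma dcyc_perms: "1 \<le> a \<Longrightarrow> a + k \<le> n \<Longrightarrow> dcyc a k \<in> perms n"
  by (induction k) (auto simp: dcyc_Suc intro!: comp_perms sref_perms simp del: comp_apply id_apply)

lemma bI_mult_desc:
  assumes "fperm w" "1 \<le> a" "\<And>j. a \<le> j \<Longrightarrow> j < a + k \<Longrightarrow> w j < w (a + k)"
  shows "bI w * desc gs a k = bI (w \<circ> dcyc a k)"
  using assms
proof (induction k arbitrary: w)
  case (Suc k)
  have ak: "1 \<le> a + k" using Suc.prems by simp
  define s where "s = w \<circ> sref (a + k)"
  have s: "fperm s" unfolding s_def using Suc.prems ak by (intro fperm_comp fperm_sref)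
  have "bI w * gs (a + k) = bI s"
    unfolding s_def using Suc.prems ak by (intro bI_right_up[symmetric]) auto
  then have "bI w * desc gs a (Suc k) = bI s * desc gs a k"
    by (simp add: desc_Suc mult.assoc[symmetric])
  also have "\<dots> = bI (s \<circ> dcyc a k)"
  proof (rule Suc.IH[OF s])
    fix j assume "a \<le> j" "j < a + k"
    then show "s j < s (a + k)" using Suc.prems(3)[of j] by (simp add: s_def) (simp add: sref_def sw_def)
  qed (use Suc.prems in auto)
  also have "s \<circ> dcyc a k = w \<circ> dcyc a (Suc k)" by (simp add: s_def dcyc_Suc comp_assoc del: comp_apply)
  finally show ?case .
qed (simp del: id_apply)

definition rk :: "nat \<Rightarrow> nat \<Rightarrow> nat \<Rightarrow> nat" where
  "rk m k j = (if m + 1 \<le> j \<and> j \<le> m + k then 2 * m + k + 1 - j else j)"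

lemma half_twist_bI: "rk m k \<in> perms (m + k) \<and> half_twist m k = bI (rk m k)"
proof (induction k)
  case 0
  have "rk m 0 = id" by (auto simp: rk_def)
  then show ?case by (simp del: id_apply)
next
  case (Suc k)
  have f: "fperm (rk m k)" using Suc perms_fperm by blast
  have e: "rk m k \<circ> dcyc (Suc m) k = rk m (Suc k)"
    by (rule ext) (auto simp: rk_def dcyc_def One_nat_def)
  have "bI (rk m k) * desc gs (Suc m) k = bI (rk m k \<circ> dcyc (Suc m) k)"
    by (rule bI_mult_desc[OF f]) (auto simp: rk_def)
  moreover have "rk m (Suc k) \<in> perms (m + Suc k)"
    unfolding e[symmetric] using Suc perms_mono[of "rk m k" "m + k" "m + Suc k"]
    by (intro comp_perms dcyc_perms) auto
  ultimately show ?case using Suc e by simp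
qed

lemma w0_shift_rk: "w0_shift m = rk m m"
  by (rule ext) (auto simp: w0_shift_def rk_def)

lemma w0_shift_perms: "w0_shift m \<in> perms (2 * m)"
  unfolding w0_shift_rk using half_twist_bI[of m m] by (simp add: mult_2)

lemma bI_w0_shift: "bI (w0_shift m) = half_twist m m"
  unfolding w0_shift_rk using half_twist_bI[of m m] by simp

lemma bar_half_twist: "bar (half_twist m m) = half_twist_inv m m"
proof -
  have "w0_shift m \<circ> w0_shift m = id" by (rule ext) (auto simp: w0_shift_def)
  then have "inv (w0_shift m) = w0_shift m" by (intro inv_unique_comp)
  then have "barI (w0_shift m) = half_twist_inv m m"
    by (intro barI_eqI) (simp_all add: bI_w0_shift half_twist_half_twist_inv)
  then show ?thesis
    using bar_bI[OF perms_fperm[OF w0_shift_perms]] by (simp add: bI_w0_shift)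
qed

text \<open>The bar image of R is R gamma^(-2), and that of gamma^(-1) is gamma; together they
  restore R gamma^(-1).\<close>

lemma bar_Hpart_half_twist_inv: "bar (Hpart m m * half_twist_inv m m) = Hpart m m * half_twist_inv m m"
proof -
  have l: "lpoly_co x" if "x \<in> galg {1..}" for x by (rule lpoly_co_galg[OF that]) auto
  have m: "bar (x * y) = bar x * bar y" if "x \<in> galg {1..}" "y \<in> galg {1..}" for x y
    by (rule bar_mult[OF that(1) _ l[OF that(2)]]) auto
  have g: "half_twist m m \<in> galg {1..}" "half_twist_inv m m \<in> galg {1..}" "Hpart m m \<in> galg {1..}"
    by (rule galg_mono[OF half_twist_galg(1)] galg_mono[OF half_twist_galg(2)] galg_mono[OF Hpart_galg]; auto)+
  have "half_twist_inv m m * bar (half_twist_inv m m) = 1"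
    using m[OF g(1,2)] by (simp add: half_twist_half_twist_inv bar_half_twist)
  then have "bar (half_twist_inv m m) = half_twist m m"
    using half_twist_half_twist_inv[of m m] by (metis mult.assoc mult_1 mult_1_right)
  then have "bar (Hpart m m * half_twist_inv m m) = Hpart m m * half_twist_inv m m * (half_twist_inv m m * half_twist m m)"
    using m[OF g(3,2)] by (simp add: bar_Hpart Ginv_half_twist_inv mult.assoc)
  then show ?thesis by (simp add: half_twist_half_twist_inv)
qed

section \<open>Bruhat order\<close>

text \<open>An inversion of y is carried to the exchanged positions when these are still in order
  and kept otherwise. This embeds the inversions of y into those of the product and misses the new
  inversion (i, j).\<close>

lemma ell_transposition:
  assumes y: "fperm y" and ij: "1 \<le> i" "i < j" and less: "y i < y j"
  shows "ell y < ell (y \<circ> sw i j)"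
proof -
  let ?t = "sw i j"
  have "fperm ?t" using sw_perms[of i j j] ij by (intro perms_fperm) auto
  then have f: "fperm (y \<circ> ?t)" by (rule fperm_comp[OF y])
  define \<phi> where "\<phi> = (\<lambda>(a, b). if ?t a < ?t b then (?t a, ?t b) else (a, b))"
  have "\<phi> ` Inv y \<subseteq> Inv (y \<circ> ?t) - {(i, j)}"
  proof
    fix p assume "p \<in> \<phi> ` Inv y"
    then obtain a b where p: "p = \<phi> (a, b)" "a < b" "y b < y a" by (auto simp: Inv_def)
    show "p \<in> Inv (y \<circ> ?t) - {(i, j)}"
    proof (cases "?t a < ?t b")
      case True
      moreover have "(?t a, ?t b) \<noteq> (i, j)"
      proof
        assume "(?t a, ?t b) = (i, j)"
        then have "a = j" "b = i" by (auto simp: sw_def split: if_splits)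
        then show False using p ij by simp
      qed
      ultimately show ?thesis using p by (auto simp: \<phi>_def Inv_def)
    next
      case False
      then have "a = i \<and> b < j \<or> i < a \<and> b = j \<or> a = i \<and> b = j"
        using p(2) ij by (auto simp: sw_def split: if_splits)
      moreover have "\<not> (a = i \<and> b = j)" using p(3) less by auto
      ultimately show ?thesis
        using False p ij less by (auto simp: \<phi>_def Inv_def sw_def split: if_splits)
    qed
  qed
  moreover have "inj_on \<phi> (Inv y)"
  proof (rule inj_onI)
    fix p q assume pq: "p \<in> Inv y" "q \<in> Inv y" "\<phi> p = \<phi> q"
    obtain a b c d where e: "p = (a, b)" "q = (c, d)" "a < b" "c < d"
      using pq(1,2) by (auto simp: Inv_def)
    have "?t u = v \<longleftrightarrow> u = ?t v" for u v by (auto simp: sw_def)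
    then show "p = q" using pq(3) e by (auto simp: \<phi>_def split: if_splits)
  qed
  moreover have "(i, j) \<in> Inv (y \<circ> ?t)" using ij less by (simp add: Inv_def sw_def)
  ultimately have "card (Inv y) \<le> card (Inv (y \<circ> ?t) - {(i, j)})" "(i, j) \<in> Inv (y \<circ> ?t)"
    using finite_Inv[OF f] card_mono[of "Inv (y \<circ> ?t) - {(i, j)}" "\<phi> ` Inv y"] by (auto simp: card_image)
  moreover have "card (Inv (y \<circ> ?t) - {(i, j)}) < card (Inv (y \<circ> ?t))"
    using finite_Inv[OF f] \<open>(i, j) \<in> Inv (y \<circ> ?t)\<close> by (rule card_Diff1_less)
  ultimately show ?thesis by (simp add: ell_def)
qed

lemma bruhat_step_iff:
  "bruhat_step n y x \<longleftrightarrow> y \<in> perms n \<and> (\<exists>i j. 1 \<le> i \<and> i < j \<and> j \<le> n \<and> x = y \<circ> sw i j \<and> y i < y j)"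
proof -
  have "len n y < len n (y \<circ> sw i j) \<longleftrightarrow> y i < y j"
    if y: "y \<in> perms n" and ij: "1 \<le> i" "i < j" "j \<le> n" for i j
  proof -
    have t: "y \<circ> sw i j \<in> perms n" using y ij by (intro comp_perms sw_perms) auto
    have "y i \<noteq> y j" using fperm_inj[OF perms_fperm[OF y]] ij by simp
    moreover have "ell y < ell (y \<circ> sw i j)" if "y i < y j"
      using that ell_transposition perms_fperm[OF y] ij by blast
    moreover have "ell (y \<circ> sw i j) < ell y" if "y j < y i"
    proof -
      have "ell (y \<circ> sw i j) < ell ((y \<circ> sw i j) \<circ> sw i j)"
        using that ij by (intro ell_transposition perms_fperm[OF t]) (auto simp: sw_def)
      then show ?thesis by (simp add: comp_assoc del: comp_apply)
    qed
    ultimately show ?thesis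
      unfolding len_ell[OF y] len_ell[OF t] by (meson less_asym nat_neq_iff)
  qed
  then show ?thesis by (auto simp: bruhat_step_def simp del: comp_apply)
qed

lemma sref_comp_sw: "fperm x \<Longrightarrow> sref k \<circ> x = x \<circ> sw (inv x k) (inv x (Suc k))"
proof
  fix a assume f: "fperm x"
  have x: "x (inv x b) = b" "inv x (x b) = b" for b using f by (simp_all add: fperm_f_inv fperm_inv_f)
  consider "x a = k" | "x a = Suc k" | "x a \<noteq> k" "x a \<noteq> Suc k" by blast
  then show "(sref k \<circ> x) a = (x \<circ> sw (inv x k) (inv x (Suc k))) a"
  proof cases
    case 1
    then have "inv x k = a" using x(2)[of a] by simp
    then show ?thesis using 1 x(1) by (simp add: sw_def)
  next
    case 2
    then have "inv x (Suc k) = a" using x(2)[of a] by simp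
    then show ?thesis using 2 x(1) by (simp add: sw_def)
  next
    case 3
    then have "a \<noteq> inv x k" "a \<noteq> inv x (Suc k)" using x(1) by auto
    then show ?thesis using 3 by (simp add: sw_def sref_def)
  qed
qed

lemma bruhat_step_up:
  assumes x: "x \<in> perms n" and k: "1 \<le> k" "k < n" and up: "inv x k < inv x (Suc k)"
  shows "bruhat_step n x (sref k \<circ> x)"
proof -
  have f: "fperm x" using x by (rule perms_fperm)
  have "inv x k \<in> {1..n}" "inv x (Suc k) \<in> {1..n}"
    using perms_in[OF inv_perms[OF x]] k by auto
  then show ?thesis
    unfolding bruhat_step_iff sref_comp_sw[OF f] using x up fperm_f_inv[OF f]
    by (intro conjI exI[of _ "inv x k"] exI[of _ "inv x (Suc k)"]) auto
qed

lemma bruhat_refl: "bruhat_le n x x"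
  by (simp add: bruhat_le_def)

lemma bruhat_trans: "bruhat_le n x y \<Longrightarrow> bruhat_le n y z \<Longrightarrow> bruhat_le n x z"
  by (simp add: bruhat_le_def)

lemma bruhat_stepI: "bruhat_step n x y \<Longrightarrow> bruhat_le n x y"
  by (simp add: bruhat_le_def r_into_rtranclp)

text \<open>Follow a chain of reflections. Left multiplication by s_k preserves an upward step from
  w to x unless that step exchanges the values k and k+1, and then s_k w is already x.\<close>

lemma bruhat_lifting:
  assumes le: "bruhat_le n y w" and k: "1 \<le> k" "k < n"
  shows "bruhat_le n (sref k \<circ> y) w \<or> bruhat_le n (sref k \<circ> y) (sref k \<circ> w)"
  using le[unfolded bruhat_le_def]
proof (induction rule: rtranclp_induct)
  case base
  show ?case by (simp add: bruhat_refl)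
next
  case (step w x)
  then obtain i j where w: "w \<in> perms n" and ij: "1 \<le> i" "i < j" "j \<le> n" "x = w \<circ> sw i j" "w i < w j"
    unfolding bruhat_step_iff by blast
  have f: "fperm w" using w by (rule perms_fperm)
  from step.IH show ?case
  proof
    assume "bruhat_le n (sref k \<circ> y) w"
    then show ?thesis using bruhat_trans bruhat_stepI step(2) by blast
  next
    assume le: "bruhat_le n (sref k \<circ> y) (sref k \<circ> w)"
    show ?thesis
    proof (cases "sref k (w i) < sref k (w j)")
      case True
      then have "bruhat_step n (sref k \<circ> w) (sref k \<circ> x)"
        unfolding bruhat_step_iff using w k ij
        by (intro conjI perms_sref_comp exI[of _ i] exI[of _ j]) (auto simp: comp_assoc)
      then show ?thesis using le bruhat_trans bruhat_stepI by blast
    next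
      case False
      then have "w i = k" "w j = Suc k"
        using ij(5) by (auto simp: sref_def sw_def split: if_splits)
      then have "inv w k = i" "inv w (Suc k) = j" using fperm_inv_f[OF f] by metis+
      then have "sref k \<circ> w = x" using sref_comp_sw[OF f] ij(4) by simp
      then show ?thesis using le by (simp del: comp_apply)
    qed
  qed
qed

text \<open>With x = s_j w above w, a permutation y in the expansion of \<open>barI x\<close> has
  s_j y or y in that of \<open>barI w\<close>; lifting places it below x. At x itself the
  \<open>zz\<close> contributions cancel, so the coefficient stays 1.\<close>

lemma barI_bruhat:
  assumes "w \<in> perms n"
  shows "co (barI w) w = 1 \<and> (\<forall>y. co (barI w) y \<noteq> 0 \<longrightarrow> bruhat_le n y w)"
  using assms
proof (induction rule: perms_left_induct)
  case id
  have "co (barI id) y = (if y = id then 1 else 0)" for y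
    using co_bI[of id y] by (simp del: id_apply)
  then show ?case by (simp add: bruhat_refl del: id_apply)
next
  case (step w j)
  have f: "fperm w" using step(1) by (rule perms_fperm)
  define x where "x = sref j \<circ> w"
  have x: "fperm x" "sref j \<circ> x = w" unfolding x_def
    using f step(2) by (simp_all add: fperm_comp fperm_sref del: comp_apply)
  have wx: "bruhat_le n w x"
    unfolding x_def using step by (intro bruhat_stepI bruhat_step_up)
  have bx: "barI x = gs j * barI w - sc zz * barI w"
    unfolding x_def barI_up[OF f step(2,4)] by (simp add: gi_def left_diff_distrib)
  have c: "co (barI x) u = co (barI w) (sref j \<circ> u)
      + (if inv u (Suc j) < inv u j then 0 else - (zz * co (barI w) u))" if "fperm u" for u
    unfolding bx by (simp add: co_gs_mult[OF that step(2)])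
  have "inv x (Suc j) < inv x j"
    using step(4) unfolding x_def inv_sref_comp[OF f step(2)] by simp
  then have "co (barI x) x = 1" using c[OF x(1)] step.IH x(2) by simp
  moreover have "bruhat_le n y x" if y: "co (barI x) y \<noteq> 0" for y
  proof -
    have fy: "fperm y" using y co_out by blast
    have "co (barI w) (sref j \<circ> y) \<noteq> 0 \<or> co (barI w) y \<noteq> 0"
      using y c[OF fy] by (auto split: if_splits)
    then have "bruhat_le n (sref j \<circ> y) w \<or> bruhat_le n y w" using step.IH by blast
    then show ?thesis
    proof
      assume "bruhat_le n (sref j \<circ> y) w"
      from bruhat_lifting[OF this step(2,3)]
      have "bruhat_le n y w \<or> bruhat_le n y x" by (simp add: x_def del: comp_apply)
      then show ?thesis using wx bruhat_trans by blast
    next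
      assume "bruhat_le n y w"
      then show ?thesis using wx by (rule bruhat_trans)
    qed
  qed
  ultimately show ?case unfolding x_def by blast
qed

context
  fixes m :: nat
  assumes m: "1 \<le> m"
begin

text \<open>A transposition across the blocks that leads up to a Young element would have to put a
  small value before a large one, against y i < y j. So the Young subgroup is closed downwards,
  through steps inside the blocks.\<close>

lemma sw_blocks:
  assumes x: "x \<in> young m" and st: "bruhat_step (2 * m) y x"
  obtains i j where "x = y \<circ> sw i j" "1 \<le> i" "i < j" "j \<le> 2 * m" "y i < y j" "y \<in> perms (2 * m)"
    "j \<le> m \<or> m < i"
proof -
  obtain i j where ij: "x = y \<circ> sw i j" "1 \<le> i" "i < j" "j \<le> 2 * m" "y i < y j" "y \<in> perms (2 * m)"
    using st unfolding bruhat_step_iff by blast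
  have "j \<le> m \<or> m < i"
  proof (rule ccontr)
    assume n: "\<not> (j \<le> m \<or> m < i)"
    have "x i \<in> {1..m}" using young_iff[OF m x, of i] n ij by auto
    moreover have "x j \<notin> {1..m}" using young_iff[OF m x, of j] n ij by auto
    moreover have "x i = y j" "x j = y i" using ij by (auto simp: sw_def)
    moreover have "y i \<in> {1..2 * m}" using perms_in[OF ij(6), of i] ij by auto
    ultimately show False using ij(5) by auto
  qed
  then show thesis using that ij by blast
qed

lemma young_bruhat_step:
  assumes "x \<in> young m" "bruhat_step (2 * m) y x"
  shows "y \<in> young m"
proof -
  obtain i j where ij: "x = y \<circ> sw i j" "1 \<le> i" "i < j" "j \<le> 2 * m" "y i < y j" "y \<in> perms (2 * m)"
    "j \<le> m \<or> m < i"
    using sw_blocks[OF assms] by blast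
  have "sw i j k \<in> {1..m} \<longleftrightarrow> k \<in> {1..m}" for k using ij by (auto simp: sw_def)
  then have "sw i j ` {1..m} = {1..m}" by (metis (no_types, lifting) image_iff sw_sw subsetI subset_antisym)
  moreover have "y = x \<circ> sw i j" unfolding ij(1) by (simp add: fun_eq_iff)
  ultimately have "y ` {1..m} = {1..m}" using assms(1) by (simp only: image_comp[symmetric]) (simp add: young_def)
  then show ?thesis using ij by (simp add: young_def)
qed

lemma young_bruhat_le: "bruhat_le (2 * m) y x \<Longrightarrow> x \<in> young m \<Longrightarrow> y \<in> young m"
  unfolding bruhat_le_def
  by (induction rule: converse_rtranclp_induct) (auto intro: young_bruhat_step)

lemma t1_t1 [simp]: "t1 m (t1 m k) = k"
  by (auto simp: t1_def)

lemma comp_t1_t1 [simp]: "(w :: nat \<Rightarrow> nat) \<circ> t1 m \<circ> t1 m = w"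
  by (simp add: fun_eq_iff)

text \<open>On each block t_1 is increasing, so it carries a transposition inside a block to one
  inside the other block with the same order of positions.\<close>

lemma bruhat_le_t1:
  assumes "bruhat_le (2 * m) y x" "x \<in> young m"
  shows "bruhat_le (2 * m) (y \<circ> t1 m) (x \<circ> t1 m)"
  using assms unfolding bruhat_le_def
proof (induction rule: converse_rtranclp_induct)
  case (step y z)
  have z: "z \<in> young m" using step(2,4) young_bruhat_le unfolding bruhat_le_def by blast
  obtain i j where ij: "z = y \<circ> sw i j" "1 \<le> i" "i < j" "j \<le> 2 * m" "y i < y j" "y \<in> perms (2 * m)"
    "j \<le> m \<or> m < i"
    using sw_blocks[OF z step(1)] by blast
  have tp: "t1 m \<in> perms (2 * m)" unfolding t1_tk using tpart_bI[of m m] by (simp add: mult_2)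
  have sw: "sw i j (t1 m k) = t1 m (sw (t1 m i) (t1 m j) k)" for k
    by (auto simp: sw_def)
  have "bruhat_step (2 * m) (y \<circ> t1 m) (z \<circ> t1 m)"
    unfolding bruhat_step_iff
  proof (intro conjI exI)
    show "y \<circ> t1 m \<in> perms (2 * m)" using ij(6) tp by (rule comp_perms)
    show "z \<circ> t1 m = (y \<circ> t1 m) \<circ> sw (t1 m i) (t1 m j)"
      by (rule ext) (simp add: ij(1) sw)
    show "1 \<le> t1 m i" "t1 m i < t1 m j" "t1 m j \<le> 2 * m"
      using ij by (auto simp: t1_def)
    show "(y \<circ> t1 m) (t1 m i) < (y \<circ> t1 m) (t1 m j)" using ij by simp
  qed
  then show ?case by (rule converse_rtranclp_into_rtranclp[OF _ step.IH[OF step.prems]])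
qed simp

end

section \<open>The Hu algebra\<close>

lemma hmul_cf: "supported n x \<Longrightarrow> supported n y \<Longrightarrow> hmul n (cf x) (cf y) = cf (x * y)"
  by (simp add: cf_times)

lemma hadd_cf: "hadd (cf x) (cf y) = cf (x + y)"
  by (simp add: cf_plus)

lemma hscale_cf: "hscale c (cf x) = cf (sc c * x)"
  by (simp add: cf_sc_mult)

lemma hsum_cf: "hsum A (\<lambda>a. cf (f a)) = cf (sum f A)"
  by (rule ext) (simp add: hsum_def cf_sum)

lemma Ib_cf: "w \<in> perms n \<Longrightarrow> Ib n w = cf (bI w)"
  by (simp add: Ib_def cf_bI perms_fperm len_ell)

lemma supported_prod_list: "(\<And>x. x \<in> set xs \<Longrightarrow> supported n x) \<Longrightarrow> supported n (prod_list xs)"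
  by (induction xs) (auto intro: supported_one supported_times)

lemma hprod_cf:
  assumes "\<And>x. x \<in> set xs \<Longrightarrow> supported n x"
  shows "hprod n (map cf xs) = cf (prod_list xs)"
  using assms
proof (induction xs)
  case (Cons x xs)
  then have "hprod n (map cf (x # xs)) = hmul n (cf x) (cf (prod_list xs))"
    by (simp add: hprod_def)
  then show ?case using Cons.prems by (simp add: hmul_cf supported_prod_list)
qed (simp add: hprod_def cf_one)

lemma hinv_cf:
  assumes "supported n x" "supported n y" "x * y = 1" "y * x = 1"
  shows "hinv n (cf x) = cf y"
  unfolding hinv_def
proof (rule the_equality)
  show "cf y \<in> hecke_carrier n \<and> hmul n (cf x) (cf y) = hone \<and> hmul n (cf y) (cf x) = hone"
    using assms by (simp add: hmul_cf cf_one) (simp add: supported_def)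
  fix g assume g: "g \<in> hecke_carrier n \<and> hmul n (cf x) g = hone \<and> hmul n g (cf x) = hone"
  define h where "h = Abs_hk g"
  have h: "g = cf h" "supported n h" using g by (auto simp: h_def cf_Abs supported_Abs)
  then have "cf (h * x) = cf 1" using g assms by (simp add: cf_times cf_one)
  then have "h * x = 1" by (simp add: cf_inject)
  then have "h = y" using assms(3) by (metis mult.assoc mult_1 mult_1_right)
  then show "g = cf y" using h by simp
qed

lemma hbar_cf:
  assumes x: "supported n x"
  shows "hbar n (cf x) = cf (bar x)"
proof -
  have "hbar n (cf x) = hsum (perms n) (\<lambda>w. cf (sc (lbar (co x w)) * barI w))"
    unfolding hbar_def hsum_def
  proof (rule ext, rule sum.cong[OF refl])
    fix u w assume w: "w \<in> perms n"
    note b = barI_inverse[OF w]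
    have "hinv n (Ib n (inv w)) = cf (barI w)"
      unfolding Ib_cf[OF inv_perms[OF w]]
      using b by (intro hinv_cf supported_bI inv_perms w supported_galg[of _ "{1..<n}"]) auto
    then show "hscale (lbar (vv ^ len n w * cf x w)) (hinv n (Ib n (inv w))) u
        = cf (sc (lbar (co x w)) * barI w) u"
      using w by (simp add: co_def len_ell hscale_cf)
  qed
  also have "\<dots> = cf (bar x)"
    unfolding hsum_cf using x
    by (subst bar_on[of "perms n" x]) (auto simp: supported_co)
  finally show ?thesis .
qed

section \<open>The elements of the statement, rewritten in the ring \<open>hk\<close>\<close>

lemma idx_up: "a \<le> b \<Longrightarrow> idx a b = [a..<Suc b]"
  by (simp add: idx_def)

lemma idx_down: "b \<le> a \<Longrightarrow> idx a b = rev [b..<Suc a]"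
  by (cases "a = b") (auto simp: idx_def)

context
  fixes m :: nat
  assumes m: "1 \<le> m"
begin

lemma Ig_map: "set xs \<subseteq> {1..<2 * m} \<Longrightarrow> map (Ig m) xs = map cf (map gs xs)"
  by (auto simp: Ig_def gs_def Ib_cf sref_perms)

lemma Iarrow_up:
  assumes "1 \<le> a" "a + k \<le> 2 * m" "1 \<le> k"
  shows "Iarrow m a (a + k - 1) = cf (asc gs a k)"
proof -
  have "idx a (a + k - 1) = [a..<a + k]" using assms by (subst idx_up) auto
  moreover have "map (Ig m) ([a..<a + k]) = map cf (map gs ([a..<a + k]))"
    by (rule Ig_map) (use assms in auto)
  moreover have "hprod (2 * m) (map cf (map gs ([a..<a + k]))) = cf (prod_list (map gs ([a..<a + k])))"
    by (rule hprod_cf) (use assms in \<open>auto intro!: supported_gs\<close>)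
  ultimately show ?thesis unfolding Iarrow_def asc_def by (simp only:)
qed

lemma Iarrow_down:
  assumes "1 \<le> a" "a + k \<le> 2 * m" "1 \<le> k"
  shows "Iarrow m (a + k - 1) a = cf (desc gs a k)"
proof -
  have "idx (a + k - 1) a = rev [a..<a + k]" using assms by (subst idx_down) auto
  moreover have "map (Ig m) (rev [a..<a + k]) = map cf (map gs (rev [a..<a + k]))"
    by (rule Ig_map) (use assms in auto)
  moreover have "hprod (2 * m) (map cf (map gs (rev [a..<a + k]))) = cf (prod_list (map gs (rev [a..<a + k])))"
    by (rule hprod_cf) (use assms in \<open>auto intro!: supported_gs\<close>)
  ultimately show ?thesis unfolding Iarrow_def desc_def by (simp only:)
qed

lemma supported_asc:
  assumes "1 \<le> a" "a + k \<le> 2 * m"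
  shows "supported (2 * m) (asc gs a k)" "supported (2 * m) (asc gi a k)" "supported (2 * m) (desc gs a k)"
  by (rule supported_galg[OF galg_asc(1)[OF order_refl]] supported_galg[OF galg_asc(2)[OF order_refl]]
      supported_galg[OF galg_asc(3)[OF order_refl]]; use assms in auto)+

lemma Ipm_cf:
  assumes k: "1 \<le> k" "k \<le> m"
  shows "Ipm m pos (m + 1 - k) (2 * m - k)
    = cf (if pos then asc gs (m + 1 - k) m else asc gi (m + 1 - k) m)"
proof -
  define a where "a = m + 1 - k"
  have a: "1 \<le> a" "a + m \<le> 2 * m" "2 * m - k = a + m - 1" using k by (auto simp: a_def)
  have "hinv (2 * m) (cf (desc gs a m)) = cf (asc gi a m)"
    using a by (intro hinv_cf supported_asc asc_desc_gs)
  then show ?thesis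
    unfolding Ipm_def a(3) a_def[symmetric] using Iarrow_up[OF a(1,2) m] Iarrow_down[OF a(1,2) m] by simp
qed

lemma cm_cf: assumes "i < m" shows "cm m i = cf (jucys m i)"
proof (cases "i = 0")
  case True
  then show ?thesis by (simp add: cm_def jucys_def cf_one)
next
  case False
  then have "Iarrow m (m + i) (Suc m) = cf (desc gs (Suc m) i)" "Iarrow m (Suc m) (m + i) = cf (asc gs (Suc m) i)"
    using Iarrow_down[of "Suc m" i] Iarrow_up[of "Suc m" i] assms by simp_all
  moreover have "m + 1 = Suc m" by simp
  ultimately show ?thesis
    using False assms supported_asc[of "Suc m" i] by (simp only: cm_def jucys_def if_False) (simp add: hmul_cf)
qed

definition Pf :: "nat set \<Rightarrow> nat \<Rightarrow> hk" where
  "Pf S k = (if k \<notin> S then asc gs (m + 1 - k) m else asc gi (m + 1 - k) m)"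

text \<open>The factors of I_epsilon with index at least a, so that a sign can be added at the left
  end; \<open>CS\<close> truncates C_epsilon in the same way.\<close>

definition PS :: "nat set \<Rightarrow> nat \<Rightarrow> hk" where
  "PS S a = prod_list (map (Pf S) [a..<Suc m])"

definition CS :: "nat set \<Rightarrow> nat \<Rightarrow> hk" where
  "CS S a = prod_list (map (\<lambda>i. jucys m (m - i)) (filter (\<lambda>i. i \<in> S) [a..<Suc m]))"

lemma supported_Pf: "1 \<le> k \<Longrightarrow> k \<le> m \<Longrightarrow> supported (2 * m) (Pf S k)"
  by (auto simp: Pf_def intro!: supported_asc)

lemma Ieps_cf: "Ieps m S = cf (PS S 1)"
proof -
  have "map (\<lambda>k. Ipm m (k \<notin> S) (m + 1 - k) (2 * m - k)) [1..<Suc m] = map cf (map (Pf S) [1..<Suc m])"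
    by (auto simp: Ipm_cf Pf_def simp del: upt_Suc)
  then show ?thesis
    unfolding Ieps_def PS_def by (simp only:) (intro hprod_cf, auto intro: supported_Pf)
qed

lemma supported_jucys: "i < m \<Longrightarrow> supported (2 * m) (jucys m i)"
  by (rule supported_galg[OF jucys_galg]) auto

lemma Ceps_cf: "Ceps m S = cf (CS S 1)"
proof -
  have "map (\<lambda>i. cm m (m - i)) (filter (\<lambda>i. i \<in> S) [1..<Suc m])
      = map cf (map (\<lambda>i. jucys m (m - i)) (filter (\<lambda>i. i \<in> S) [1..<Suc m]))"
    by (auto simp: cm_cf simp del: upt_Suc)
  then show ?thesis
    unfolding Ceps_def CS_def by (simp only:) (intro hprod_cf, auto intro!: supported_jucys)
qed

lemma CS_galg: "1 \<le> a \<Longrightarrow> k + a = Suc m \<Longrightarrow> CS S a \<in> galg {Suc m..<m + k}"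
  unfolding CS_def
proof (rule galg_prod_list)
  fix x assume a: "1 \<le> a" "k + a = Suc m" "x \<in> set (map (\<lambda>i. jucys m (m - i)) (filter (\<lambda>i. i \<in> S) [a..<Suc m]))"
  then obtain i where i: "a \<le> i" "i \<le> m" "x = jucys m (m - i)" by auto
  show "x \<in> galg {Suc m..<m + k}"
    unfolding i(3) by (rule galg_mono[OF jucys_galg]) (use a i in auto)
qed

text \<open>Splitting by the sign at the new first index a = m - k yields the two summands in the
  recursion for \<open>Hpart\<close>.\<close>

lemma sum_signs:
  assumes "k \<le> m"
  shows "(\<Sum>S\<in>Pow {Suc m - k..m}. PS S (Suc m - k) * CS S (Suc m - k)) = Hpart m k"
  using assms
proof (induction k)
  case 0
  have "Pow {Suc m..m} = {{}}" by auto
  then show ?case by (simp add: PS_def CS_def)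
next
  case (Suc k)
  define a where "a = m - k"
  have a: "1 \<le> a" "a \<le> m" "Suc m - Suc k = a" "Suc m - k = Suc a" "m - a = k" "m + 1 - a = Suc k"
    using Suc.prems by (auto simp: a_def)
  have upt: "[a..<Suc m] = a # [Suc a..<Suc m]" using a(2) by (simp add: upt_conv_Cons)
  have ins: "{a..m} = insert a {Suc a..m}" using a(2) by auto
  have out: "a \<notin> S" if "S \<in> Pow {Suc a..m}" for S using that by auto
  have tail: "map (Pf (insert a S)) [Suc a..<Suc m] = map (Pf S) [Suc a..<Suc m]"
    "filter (\<lambda>i. i \<in> insert a S) [Suc a..<Suc m] = filter (\<lambda>i. i \<in> S) [Suc a..<Suc m]" for S
    by (auto simp: Pf_def intro!: filter_cong simp del: upt_Suc)
  have neg: "PS (insert a S) a = asc gi (Suc k) m * PS S (Suc a)" "CS (insert a S) a = jucys m k * CS S (Suc a)" for S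
    by (simp_all only: PS_def CS_def upt list.map prod_list.Cons filter.simps tail insertI1 if_True a(5))
      (simp add: Pf_def a(6))
  have pos: "PS S a = asc gs (Suc k) m * PS S (Suc a)" "CS S a = CS S (Suc a)" if "a \<notin> S" for S
    using a(5,6) that unfolding PS_def CS_def upt by (simp_all add: Pf_def[of _ a] del: upt_Suc)
  \<comment> \<open>The new factor stands at the left of C_epsilon, while the recursion has it at
    the right.\<close>
  have cm: "jucys m k * CS S (Suc a) = CS S (Suc a) * jucys m k" for S
    by (rule jucys_comm_galg[OF CS_galg]) (use a Suc.prems in auto)
  have IH: "(\<Sum>S\<in>Pow {Suc a..m}. PS S (Suc a) * CS S (Suc a)) = Hpart m k"
    using Suc a(4) by simp
  have "(\<Sum>S\<in>Pow {a..m}. PS S a * CS S a)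
      = (\<Sum>S\<in>Pow {Suc a..m}. PS S a * CS S a) + (\<Sum>S\<in>insert a ` Pow {Suc a..m}. PS S a * CS S a)"
    unfolding ins Pow_insert by (rule sum.union_disjoint) auto
  also have "(\<Sum>S\<in>insert a ` Pow {Suc a..m}. PS S a * CS S a)
      = (\<Sum>S\<in>Pow {Suc a..m}. PS (insert a S) a * CS (insert a S) a)"
  proof (rule sum.reindex_cong[OF _ refl refl])
    show "inj_on (insert a) (Pow {Suc a..m})" using out by (intro inj_onI) (metis insert_ident)
  qed
  also have "\<dots> = (\<Sum>S\<in>Pow {Suc a..m}. asc gi (Suc k) m * (PS S (Suc a) * CS S (Suc a)) * jucys m k)"
    by (rule sum.cong) (auto simp: neg cm mult.assoc)
  also have "\<dots> = asc gi (Suc k) m * Hpart m k * jucys m k"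
    unfolding IH[symmetric] sum_distrib_left sum_distrib_right ..
  also have "(\<Sum>S\<in>Pow {Suc a..m}. PS S a * CS S a)
      = (\<Sum>S\<in>Pow {Suc a..m}. asc gs (Suc k) m * (PS S (Suc a) * CS S (Suc a)))"
    by (rule sum.cong) (auto simp: pos out mult.assoc)
  also have "\<dots> = asc gs (Suc k) m * Hpart m k"
    unfolding IH[symmetric] sum_distrib_left ..
  finally show ?case by (simp only: a(3) Hpart.simps)
qed

lemma supported_Hpart: "supported (2 * m) (Hpart m m)"
  using Hpart_galg[of m m] by (intro supported_galg) (auto simp: mult_2)

lemma H1_cf: "H1 m = cf (sc (vv ^ (m * (2 * m - 1))) * Hpart m m)"
proof -
  have "hmul (2 * m) (Ieps m S) (Ceps m S) = cf (PS S 1 * CS S 1)" for S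
  proof -
    have "supported (2 * m) (PS S 1)"
      unfolding PS_def by (intro supported_prod_list) (auto intro: supported_Pf)
    moreover have "supported (2 * m) (CS S 1)"
      by (rule supported_galg[OF CS_galg[of 1 m]]) auto
    ultimately show ?thesis by (simp add: Ieps_cf Ceps_cf hmul_cf)
  qed
  moreover have s1: "Suc m - m = 1" by simp
  ultimately have "hsum (Pow {1..m}) (\<lambda>S. hmul (2 * m) (Ieps m S) (Ceps m S)) = cf (Hpart m m)"
    using sum_signs[of m] unfolding s1 by (simp add: hsum_cf)
  then show ?thesis by (simp add: H1_def hscale_cf)
qed

text \<open>This is b_1: the powers of v in H_1 and in its normalisation cancel, and the second
  factor is the bar image of gamma.\<close>

definition hb1 :: hk where "hb1 = Hpart m m * half_twist_inv m m"

lemma half_twist_Y: "half_twist m m \<in> galg (young_gens m)" "half_twist_inv m m \<in> galg (young_gens m)"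
  by (rule galg_mono[OF half_twist_galg(1)] galg_mono[OF half_twist_galg(2)]; auto)+

lemma supported_Y: "x \<in> galg (young_gens m) \<Longrightarrow> supported (2 * m) x"
  by (rule supported_galg) auto

lemma supported_hb1: "supported (2 * m) hb1"
  unfolding hb1_def by (intro supported_times supported_Hpart supported_Y half_twist_Y)

lemma gamma_bar_cf: "hbar (2 * m) (gamma m) = cf (half_twist_inv m m)"
  unfolding gamma_def Ib_cf[OF w0_shift_perms] bI_w0_shift
  using hbar_cf[OF supported_Y[OF half_twist_Y(1)]] by (simp add: bar_half_twist)

lemma b1_cf: "b1 m = cf hb1"
proof -
  have "supported (2 * m) (sc (vv ^ (m * (2 * m - 1))) * Hpart m m)"
    by (intro supported_times supported_sc supported_Hpart)
  then show ?thesis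
    unfolding b1_def H1_cf gamma_bar_cf
    by (simp add: hmul_cf[OF _ supported_Y[OF half_twist_Y(2)]] hscale_cf hb1_def mult.assoc[symmetric] sc_mult[symmetric])
qed

definition hIw :: "(nat \<Rightarrow> nat) \<Rightarrow> hk" where
  "hIw x = (if x \<in> young m then bI x else bI (x \<circ> t1 m) * hb1)"

lemma young_perms: "w \<in> young m \<Longrightarrow> w \<in> perms (2 * m)"
  by (simp add: young_def)

lemma finite_young: "finite (young m)"
  by (rule finite_subset[OF _ finite_perms[of "2 * m"]]) (auto simp: young_def)

lemma young_t1: assumes "w \<in> young m" shows "w \<circ> t1 m \<notin> young m"
proof
  assume "w \<circ> t1 m \<in> young m"
  then have "(w \<circ> t1 m) 1 \<in> {1..m}" using young_iff[OF m, of "w \<circ> t1 m" 1] m by auto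
  moreover have "t1 m 1 = m + 1" using m by (simp add: t1_def)
  ultimately show False using young_iff[OF m assms, of "m + 1"] by simp
qed

lemma Iw_cf: "x \<in> wreath m \<Longrightarrow> Iw m x = cf (hIw x)"
proof (cases "x \<in> young m")
  case True
  then show ?thesis by (simp add: Iw_def hIw_def Ib_cf young_perms)
next
  case False
  assume "x \<in> wreath m"
  then obtain w where w: "w \<in> young m" "x = w \<circ> t1 m" using False by (auto simp: wreath_def)
  then have xt: "x \<circ> t1 m = w" using comp_t1_t1[OF m] by simp
  then show ?thesis
    using False young_perms[OF w(1)] by (simp add: Iw_def hIw_def Ib_cf b1_cf hmul_cf supported_bI supported_hb1)
qed

lemma sum_wreath: "sum f (wreath m) = sum f (young m) + (\<Sum>w\<in>young m. f (w \<circ> t1 m))"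
proof -
  have "inj_on (\<lambda>w. w \<circ> t1 m) (young m)"
    using comp_t1_t1[OF m] by (intro inj_onI) metis
  then have "sum f ((\<lambda>w. w \<circ> t1 m) ` young m) = (\<Sum>w\<in>young m. f (w \<circ> t1 m))"
    by (simp add: sum.reindex)
  moreover have "sum f (wreath m) = sum f (young m) + sum f ((\<lambda>w. w \<circ> t1 m) ` young m)"
    unfolding wreath_def using finite_young young_t1 by (intro sum.union_disjoint) auto
  ultimately show ?thesis by simp
qed

lemma hb1_swap: assumes c: "c \<in> galg (young_gens m)" shows "\<exists>d\<in>galg (young_gens m). hb1 * c = d * hb1"
proof -
  obtain d where d: "d \<in> galg (young_gens m)" "Hpart m m * (half_twist_inv m m * c * half_twist m m) = d * Hpart m m"
    using Hpart_swap'[OF m galg.mult[OF galg.mult[OF half_twist_Y(2) c] half_twist_Y(1)]] by blast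
  have "hb1 * c = Hpart m m * (half_twist_inv m m * c * half_twist m m) * half_twist_inv m m"
    by (simp add: hb1_def mult.assoc half_twist_half_twist_inv)
  also have "\<dots> = d * hb1" unfolding d(2) by (simp add: hb1_def mult.assoc)
  finally show ?thesis using d(1) by blast
qed

lemma hb1_square: "hb1 * hb1 \<in> galg (young_gens m)"
proof -
  obtain d where d: "d \<in> galg (young_gens m)" "half_twist_inv m m * Hpart m m = Hpart m m * d"
    using Hpart_swap[OF m half_twist_Y(2)] by blast
  have "hb1 * hb1 = Hpart m m * (half_twist_inv m m * Hpart m m) * half_twist_inv m m" by (simp add: hb1_def mult.assoc)
  then have "hb1 * hb1 = (Hpart m m * Hpart m m) * d * half_twist_inv m m" unfolding d(2) by (simp add: mult.assoc)
  then show ?thesis using d half_twist_Y Hpart_square[OF m] by (auto intro: galg.mult)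
qed

text \<open>R equals b_1 gamma, and gamma moves to the left of R by the exchange of the
  blocks.\<close>

lemma Hpart_hb1: "\<exists>d\<in>galg (young_gens m). Hpart m m = d * hb1"
proof -
  obtain d where d: "d \<in> galg (young_gens m)" "Hpart m m * half_twist m m = d * Hpart m m" using Hpart_swap'[OF m half_twist_Y(1)] by blast
  have "Hpart m m = Hpart m m * half_twist m m * half_twist_inv m m" by (simp add: mult.assoc half_twist_half_twist_inv)
  then have "Hpart m m = d * hb1" unfolding d(2) by (simp add: hb1_def mult.assoc)
  then show ?thesis using d(1) by blast
qed

text \<open>For closure under products, b_1 is moved past Young coefficients by
  \<open>hb1_swap\<close> and its square is absorbed by \<open>hb1_square\<close>.\<close>

lemma hu_alg_decompose:
  assumes "h \<in> hu_alg m"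
  shows "\<exists>p\<in>galg (young_gens m). \<exists>q\<in>galg (young_gens m). h = cf (p + q * hb1)"
  using assms
proof (induction rule: hu_alg.induct)
  case (gen_T i)
  have "Tb (sref i) = cf (sc vv * gs i + 0 * hb1)"
    using gen_T by (simp add: cf_sc_mult cf_gs) (simp add: hscale_def mult.assoc[symmetric])
  moreover have "sc vv * gs i \<in> galg (young_gens m)" using gen_T by (intro galg.mult galg.scalar galg.gen) auto
  ultimately show ?case using galg_0 by blast
next
  case gen_H1
  obtain d where d: "d \<in> galg (young_gens m)" "Hpart m m = d * hb1" using Hpart_hb1 by blast
  let ?c = "sc (vv ^ (m * (2 * m - 1)))"
  have "H1 m = cf (0 + (?c * d) * hb1)" unfolding H1_cf by (subst d(2)) (simp add: mult.assoc)
  moreover have "?c * d \<in> galg (young_gens m)" by (intro galg.mult galg.scalar is_lpoly_power is_lpoly_vv d(1))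
  ultimately show ?case using galg_0 by blast
next
  case one
  have "hone = cf (1 + 0 * hb1)" by (simp add: cf_one)
  then show ?case using galg_0 galg_1 by blast
next
  case (add a b)
  then obtain p q r s where pq: "p \<in> galg (young_gens m)" "q \<in> galg (young_gens m)" "a = cf (p + q * hb1)"
    and rs: "r \<in> galg (young_gens m)" "s \<in> galg (young_gens m)" "b = cf (r + s * hb1)" by blast
  have "hadd a b = cf ((p + r) + (q + s) * hb1)" by (simp add: pq rs hadd_cf algebra_simps)
  then show ?case using galg.add[OF pq(1) rs(1)] galg.add[OF pq(2) rs(2)] by blast
next
  case (mul a b)
  then obtain p q r s where pq: "p \<in> galg (young_gens m)" "q \<in> galg (young_gens m)" "a = cf (p + q * hb1)"
    and rs: "r \<in> galg (young_gens m)" "s \<in> galg (young_gens m)" "b = cf (r + s * hb1)" by blast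
  obtain r' where r': "r' \<in> galg (young_gens m)" "hb1 * r = r' * hb1" using hb1_swap[OF rs(1)] by blast
  obtain s' where s': "s' \<in> galg (young_gens m)" "hb1 * s = s' * hb1" using hb1_swap[OF rs(2)] by blast
  have s: "supported (2 * m) (p + q * hb1)" "supported (2 * m) (r + s * hb1)"
    by (rule supported_plus supported_times supported_hb1 supported_Y[OF pq(1)] supported_Y[OF pq(2)]
        supported_Y[OF rs(1)] supported_Y[OF rs(2)])+
  have "(p + q * hb1) * (r + s * hb1) = p * r + p * s * hb1 + q * (hb1 * r) + q * (hb1 * s) * hb1"
    by (simp add: algebra_simps)
  also have "\<dots> = (p * r + q * s' * (hb1 * hb1)) + (p * s + q * r') * hb1"
    unfolding r'(2) s'(2) by (simp add: algebra_simps)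
  finally have "hmul (2 * m) a b = cf ((p * r + q * s' * (hb1 * hb1)) + (p * s + q * r') * hb1)"
    unfolding pq(3) rs(3) hmul_cf[OF s] by simp
  moreover have "p * r + q * s' * (hb1 * hb1) \<in> galg (young_gens m)" "p * s + q * r' \<in> galg (young_gens m)"
    using pq rs r' s' hb1_square by (auto intro!: galg.add galg.mult)
  ultimately show ?case by blast
next
  case (scale c a)
  then obtain p q where pq: "p \<in> galg (young_gens m)" "q \<in> galg (young_gens m)" "a = cf (p + q * hb1)" by blast
  have "hscale c a = cf (sc c * p + (sc c * q) * hb1)"
    by (simp add: pq(3) hscale_cf distrib_left mult.assoc)
  moreover have "sc c * p \<in> galg (young_gens m)" "sc c * q \<in> galg (young_gens m)"
    using pq scale(1) by (auto intro!: galg.mult galg.scalar)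
  ultimately show ?case by blast
qed

lemma galg_hu: "x \<in> galg (young_gens m) \<Longrightarrow> cf x \<in> hu_alg m"
proof (induction rule: galg.induct)
  case (gen i)
  then have "hscale vinv (Tb (sref i)) \<in> hu_alg m" by (intro hu_alg.scale hu_alg.gen_T is_lpoly_vv) auto
  then show ?case using gen by (simp add: cf_gs)
next
  case (scalar c)
  then show ?case unfolding cf_sc by (intro hu_alg.scale hu_alg.one)
next
  case (add x y)
  then show ?case unfolding cf_plus by (intro hu_alg.add)
next
  case (mult x y)
  then show ?case
    using hmul_cf[OF supported_Y[of x] supported_Y[of y]] hu_alg.mul[of "cf x" m "cf y"] by simp
qed

lemma hb1_hu: "cf hb1 \<in> hu_alg m"
proof -
  have "hmul (2 * m) (H1 m) (cf (half_twist_inv m m)) \<in> hu_alg m"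
    by (intro hu_alg.mul hu_alg.gen_H1 galg_hu half_twist_Y)
  then have "b1 m \<in> hu_alg m"
    unfolding b1_def gamma_bar_cf by (intro hu_alg.scale is_lpoly_power is_lpoly_vv)
  then show ?thesis by (simp add: b1_cf)
qed

lemma young_expand:
  assumes "\<And>w. co p w \<noteq> 0 \<Longrightarrow> w \<in> young m"
  shows "p = (\<Sum>w\<in>young m. sc (co p w) * bI w)"
proof (rule hk_expand_on)
  show "finite (young m)" by (rule finite_young)
qed (use assms young_perms perms_fperm in auto)

lemma sum_hIw: "(\<Sum>x\<in>wreath m. sc (c x) * hIw x)
    = (\<Sum>w\<in>young m. sc (c w) * bI w) + (\<Sum>w\<in>young m. sc (c (w \<circ> t1 m)) * bI w) * hb1"
proof -
  have "(\<Sum>w\<in>young m. sc (c (w \<circ> t1 m)) * hIw (w \<circ> t1 m)) = (\<Sum>w\<in>young m. sc (c (w \<circ> t1 m)) * bI w * hb1)"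
    using young_t1 comp_t1_t1[OF m] by (intro sum.cong) (simp_all add: hIw_def mult.assoc del: comp_apply)
  moreover have "(\<Sum>w\<in>young m. sc (c w) * hIw w) = (\<Sum>w\<in>young m. sc (c w) * bI w)"
    by (intro sum.cong) (simp_all add: hIw_def)
  ultimately show ?thesis by (simp add: sum_wreath sum_distrib_right del: comp_apply)
qed

lemma hsum_Iw: "A \<subseteq> wreath m \<Longrightarrow> hsum A (\<lambda>x. hscale (c x) (Iw m x)) = cf (\<Sum>x\<in>A. sc (c x) * hIw x)"
proof -
  assume A: "A \<subseteq> wreath m"
  have "hsum A (\<lambda>x. hscale (c x) (Iw m x)) = hsum A (\<lambda>x. cf (sc (c x) * hIw x))"
    unfolding hsum_def using A by (intro ext sum.cong) (auto simp: Iw_cf hscale_cf)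
  then show ?thesis by (simp add: hsum_cf)
qed

lemma co_young_sum: "w \<in> young m \<Longrightarrow> co (\<Sum>u\<in>young m. sc (c u) * bI u) w = c w"
proof -
  assume w: "w \<in> young m"
  have "co (\<Sum>u\<in>young m. sc (c u) * bI u) w = (\<Sum>u\<in>young m. if w = u then c u else 0)"
    unfolding co_sum by (intro sum.cong) (auto simp: co_bI perms_fperm[OF young_perms])
  then show ?thesis using finite_young w by simp
qed

lemma young_sum_galg: "(\<And>w. w \<in> young m \<Longrightarrow> is_lpoly (c w)) \<Longrightarrow> (\<Sum>u\<in>young m. sc (c u) * bI u) \<in> galg (young_gens m)"
  by (intro galg_sum galg.mult galg.scalar bI_young[OF m])

lemma Iw_hu: "x \<in> wreath m \<Longrightarrow> Iw m x \<in> hu_alg m"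
proof -
  assume x: "x \<in> wreath m"
  show ?thesis
  proof (cases "x \<in> young m")
    case True
    then show ?thesis using x by (simp add: Iw_cf hIw_def galg_hu bI_young[OF m])
  next
    case False
    then obtain w where "w \<in> young m" "x = w \<circ> t1 m" using x by (auto simp: wreath_def)
    then have w: "x \<circ> t1 m \<in> young m" using comp_t1_t1[OF m] by simp
    have "hmul (2 * m) (cf (bI (x \<circ> t1 m))) (cf hb1) \<in> hu_alg m"
      by (intro hu_alg.mul galg_hu bI_young[OF m] w hb1_hu)
    then show ?thesis
      using False w x
      by (simp add: Iw_cf hIw_def hmul_cf supported_Y[OF bI_young[OF m w]] supported_hb1 del: comp_apply)
  qed
qed

lemma hu_span:
  assumes "h \<in> hu_alg m"
  shows "\<exists>c. (\<forall>x. is_lpoly (c x)) \<and> h = hsum (wreath m) (\<lambda>x. hscale (c x) (Iw m x))"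
proof -
  obtain p q where p: "p \<in> galg (young_gens m)" and q: "q \<in> galg (young_gens m)" and h: "h = cf (p + q * hb1)"
    using hu_alg_decompose[OF assms] by blast
  define c where "c x = (if x \<in> young m then co p x else co q (x \<circ> t1 m))" for x
  have "is_lpoly (c x)" for x using p q by (simp add: c_def galg_young_iff[OF m] lpoly_co_def)
  moreover have "(\<Sum>w\<in>young m. sc (c w) * bI w) = p"
    using p young_expand[of p] by (simp add: c_def galg_young_iff[OF m])
  moreover have "(\<Sum>w\<in>young m. sc (c (w \<circ> t1 m)) * bI w) = q"
  proof -
    have "(\<Sum>w\<in>young m. sc (c (w \<circ> t1 m)) * bI w) = (\<Sum>w\<in>young m. sc (co q w) * bI w)"
      using young_t1 comp_t1_t1[OF m] by (intro sum.cong) (simp_all add: c_def del: comp_apply)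
    then show ?thesis using q young_expand[of q] by (simp add: galg_young_iff[OF m])
  qed
  ultimately show ?thesis unfolding h by (intro exI[of _ c]) (simp add: hsum_Iw sum_hIw del: comp_apply)
qed

lemma Iw_independent:
  assumes c: "\<forall>x\<in>wreath m. is_lpoly (c x)"
    and z: "hsum (wreath m) (\<lambda>x. hscale (c x) (Iw m x)) = hzero"
    and x: "x \<in> wreath m"
  shows "c x = 0"
proof -
  define p where "p = (\<Sum>w\<in>young m. sc (c w) * bI w)"
  define q where "q = (\<Sum>w\<in>young m. sc (c (w \<circ> t1 m)) * bI w)"
  have p: "p \<in> galg (young_gens m)" and q: "q \<in> galg (young_gens m)"
    unfolding p_def q_def using c by (auto intro!: young_sum_galg simp: wreath_def)
  have "cf (p + q * hb1) = cf 0"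
    using z unfolding hsum_Iw[OF order_refl] sum_hIw p_def[symmetric] q_def[symmetric] by (simp add: cf_zero)
  then have pq: "p + q * hb1 = 0" by (simp add: cf_inject)
  \<comment> \<open>\<open>Hpart_independent\<close> expects the coefficient to the right of R, so q
    is moved across; the reverse relation leads back to q.\<close>
  obtain d where d: "d \<in> galg (young_gens m)" "q * Hpart m m = Hpart m m * d" "d * Hpart m m = Hpart m m * q"
    using Hpart_swap[OF m q] by blast
  have "p + Hpart m m * (d * half_twist_inv m m) = 0"
    using pq d(2) by (simp add: hb1_def mult.assoc[symmetric])
  from Hpart_independent[OF m this p galg.mult[OF d(1) half_twist_Y(2)]]
  have p0: "p = 0" and d0: "d * half_twist_inv m m = 0" by auto
  \<comment> \<open>Invertibility of gamma removes it; the resulting R q = 0 is a second instance of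
    independence, with first coefficient 0.\<close>
  have "d = d * half_twist_inv m m * half_twist m m" by (simp add: mult.assoc half_twist_half_twist_inv)
  then have "d = 0" using d0 by simp
  then have "0 + Hpart m m * q = 0" using d(3) by simp
  then have q0: "q = 0" using Hpart_independent(2)[OF m _ galg_0 q] by blast
  show ?thesis
  proof (cases "x \<in> young m")
    case True
    then show ?thesis using co_young_sum[OF True, of c] p0 by (simp add: p_def)
  next
    case False
    then obtain w where w: "w \<in> young m" "x = w \<circ> t1 m" using x by (auto simp: wreath_def)
    have "co q w = c (w \<circ> t1 m)" unfolding q_def by (rule co_young_sum[OF w(1)])
    then show ?thesis using q0 w(2) by simp
  qed
qed

lemma barI_young:
  assumes w: "w \<in> young m"
  shows "barI w = bI w + (\<Sum>y | y \<in> young m \<and> bruhat_lt (2 * m) y w. sc (co (barI w) y) * bI y)"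
proof -
  let ?S = "{y. y \<in> young m \<and> bruhat_lt (2 * m) y w}"
  have fin: "finite ?S" by (rule finite_subset[OF _ finite_young]) auto
  note b = barI_bruhat[OF young_perms[OF w]]
  have "barI w = (\<Sum>y\<in>insert w ?S. sc (co (barI w) y) * bI y)"
  proof (rule hk_expand_on)
    fix y assume "co (barI w) y \<noteq> 0"
    then have le: "bruhat_le (2 * m) y w" using b by blast
    then show "y \<in> insert w ?S" using young_bruhat_le[OF m le w] by (auto simp: bruhat_lt_def)
  qed (use fin w young_perms perms_fperm in auto)
  also have "\<dots> = sc (co (barI w) w) * bI w + (\<Sum>y\<in>?S. sc (co (barI w) y) * bI y)"
    by (rule sum.insert[OF fin]) (simp add: bruhat_lt_def)
  finally show ?thesis using b by simp
qed

lemma lpoly_co_barI: "w \<in> perms n \<Longrightarrow> lpoly_co (barI w)"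
  using barI_inverse by (intro lpoly_co_galg[of _ "{1..<n}"]) auto

lemma finite_wreath: "finite (wreath m)"
  by (simp add: wreath_def finite_young)

text \<open>On the Young subgroup this is the triangularity of \<open>barI\<close>. On the other
  coset bar invariance of b_1 gives bar(I_w b_1) = bar(I_w) b_1, and \<open>bruhat_le_t1\<close>
  transports the order.\<close>

lemma hbar_Iw:
  assumes x: "x \<in> wreath m"
  shows "\<exists>c. (\<forall>y. is_lpoly (c y)) \<and>
    hbar (2 * m) (Iw m x) =
      hadd (Iw m x) (hsum {y \<in> wreath m. bruhat_lt (2 * m) y x} (\<lambda>y. hscale (c y) (Iw m y)))"
proof -
  let ?A = "{y \<in> wreath m. bruhat_lt (2 * m) y x}"
  have main: "?thesis" if c: "\<And>y. is_lpoly (c y)"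
    and e: "supported (2 * m) (hIw x)" "bar (hIw x) = hIw x + (\<Sum>y\<in>?A. sc (c y) * hIw y)" for c
  proof (intro exI[of _ c] conjI allI c)
    have "hbar (2 * m) (Iw m x) = cf (hIw x + (\<Sum>y\<in>?A. sc (c y) * hIw y))"
      unfolding Iw_cf[OF x] hbar_cf[OF e(1)] e(2) ..
    also have "\<dots> = hadd (Iw m x) (hsum ?A (\<lambda>y. hscale (c y) (Iw m y)))"
      by (subst hsum_Iw) (auto simp: hadd_cf Iw_cf[OF x])
    finally show "hbar (2 * m) (Iw m x) = hadd (Iw m x) (hsum ?A (\<lambda>y. hscale (c y) (Iw m y)))" .
  qed
  show ?thesis
  proof (cases "x \<in> young m")
    case True
    have A: "?A = {y. y \<in> young m \<and> bruhat_lt (2 * m) y x}"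
      using young_bruhat_le[OF m _ True] by (auto simp: bruhat_lt_def wreath_def)
    have "(\<Sum>y\<in>?A. sc (co (barI x) y) * hIw y) = (\<Sum>y\<in>?A. sc (co (barI x) y) * bI y)"
      by (rule sum.cong) (auto simp: A hIw_def)
    then have "bar (hIw x) = hIw x + (\<Sum>y\<in>?A. sc (co (barI x) y) * hIw y)"
      using barI_young[OF True] True by (simp add: hIw_def bar_bI perms_fperm[OF young_perms] A)
    moreover have "supported (2 * m) (hIw x)" using True by (simp add: hIw_def supported_bI young_perms)
    ultimately show ?thesis using lpoly_co_barI[OF young_perms[OF True]] by (intro main) (auto simp: lpoly_co_def)
  next
    case False
    then obtain w where w: "w \<in> young m" "x = w \<circ> t1 m" using x by (auto simp: wreath_def)
    have xw: "hIw x = bI w * hb1" using False w(2) comp_t1_t1[OF m, of w] by (simp add: hIw_def)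
    define S where "S = {y. y \<in> young m \<and> bruhat_lt (2 * m) y w}"
    \<comment> \<open>The permutations below x may include more than the images of those below w,
      Young elements among them; they receive the coefficient 0.\<close>
    define c where "c y = (if y \<notin> young m \<and> y \<circ> t1 m \<in> S then co (barI w) (y \<circ> t1 m) else 0)" for y
    have "lpoly_co hb1"
      unfolding hb1_def using Hpart_galg[of m m] half_twist_Y(2)
      by (intro lpoly_co_galg[of _ "{1..}"]) (auto intro!: galg.mult elim: galg_mono)
    then have "bar (hIw x) = barI w * bar hb1"
      unfolding xw using bar_mult[OF bI_young[OF m w(1)], of hb1] w(1)
      by (simp add: bar_bI perms_fperm[OF young_perms])
    also have "bar hb1 = hb1" unfolding hb1_def by (rule bar_Hpart_half_twist_inv)
    also have "barI w * hb1 = hIw x + (\<Sum>y\<in>S. sc (co (barI w) y) * bI y) * hb1"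
      unfolding xw distrib_right[symmetric] S_def using barI_young[OF w(1)] by simp
    also have "(\<Sum>y\<in>S. sc (co (barI w) y) * bI y) * hb1 = (\<Sum>y\<in>(\<lambda>y. y \<circ> t1 m) ` S. sc (c y) * hIw y)"
    proof -
      have inj: "inj_on (\<lambda>y. y \<circ> t1 m) S" using comp_t1_t1[OF m] by (intro inj_onI) metis
      have "sc (c (y \<circ> t1 m)) * hIw (y \<circ> t1 m) = sc (co (barI w) y) * bI y * hb1" if "y \<in> S" for y
        using that young_t1[of y] comp_t1_t1[OF m, of y] by (simp add: c_def hIw_def S_def mult.assoc del: comp_apply)
      then have "(\<Sum>y\<in>S. sc (c (y \<circ> t1 m)) * hIw (y \<circ> t1 m)) = (\<Sum>y\<in>S. sc (co (barI w) y) * bI y * hb1)"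
        by (rule sum.cong[OF refl])
      then show ?thesis by (simp add: sum.reindex[OF inj] sum_distrib_right)
    qed
    also have "\<dots> = (\<Sum>y\<in>?A. sc (c y) * hIw y)"
    proof (rule sum.mono_neutral_left)
      show "finite ?A" using finite_wreath by simp
      show "(\<lambda>y. y \<circ> t1 m) ` S \<subseteq> ?A"
      proof
        fix u assume "u \<in> (\<lambda>y. y \<circ> t1 m) ` S"
        then obtain y where y: "y \<in> young m" "bruhat_le (2 * m) y w" "y \<noteq> w" "u = y \<circ> t1 m"
          by (auto simp: S_def bruhat_lt_def)
        have "u \<noteq> x" using y w(2) comp_t1_t1[OF m] by metis
        then show "u \<in> ?A"
          using y bruhat_le_t1[OF m y(2) w(1)] w(2) by (auto simp: wreath_def bruhat_lt_def simp del: comp_apply)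
      qed
      show "\<forall>y\<in>?A - (\<lambda>y. y \<circ> t1 m) ` S. sc (c y) * hIw y = 0"
      proof
        fix y assume y: "y \<in> ?A - (\<lambda>y. y \<circ> t1 m) ` S"
        have "y \<circ> t1 m \<notin> S"
        proof
          assume "y \<circ> t1 m \<in> S"
          then have "(y \<circ> t1 m) \<circ> t1 m \<in> (\<lambda>y. y \<circ> t1 m) ` S" by (rule imageI)
          then show False using y comp_t1_t1[OF m, of y] by simp
        qed
        then show "sc (c y) * hIw y = 0" by (simp add: c_def)
      qed
    qed
    finally have "bar (hIw x) = hIw x + (\<Sum>y\<in>?A. sc (c y) * hIw y)" .
    moreover have "supported (2 * m) (hIw x)"
      unfolding xw by (intro supported_times supported_bI supported_hb1 young_perms w(1))
    moreover have "is_lpoly (c y)" for y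
      using lpoly_co_barI[OF young_perms[OF w(1)]] by (simp add: c_def lpoly_co_def)
    ultimately show ?thesis by (intro main) auto
  qed
qed

end

theorem theorem6p12:
  fixes m :: nat
  assumes "1 \<le> m"
  shows "(\<forall>x\<in>wreath m. Iw m x \<in> hu_alg m)
    \<and> (\<forall>h\<in>hu_alg m. \<exists>c. (\<forall>x. is_lpoly (c x)) \<and>
          h = hsum (wreath m) (\<lambda>x. hscale (c x) (Iw m x)))
    \<and> (\<forall>c. (\<forall>x\<in>wreath m. is_lpoly (c x)) \<and>
          hsum (wreath m) (\<lambda>x. hscale (c x) (Iw m x)) = hzero
          \<longrightarrow> (\<forall>x\<in>wreath m. c x = 0))
    \<and> (\<forall>x\<in>wreath m. \<exists>c. (\<forall>y. is_lpoly (c y)) \<and>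
          hbar (2*m) (Iw m x) =
            hadd (Iw m x) (hsum {y \<in> wreath m. bruhat_lt (2*m) y x} (\<lambda>y. hscale (c y) (Iw m y))))"
  using Iw_hu[OF assms] hu_span[OF assms] Iw_independent[OF assms] hbar_Iw[OF assms] by blast

end
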